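(* For every constant $0<\varepsilon<1$ there exist constants $c,C>0$ (depending only on $\varepsilon$) such that for all integers $d\ge2$ and $n\ge1$ there is a distribution over $r\times n$ real matrices $\Pi$ with $r\le Cd^2$, such that every matrix in the support has at most two non-zero entries in each column, the expected number of non-zero entries in each column is at most $1+\varepsilon$, and for every fixed $A\in\mathbb{R}^{n\times d}$, with probability at least $0.99$, simultaneously for all $x\in\mathbb{R}^d$, $$c\log d\,\|Ax\|_1\le\|\Pi Ax\|_1\le Cd\log d\,\|Ax\|_1.$$
   Context: $\|y\|_1=\sum_i|y_i|$. The distribution depends only on $n,d,\varepsilon$, not on $A$. *)

theory Defs
  imports "HOL-Probability.Probability"
begin

text \<open>Matrices of varying size are represented as functions nat => nat => real;
 only the entries with indices below the stated dimensions are relevant.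
 The measurable space of such matrices carries the product (Borel) sigma algebra.\<close>

definition mat_space :: "(nat \<Rightarrow> nat \<Rightarrow> real) measure" where
  "mat_space = PiM UNIV (\<lambda>_. PiM UNIV (\<lambda>_. borel))"

definition col_nnz :: "nat \<Rightarrow> (nat \<Rightarrow> nat \<Rightarrow> real) \<Rightarrow> nat \<Rightarrow> nat" where
  "col_nnz r P j = card {i. i < r \<and> P i j \<noteq> 0}"

definition mat_vec :: "nat \<Rightarrow> (nat \<Rightarrow> nat \<Rightarrow> real) \<Rightarrow> (nat \<Rightarrow> real) \<Rightarrow> nat \<Rightarrow> real" where
  "mat_vec k M v = (\<lambda>i. \<Sum>j<k. M i j * v j)"

definition l1norm :: "nat \<Rightarrow> (nat \<Rightarrow> real) \<Rightarrow> real" where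
  "l1norm m y = (\<Sum>i<m. \<bar>y i\<bar>)"

end

theory Submission
  imports Defs "Jordan_Normal_Form.Determinant" "HOL-Real_Asymp.Real_Asymp"
begin

text \<open>With \<open>D = K d\<close> for a large constant \<open>K\<close>, column \<open>k\<close> gets a uniformly random row \<open>h k\<close> among
  \<open>D\<^sup>2\<close> rows and a random sign. A first block of rows is CountSketch scaled by \<open>D ln d\<close>; a second
  block carries at the same position a heavy-tailed magnitude that equals \<open>2 ^ s\<close> with probability
  \<open>\<epsilon> / 2 ^ (s + 1)\<close> and vanishes otherwise.

  Upper bound: CountSketch never increases the l1 norm, and the heavy-tailed block is evaluated on
  an Auerbach basis, where truncation of the magnitudes costs a factor \<open>O(ln d)\<close>.

  Lower bound: with \<open>D\<^sup>2\<close> rows CountSketch is an l2 subspace embedding, which suffices for \<open>y\<close> with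
  \<open>\<parallel>y\<parallel>\<^sub>2 \<ge> \<parallel>y\<parallel>\<^sub>1 / D\<close>. Any other \<open>y\<close> is spread over about \<open>D\<^sup>2\<close> coordinates, and the heavy-tailed block
  collects a constant amount of mass on each of about \<open>ln D\<close> dyadic scales; this fails with
  probability \<open>exp (- \<Omega>(D powr (3/2)))\<close> only, which beats a net of the subspace.\<close>

subsection \<open>Orthonormal and Auerbach bases\<close>

text \<open>The hard part is the lower bound on spread vectors. Signs may cancel inside a row, no
  moment of the magnitudes is bounded independently of \<open>n\<close>, and yet the failure
  probability must beat a net of exp (O(D ln D)) points. The choice
  \<open>4 ^ N \<le> D < 4 ^ Suc N\<close> is the compromise: \<open>N\<close> is of order ln d, so
  enough scales remain, while counting a row as occupied above a threshold of order
  \<open>1 / 2 ^ N\<close> divides the exponent \<open>D\<^sup>2\<close> only by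
  \<open>2 ^ N\<close>, at most sqrt D. The tail bound follows the Chernoff method, but with a test
  function bounded below in place of exp (- 2 |z|), so that a huge magnitude costs at most a factor
  2. The upper bound is reused in the lower one: the error of rounding to the net is measured by the
  heavy-tailed block on the Auerbach basis, which is of order \<open>d * N\<close>, against an
  allowance of order \<open>\<epsilon> * N * D\<^sup>2\<close>. This makes \<open>K\<close> depend
  on \<open>\<epsilon>\<close>. The weight \<open>D * ln d\<close> of the sign block is the most
  that the upper bound permits, up to constants, and the l2 argument loses just the factor
  \<open>D\<close>.\<close>

definition sqmat :: "nat \<Rightarrow> (nat \<Rightarrow> nat \<Rightarrow> real) \<Rightarrow> real mat" where
  "sqmat m t = mat m m (\<lambda>(i, j). t i j)"

section \<open>Determinants and Cramer's rule\<close>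

lemma sqmat_carrier [simp]: "sqmat m t \<in> carrier_mat m m"
  by (simp add: sqmat_def)

lemma sqmat_index [simp]: "i < m \<Longrightarrow> j < m \<Longrightarrow> sqmat m t $$ (i, j) = t i j"
  by (simp add: sqmat_def)

lemma abs_det_sqmat_le:
  assumes "\<And>i j. i < m \<Longrightarrow> j < m \<Longrightarrow> \<bar>t i j\<bar> \<le> 1"
  shows "\<bar>det (sqmat m t)\<bar> \<le> fact m"
proof -
  have "\<bar>det (sqmat m t)\<bar> \<le> (\<Sum>p | p permutes {0..<m}. \<bar>signof p * (\<Prod>i = 0..<m. sqmat m t $$ (i, p i))\<bar>)"
    by (subst det_def'[of _ m]) (auto intro: sum_abs)
  also have "\<dots> \<le> (\<Sum>p | p permutes {0..<m}. 1)"
  proof (rule sum_mono)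
    fix p assume "p \<in> {p. p permutes {0..<m}}"
    hence p: "p permutes {0..<m}" by simp
    have "(\<Prod>i = 0..<m. \<bar>sqmat m t $$ (i, p i)\<bar>) \<le> (\<Prod>i = 0..<m. 1)"
      using permutes_in_image[OF p] assms by (intro prod_mono) auto
    thus "\<bar>signof p * (\<Prod>i = 0..<m. sqmat m t $$ (i, p i))\<bar> \<le> 1"
      by (simp add: abs_mult abs_prod sign_def)
  qed
  also have "\<dots> = fact m"
    using card_permutations[of "{0..<m}" m] by simp
  finally show ?thesis .
qed

text \<open>The cofactors along row \<open>i\<close> delete that row, hence are those of the
  unmodified \<open>t\<close>. So the determinant is linear in the replaced row.\<close>

lemma cofactor_expansion:
  assumes "i < m"
  shows "det (sqmat m (t(i := z))) = (\<Sum>j<m. z j * cofactor (sqmat m t) i j)"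
proof -
  have "det (sqmat m (t(i := z))) = (\<Sum>j<m. sqmat m (t(i := z)) $$ (i, j) * cofactor (sqmat m (t(i := z))) i j)"
    by (rule laplace_expansion_row) (use assms in auto)
  also have "\<dots> = (\<Sum>j<m. z j * cofactor (sqmat m t) i j)"
  proof (rule sum.cong[OF refl])
    fix j assume j: "j \<in> {..<m}"
    have "mat_delete (sqmat m (t(i := z))) i j = mat_delete (sqmat m t) i j"
      unfolding mat_delete_def using assms j by (auto simp: sqmat_def intro!: cong_mat)
    thus "sqmat m (t(i := z)) $$ (i, j) * cofactor (sqmat m (t(i := z))) i j
            = z j * cofactor (sqmat m t) i j"
      using assms j by (simp add: cofactor_def)
  qed
  finally show ?thesis .
qed

lemma cofactor_orthogonality:
  assumes "i < m" "j < m"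
  shows "(\<Sum>k<m. cofactor (sqmat m t) k i * t k j) = (if i = j then det (sqmat m t) else 0)"
proof -
  have "(adj_mat (sqmat m t) * sqmat m t) $$ (i, j) = (det (sqmat m t) \<cdot>\<^sub>m 1\<^sub>m m) $$ (i, j)"
    using adj_mat(3)[OF sqmat_carrier, of m t] by simp
  moreover have "(adj_mat (sqmat m t) * sqmat m t) $$ (i, j) = (\<Sum>k<m. cofactor (sqmat m t) k i * t k j)"
    using assms unfolding times_mat_def scalar_prod_def adj_mat_def
    by (auto simp: sqmat_def intro!: sum.cong)
  ultimately show ?thesis using assms by simp
qed

text \<open>Cramer's rule, from the adjugate identity after expanding each modified determinant
  along its replaced row. The coordinates are ratios of determinants, which a nearly maximal
  denominator keeps small.\<close>

lemma cramer_rows: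
  assumes "det (sqmat m t) \<noteq> 0" "j < m"
  shows "z j = (\<Sum>k<m. det (sqmat m (t(k := z))) / det (sqmat m t) * t k j)"
proof -
  have "(\<Sum>k<m. det (sqmat m (t(k := z))) * t k j)
      = (\<Sum>k<m. \<Sum>i<m. z i * (cofactor (sqmat m t) k i * t k j))"
    by (intro sum.cong refl) (simp add: cofactor_expansion sum_distrib_right mult.assoc)
  also have "\<dots> = (\<Sum>i<m. z i * (\<Sum>k<m. cofactor (sqmat m t) k i * t k j))"
    by (subst sum.swap) (simp add: sum_distrib_left)
  also have "\<dots> = (\<Sum>i<m. z i * (if i = j then det (sqmat m t) else 0))"
    using assms by (intro sum.cong refl) (simp add: cofactor_orthogonality)
  also have "\<dots> = z j * det (sqmat m t)"
    using assms by (simp add: if_distrib[of "\<lambda>x. _ * x"] cong: if_cong)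
  finally show ?thesis
    using assms by (simp add: sum_divide_distrib[symmetric] field_simps)
qed

text \<open>Gram-Schmidt over the columns of \<open>A\<close>. A column with zero residual adds no
  basis vector, which is how a rank-deficient \<open>A\<close> is covered.\<close>

lemma orthonormal_span:
  fixes A :: "nat \<Rightarrow> nat \<Rightarrow> real"
  shows "\<exists>m\<le>d. \<exists>b :: nat \<Rightarrow> nat \<Rightarrow> real.
    (\<forall>a<m. \<forall>c<m. (\<Sum>k<n. b a k * b c k) = (if a = c then 1 else 0)) \<and>
    (\<forall>j<d. \<exists>z. \<forall>k<n. A k j = (\<Sum>a<m. z a * b a k))"
proof (induction d)
  case 0
  show ?case by (intro exI[of _ 0]) auto
next
  case (Suc d)
  then obtain m b where m: "m \<le> d"
    and ort: "\<And>a c. a < m \<Longrightarrow> c < m \<Longrightarrow> (\<Sum>k<n. b a k * b c k) = (if a = c then 1 else (0::real))"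
    and sp: "\<And>j. j < d \<Longrightarrow> \<exists>z. \<forall>k<n. A k j = (\<Sum>a<m. z a * b a k)"
    by blast
  define w where "w a = (\<Sum>k<n. A k d * b a k)" for a
  define u where "u k = A k d - (\<Sum>a<m. w a * b a k)" for k
  define s where "s = (\<Sum>k<n. u k ^ 2)"
  have u_ort: "(\<Sum>k<n. u k * b c k) = 0" if c: "c < m" for c
  proof -
    have "(\<Sum>k<n. (\<Sum>a<m. w a * b a k) * b c k) = (\<Sum>a<m. w a * (\<Sum>k<n. b a k * b c k))"
      by (simp add: sum_distrib_right sum_distrib_left mult_ac) (rule sum.swap)
    also have "\<dots> = (\<Sum>a<m. w a * (if a = c then 1 else 0))"
      using c by (intro sum.cong) (auto simp: ort)
    also have "\<dots> = w c" using c by (simp add: if_distrib[of "\<lambda>x. _ * x"] cong: if_cong)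
    finally show ?thesis
      by (simp add: u_def left_diff_distrib sum_subtractf w_def)
  qed
  have A_eq: "A k d = (\<Sum>a<m. w a * b a k) + u k" for k by (simp add: u_def)
  show ?case
  proof (cases "s = 0")
    case True
    hence "\<forall>k<n. u k = 0" unfolding s_def by (subst (asm) sum_nonneg_eq_0_iff) auto
    hence "\<exists>z. \<forall>k<n. A k d = (\<Sum>a<m. z a * b a k)" using A_eq by (intro exI[of _ w]) auto
    thus ?thesis using m ort sp by (intro exI[of _ m] conjI exI[of _ b]) (auto simp: less_Suc_eq)
  next
    case False
    have "s \<ge> 0" unfolding s_def by (simp add: sum_nonneg)
    with False have s: "s > 0" by simp
    define b' where "b' = b(m := (\<lambda>k. u k / sqrt s))"
    have 1: "(\<Sum>k<n. b' m k * b' m k) = 1"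
    proof -
      have "(\<Sum>k<n. b' m k * b' m k) = (\<Sum>k<n. u k ^ 2 / s)"
        using s by (intro sum.cong) (auto simp: b'_def power2_eq_square)
      thus ?thesis using s by (simp add: sum_divide_distrib[symmetric] s_def[symmetric])
    qed
    have 2: "(\<Sum>k<n. b' m k * b' c k) = 0" if "c < m" for c
      using that u_ort[OF that] by (simp add: b'_def sum_divide_distrib[symmetric])
    have 3: "(\<Sum>k<n. b' c k * b' m k) = 0" if "c < m" for c
      using 2[OF that] by (simp add: mult.commute)
    have ort': "(\<Sum>k<n. b' a k * b' c k) = (if a = c then 1 else 0)" if "a < Suc m" "c < Suc m" for a c
      using that 1 2 3 ort unfolding less_Suc_eq by (auto simp: b'_def)
    have sp': "\<exists>z. \<forall>k<n. A k j = (\<Sum>a<Suc m. z a * b' a k)" if "j < Suc d" for j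
    proof (cases "j = d")
      case True
      have "\<forall>k<n. A k j = (\<Sum>a<Suc m. (w(m := sqrt s)) a * b' a k)"
        using s True by (auto simp: b'_def A_eq)
      thus ?thesis by blast
    next
      case False
      with that obtain z where "\<forall>k<n. A k j = (\<Sum>a<m. z a * b a k)" using sp[of j] by auto
      hence "\<forall>k<n. A k j = (\<Sum>a<Suc m. (z(m := 0)) a * b' a k)" by (auto simp: b'_def)
      thus ?thesis by blast
    qed
    show ?thesis using m ort' sp' by (intro exI[of _ "Suc m"] conjI exI[of _ b']) auto
  qed
qed

lemma orthonormal_range:
  fixes A :: "nat \<Rightarrow> nat \<Rightarrow> real"
  obtains m b where "m \<le> d"
    "\<And>a c. a < m \<Longrightarrow> c < m \<Longrightarrow> (\<Sum>k<n. b a k * b c k) = (if a = c then 1 else (0::real))"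
    "\<And>x. \<exists>z. \<forall>k<n. mat_vec d A x k = (\<Sum>a<m. z a * b a k)"
proof -
  obtain m b where m: "m \<le> d"
    and ort: "\<forall>a<m. \<forall>c<m. (\<Sum>k<n. b a k * b c k) = (if a = c then 1 else (0::real))"
    and sp: "\<forall>j<d. \<exists>z. \<forall>k<n. A k j = (\<Sum>a<m. z a * b a k)"
    using orthonormal_span[of d n A] by blast
  from sp obtain Z where Z: "\<And>j k. j < d \<Longrightarrow> k < n \<Longrightarrow> A k j = (\<Sum>a<m. Z j a * b a k)" by metis
  have "\<exists>z. \<forall>k<n. mat_vec d A x k = (\<Sum>a<m. z a * b a k)" for x
  proof (intro exI allI impI)
    fix k assume k: "k < n"
    have "mat_vec d A x k = (\<Sum>j<d. \<Sum>a<m. Z j a * x j * b a k)"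
      unfolding mat_vec_def using Z k by (auto simp: sum_distrib_left sum_distrib_right mult_ac intro!: sum.cong)
    also have "\<dots> = (\<Sum>a<m. (\<Sum>j<d. Z j a * x j) * b a k)"
      by (subst sum.swap) (simp add: sum_distrib_right)
    finally show "mat_vec d A x k = (\<Sum>a<m. (\<Sum>j<d. Z j a * x j) * b a k)" .
  qed
  with m ort that show ?thesis by blast
qed

text \<open>The coordinate is an inner product with \<open>b c\<close>, a unit vector, whose entries
  therefore lie in [-1, 1]. This confines the l1 unit ball to a box of coefficients, on which
  determinants are bounded.\<close>

lemma abs_coord_le_l1:
  fixes b :: "nat \<Rightarrow> nat \<Rightarrow> real"
  assumes ort: "\<And>a c. a < m \<Longrightarrow> c < m \<Longrightarrow> (\<Sum>k<n. b a k * b c k) = (if a = c then 1 else (0::real))"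
    and c: "c < m"
  shows "\<bar>z c\<bar> \<le> (\<Sum>k<n. \<bar>\<Sum>a<m. z a * b a k\<bar>)"
proof -
  have b1: "\<bar>b c k\<bar> \<le> 1" if "k < n" for k
  proof -
    have "b c k ^ 2 \<le> (\<Sum>k<n. b c k ^ 2)"
      using that by (intro member_le_sum) auto
    also have "\<dots> = 1" using ort[OF c c] by (simp add: power2_eq_square)
    finally show ?thesis by (simp add: abs_square_le_1)
  qed
  have "(\<Sum>k<n. (\<Sum>a<m. z a * b a k) * b c k) = (\<Sum>a<m. z a * (\<Sum>k<n. b a k * b c k))"
    by (simp add: sum_distrib_right sum_distrib_left mult_ac) (rule sum.swap)
  also have "\<dots> = (\<Sum>a<m. z a * (if a = c then 1 else 0))"
    using c by (intro sum.cong) (auto simp: ort)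
  also have "\<dots> = z c" using c by (simp add: if_distrib[of "\<lambda>x. _ * x"] cong: if_cong)
  finally have "\<bar>z c\<bar> = \<bar>\<Sum>k<n. (\<Sum>a<m. z a * b a k) * b c k\<bar>" by simp
  also have "\<dots> \<le> (\<Sum>k<n. \<bar>\<Sum>a<m. z a * b a k\<bar> * \<bar>b c k\<bar>)"
    by (rule order.trans[OF sum_abs]) (simp add: abs_mult)
  also have "\<dots> \<le> (\<Sum>k<n. \<bar>\<Sum>a<m. z a * b a k\<bar> * 1)"
    using b1 by (intro sum_mono mult_left_mono) auto
  finally show ?thesis by simp
qed

text \<open>An Auerbach basis up to a factor of two: the rows of a coefficient matrix in the
  unit ball whose determinant is within a factor two of the supremum. Replacing a row by another
  unit vector multiplies the determinant by the corresponding coordinate.\<close>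

lemma auerbach_coefficients:
  fixes b :: "nat \<Rightarrow> nat \<Rightarrow> real"
  assumes ort: "\<And>a c. a < m \<Longrightarrow> c < m \<Longrightarrow> (\<Sum>k<n. b a k * b c k) = (if a = c then 1 else (0::real))"
  obtains t :: "nat \<Rightarrow> nat \<Rightarrow> real" where
    "\<And>i. i < m \<Longrightarrow> (\<Sum>k<n. \<bar>\<Sum>a<m. t i a * b a k\<bar>) \<le> 1"
    "\<And>z. \<exists>\<alpha>. (\<forall>a<m. z a = (\<Sum>i<m. \<alpha> i * t i a)) \<and>
       (\<forall>i<m. \<bar>\<alpha> i\<bar> \<le> 2 * (\<Sum>k<n. \<bar>\<Sum>a<m. z a * b a k\<bar>))"
proof -
  define N where "N z = (\<Sum>k<n. \<bar>\<Sum>a<m. z a * b a k\<bar>)" for z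
  define F where "F = {t. \<forall>i<m. N (t i) \<le> 1}"
  define D where "D = (\<lambda>t. \<bar>det (sqmat m t)\<bar>) ` F"
  have N_scale: "N (\<lambda>a. c * z a) = \<bar>c\<bar> * N z" for c z
    by (simp add: N_def sum_distrib_left abs_mult[symmetric] mult.assoc)
  have N_nonneg: "N z \<ge> 0" for z by (simp add: N_def sum_nonneg)
  have coord: "\<bar>z c\<bar> \<le> N z" if "c < m" for z c
    unfolding N_def by (rule abs_coord_le_l1[OF ort that])
  have bdd: "bdd_above D"
    unfolding D_def
  proof (rule bdd_aboveI2)
    fix t assume "t \<in> F"
    thus "\<bar>det (sqmat m t)\<bar> \<le> fact m"
      by (intro abs_det_sqmat_le) (auto simp: F_def intro: order.trans[OF coord])
  qed
  \<comment> \<open>Normalized standard unit vectors give a positive determinant. The supremum is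
    then positive, and half of it is strictly smaller.\<close>
  have pos: "\<exists>x\<in>D. x > 0"
  proof -
    define e where "e i = (\<lambda>a. if a = i then 1 else (0::real))" for i :: nat
    define t0 where "t0 i a = (1 / N (e i)) * e i a" for i a
    have Ne: "N (e i) > 0" if "i < m" for i
      using coord[OF that, of "e i"] by (simp add: e_def)
    have "t0 \<in> F" unfolding F_def
    proof safe
      fix i assume i: "i < m"
      have "N (t0 i) = \<bar>1 / N (e i)\<bar> * N (e i)" unfolding t0_def by (rule N_scale)
      thus "N (t0 i) \<le> 1" using Ne[OF i] by simp
    qed
    moreover have "det (sqmat m t0) = (\<Prod>i<m. 1 / N (e i))"
    proof -
      have "det (sqmat m t0) = prod_list (diag_mat (sqmat m t0))"
        by (rule det_lower_triangular[of m]) (auto simp: t0_def e_def)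
      also have "\<dots> = (\<Prod>i = 0..<m. sqmat m t0 $$ (i, i))"
        by (simp add: prod_list_diag_prod sqmat_def)
      also have "\<dots> = (\<Prod>i = 0..<m. 1 / N (e i))"
        by (intro prod.cong) (auto simp: t0_def e_def)
      finally show ?thesis by (simp add: atLeast0LessThan)
    qed
    moreover have "(\<Prod>i<m. 1 / N (e i)) > 0" using Ne by (intro prod_pos) auto
    ultimately show ?thesis unfolding D_def by (intro bexI[OF _ imageI[of t0]]) simp_all
  qed
  have sup_pos: "Sup D > 0" using pos bdd cSup_upper by fastforce
  have "D \<noteq> {}" using pos by auto
  moreover have "Sup D / 2 < Sup D" using sup_pos by simp
  ultimately obtain t where t: "t \<in> F" "Sup D / 2 < \<bar>det (sqmat m t)\<bar>"
    unfolding less_cSup_iff[OF \<open>D \<noteq> {}\<close> bdd] by (auto simp: D_def)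
  have det0: "det (sqmat m t) \<noteq> 0" using t(2) sup_pos by auto
  show ?thesis
  proof (rule that[of t])
    show "(\<Sum>k<n. \<bar>\<Sum>a<m. t i a * b a k\<bar>) \<le> 1" if "i < m" for i
      using t(1) that by (auto simp: F_def N_def)
    fix z :: "nat \<Rightarrow> real"
    define \<alpha> where "\<alpha> k = det (sqmat m (t(k := z))) / det (sqmat m t)" for k
    have "\<forall>a<m. z a = (\<Sum>i<m. \<alpha> i * t i a)"
      unfolding \<alpha>_def using cramer_rows[OF det0] by blast
    moreover have "\<bar>\<alpha> i\<bar> \<le> 2 * N z" if i: "i < m" for i
    proof (cases "N z = 0")
      case True
      hence "z j = 0" if "j < m" for j using coord[OF that, of z] by simp
      hence "det (sqmat m (t(i := z))) = 0" using i by (subst cofactor_expansion) auto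
      thus ?thesis using True by (simp add: \<alpha>_def)
    next
      case False
      hence Nz: "N z > 0" using N_nonneg[of z] by simp
      define z' where "z' a = (1 / N z) * z a" for a
      have "N z' = 1" using Nz N_scale[of "1 / N z" z] by (simp add: z'_def[abs_def])
      hence "t(i := z') \<in> F" using t(1) by (auto simp: F_def)
      hence "\<bar>det (sqmat m (t(i := z')))\<bar> \<le> Sup D"
        by (intro cSup_upper bdd) (auto simp: D_def)
      moreover have "det (sqmat m (t(i := z'))) = det (sqmat m (t(i := z))) / N z"
        using i by (simp add: cofactor_expansion z'_def sum_divide_distrib)
      ultimately have "\<bar>det (sqmat m (t(i := z)))\<bar> / N z \<le> 2 * \<bar>det (sqmat m t)\<bar>"
        using t(2) Nz by (simp add: abs_divide)
      thus ?thesis using Nz det0 by (simp add: \<alpha>_def abs_divide field_simps)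
    qed
    ultimately show "\<exists>\<alpha>. (\<forall>a<m. z a = (\<Sum>i<m. \<alpha> i * t i a)) \<and>
       (\<forall>i<m. \<bar>\<alpha> i\<bar> \<le> 2 * (\<Sum>k<n. \<bar>\<Sum>a<m. z a * b a k\<bar>))"
      unfolding N_def by blast
  qed
qed

subsection \<open>Expectations over finitely supported distributions\<close>

abbreviation E :: "'a pmf \<Rightarrow> ('a \<Rightarrow> real) \<Rightarrow> real" where
  "E p f \<equiv> measure_pmf.expectation p f"

lemma expectation_pair_pmf_finite:
  assumes p: "finite (set_pmf p)" and q: "finite (set_pmf q)"
  shows "E (pair_pmf p q) f = E p (\<lambda>x. E q (\<lambda>y. f (x, y)))"
proof -
  have "E (pair_pmf p q) f = (\<Sum>x\<in>set_pmf p \<times> set_pmf q. f x * pmf (pair_pmf p q) x)"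
    by (rule integral_measure_pmf_real) (use p q in auto)
  also have "\<dots> = (\<Sum>x\<in>set_pmf p. (\<Sum>y\<in>set_pmf q. f (x, y) * pmf q y) * pmf p x)"
    by (simp add: sum.cartesian_product' pmf_pair sum_distrib_left sum_distrib_right mult_ac)
  also have "\<dots> = E p (\<lambda>x. E q (\<lambda>y. f (x, y)))"
    by (simp add: integral_measure_pmf_real[OF p] integral_measure_pmf_real[OF q])
  finally show ?thesis .
qed

lemma expectation_mono_finite:
  assumes "finite (set_pmf p)" "\<And>x. x \<in> set_pmf p \<Longrightarrow> f x \<le> g x"
  shows "E p f \<le> E p g"
  using assms by (intro integral_mono_AE integrable_measure_pmf_finite) (auto simp: AE_measure_pmf_iff)

lemma expectation_add_finite:
  "finite (set_pmf p) \<Longrightarrow> E p (\<lambda>x. f x + g x) = E p f + E p g"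
  by (intro Bochner_Integration.integral_add integrable_measure_pmf_finite)

lemma expectation_diff_finite:
  "finite (set_pmf p) \<Longrightarrow> E p (\<lambda>x. f x - g x) = E p f - E p g"
  by (intro Bochner_Integration.integral_diff integrable_measure_pmf_finite)

lemma expectation_sum_finite:
  "finite (set_pmf p) \<Longrightarrow> E p (\<lambda>x. \<Sum>i\<in>I. f i x) = (\<Sum>i\<in>I. E p (f i))"
  by (intro Bochner_Integration.integral_sum integrable_measure_pmf_finite)

lemma markov_finite:
  assumes p: "finite (set_pmf p)" and f: "\<And>x. x \<in> set_pmf p \<Longrightarrow> f x \<ge> 0"
    and t: "t > 0" and b: "E p f \<le> b * t"
  shows "measure_pmf.prob p {x. f x \<ge> t} \<le> b"
proof -
  have "measure_pmf.prob p {x. f x \<ge> t} = E p (indicator {x. f x \<ge> t})" by simp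
  also have "\<dots> \<le> E p (\<lambda>x. f x / t)"
    using t f by (intro expectation_mono_finite[OF p]) (auto simp: indicator_def)
  also have "\<dots> = E p f / t" by simp
  also have "\<dots> \<le> b" using b t by (simp add: field_simps)
  finally show ?thesis .
qed

subsection \<open>Random columns and row sums\<close>

text \<open>A column is a triple (row, sign, scale).\<close>

definition col_pmf :: "nat \<Rightarrow> nat pmf \<Rightarrow> (nat \<times> real \<times> nat) pmf" where
  "col_pmf r q = pair_pmf (pmf_of_set {..<r}) (pair_pmf (pmf_of_set {-1, 1}) q)"

text \<open>The index set is a parameter so that moments can be computed by inserting one column at
  a time.\<close>

definition sketch_pmf :: "nat \<Rightarrow> nat pmf \<Rightarrow> nat set \<Rightarrow> (nat \<Rightarrow> nat \<times> real \<times> nat) pmf" where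
  "sketch_pmf r q K = Pi_pmf K (0, 0, 0) (\<lambda>_. col_pmf r q)"

definition entry :: "(nat \<Rightarrow> real) \<Rightarrow> nat \<times> real \<times> nat \<Rightarrow> nat \<Rightarrow> real" where
  "entry g c i = (if fst c = i then fst (snd c) * g (snd (snd c)) else 0)"

text \<open>The coefficient \<open>g k s\<close> may depend on the scale \<open>s\<close>. Functions
  constant in \<open>s\<close> give the sign block, \<open>y k * mag L s\<close> gives the
  heavy-tailed block, and truncated magnitudes fit as well.\<close>

definition rowsum :: "nat set \<Rightarrow> (nat \<Rightarrow> nat \<Rightarrow> real) \<Rightarrow> (nat \<Rightarrow> nat \<times> real \<times> nat) \<Rightarrow> nat \<Rightarrow> real" where
  "rowsum K g \<xi> i = (\<Sum>k\<in>K. entry (g k) (\<xi> k) i)"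

lemma rowsum_insert:
  assumes "finite K" "x \<notin> K"
  shows "rowsum (insert x K) g (\<xi>(x := c)) i = rowsum K g \<xi> i + entry (g x) c i"
proof -
  have "(\<Sum>k\<in>K. entry (g k) ((\<xi>(x := c)) k) i) = (\<Sum>k\<in>K. entry (g k) (\<xi> k) i)"
    using assms by (intro sum.cong) auto
  thus ?thesis using assms by (simp add: rowsum_def)
qed

lemma sum_add_point:
  fixes z :: "nat \<Rightarrow> real" and f :: "nat \<Rightarrow> real \<Rightarrow> real"
  assumes "h < r"
  shows "(\<Sum>i<r. f i (z i + (if h = i then x else 0))) = (\<Sum>i<r. f i (z i)) - f h (z h) + f h (z h + x)"
proof -
  have "(\<Sum>i<r. f i (z i + (if h = i then x else 0)))
      = f h (z h + x) + (\<Sum>i\<in>{..<r}-{h}. f i (z i + (if h = i then x else 0)))"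
    using assms by (subst sum.remove[of _ h]) auto
  also have "(\<Sum>i\<in>{..<r}-{h}. f i (z i + (if h = i then x else 0))) = (\<Sum>i\<in>{..<r}-{h}. f i (z i))"
    by (intro sum.cong) auto
  also have "\<dots> = (\<Sum>i<r. f i (z i)) - f h (z h)"
    using assms by (subst sum.remove[of "{..<r}" h]) auto
  finally show ?thesis by simp
qed

section \<open>Moments of the row sums\<close>

context
  fixes r :: nat and q :: "nat pmf"
  assumes r: "r > 0" and q: "finite (set_pmf q)"
begin

lemma set_col_pmf: "set_pmf (col_pmf r q) = {..<r} \<times> {-1, 1} \<times> set_pmf q"
  using r by (subst col_pmf_def) (simp add: set_pmf_of_set lessThan_empty_iff)

lemma finite_col_pmf [simp]: "finite (set_pmf (col_pmf r q))"
  using q by (simp add: set_col_pmf)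

lemma set_sketch_pmf:
  "finite K \<Longrightarrow> set_pmf (sketch_pmf r q K) = PiE_dflt K (0, 0, 0) (\<lambda>_. {..<r} \<times> {-1, 1} \<times> set_pmf q)"
  unfolding sketch_pmf_def by (simp add: set_Pi_pmf o_def set_col_pmf)

lemma finite_sketch_pmf [simp]: "finite K \<Longrightarrow> finite (set_pmf (sketch_pmf r q K))"
  using q by (auto simp: set_sketch_pmf intro!: finite_PiE_dflt)

lemma expectation_col:
  "E (col_pmf r q) f = (\<Sum>i<r. (E q (\<lambda>s. f (i, 1, s)) + E q (\<lambda>s. f (i, -1, s))) / 2) / r"
proof -
  have "{..<r} \<noteq> {}" using r by (simp add: lessThan_empty_iff)
  thus ?thesis using q
    unfolding col_pmf_def
    by (simp add: expectation_pair_pmf_finite set_pmf_of_set integral_pmf_of_set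
        sum_divide_distrib[symmetric] mult.commute[of 2] add.commute)
qed

text \<open>Both orders of integration are needed: with the old columns fixed, the sign of the new
  one can be averaged; with the new column fixed, it can be treated as part of the initial
  state.\<close>

lemma expectation_sketch_insert:
  assumes K: "finite K" "x \<notin> K"
  shows "E (sketch_pmf r q (insert x K)) F
           = E (sketch_pmf r q K) (\<lambda>\<xi>. E (col_pmf r q) (\<lambda>c. F (\<xi>(x := c))))" (is ?A)
    and "E (sketch_pmf r q (insert x K)) F
           = E (col_pmf r q) (\<lambda>c. E (sketch_pmf r q K) (\<lambda>\<xi>. F (\<xi>(x := c))))" (is ?B)
proof -
  have fin: "finite (set_pmf (sketch_pmf r q K))" using K by simp
  have "E (sketch_pmf r q (insert x K)) F
      = E (pair_pmf (col_pmf r q) (sketch_pmf r q K)) (\<lambda>(c, \<xi>). F (\<xi>(x := c)))"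
    unfolding sketch_pmf_def by (simp add: Pi_pmf_insert[OF K] case_prod_unfold)
  thus ?B using fin by (simp add: expectation_pair_pmf_finite)
  also have "\<dots> = (\<Sum>c\<in>set_pmf (col_pmf r q). (\<Sum>\<xi>\<in>set_pmf (sketch_pmf r q K).
      F (\<xi>(x := c)) * pmf (sketch_pmf r q K) \<xi>) * pmf (col_pmf r q) c)"
    by (simp add: integral_measure_pmf_real[OF finite_col_pmf] integral_measure_pmf_real[OF fin])
  also have "\<dots> = (\<Sum>\<xi>\<in>set_pmf (sketch_pmf r q K). (\<Sum>c\<in>set_pmf (col_pmf r q). 
      F (\<xi>(x := c)) * pmf (col_pmf r q) c) * pmf (sketch_pmf r q K) \<xi>)"
    unfolding sum_distrib_right by (subst sum.swap) (simp add: mult_ac)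
  also have "\<dots> = E (sketch_pmf r q K) (\<lambda>\<xi>. E (col_pmf r q) (\<lambda>c. F (\<xi>(x := c))))"
    by (simp add: integral_measure_pmf_real[OF finite_col_pmf] integral_measure_pmf_real[OF fin])
  finally show ?A .
qed

lemma expectation_sketch_component:
  assumes "finite K" "k \<in> K"
  shows "E (sketch_pmf r q K) (\<lambda>\<xi>. f (\<xi> k)) = E (col_pmf r q) f"
proof -
  have "map_pmf (\<lambda>\<xi>. \<xi> k) (sketch_pmf r q K) = col_pmf r q"
    using assms by (simp add: sketch_pmf_def Pi_pmf_component)
  hence "E (col_pmf r q) f = E (map_pmf (\<lambda>\<xi>. \<xi> k) (sketch_pmf r q K)) f" by simp
  thus ?thesis by simp
qed

text \<open>The fresh sign of an inserted column kills the cross term with the old row sum, so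
  squares simply add up.\<close>

lemma second_moment_rowsum:
  assumes "finite K"
  shows "E (sketch_pmf r q K) (\<lambda>\<xi>. \<Sum>i<r. (rowsum K g \<xi> i)\<^sup>2) = (\<Sum>k\<in>K. E q (\<lambda>s. (g k s)\<^sup>2))"
  using assms
proof (induction K rule: finite_induct)
  case empty
  show ?case by (simp add: rowsum_def)
next
  case (insert x K)
  have step: "E (col_pmf r q) (\<lambda>c. \<Sum>i<r. (rowsum (insert x K) g (\<xi>(x := c)) i)\<^sup>2)
      = (\<Sum>i<r. (rowsum K g \<xi> i)\<^sup>2) + E q (\<lambda>s. (g x s)\<^sup>2)" for \<xi>
  proof -
    define S where "S = (\<Sum>i<r. (rowsum K g \<xi> i)\<^sup>2)"
    have *: "(\<Sum>i<r. (rowsum (insert x K) g (\<xi>(x := (h, \<sigma>, s))) i)\<^sup>2)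
        = S + (2 * \<sigma> * rowsum K g \<xi> h * g x s + (\<sigma> * g x s)\<^sup>2)" if "h < r" for h \<sigma> s
    proof -
      have "(\<Sum>i<r. (rowsum (insert x K) g (\<xi>(x := (h, \<sigma>, s))) i)\<^sup>2)
          = (\<Sum>i<r. (rowsum K g \<xi> i + (if h = i then \<sigma> * g x s else 0))\<^sup>2)"
        unfolding rowsum_insert[OF insert.hyps] by (simp add: entry_def cong: if_cong)
      also have "\<dots> = S - (rowsum K g \<xi> h)\<^sup>2 + (rowsum K g \<xi> h + \<sigma> * g x s)\<^sup>2"
        unfolding S_def by (rule sum_add_point[OF that, of "\<lambda>_ u. u\<^sup>2"])
      finally show ?thesis by (simp add: power2_sum)
    qed
    have "E (col_pmf r q) (\<lambda>c. \<Sum>i<r. (rowsum (insert x K) g (\<xi>(x := c)) i)\<^sup>2)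
       = (\<Sum>i<r. (E q (\<lambda>s. S + (2 * rowsum K g \<xi> i * g x s + (g x s)\<^sup>2))
          + E q (\<lambda>s. S + (- (2 * rowsum K g \<xi> i * g x s) + (g x s)\<^sup>2))) / 2) / r"
      unfolding expectation_col by (intro arg_cong2[where f="(/)"] sum.cong refl) (simp add: *)
    also have "\<dots> = (\<Sum>i<r. (2 * S + 2 * E q (\<lambda>s. (g x s)\<^sup>2)) / 2) / r"
      using q by (simp add: expectation_add_finite expectation_diff_finite)
    also have "\<dots> = S + E q (\<lambda>s. (g x s)\<^sup>2)" using r by (simp add: field_simps)
    finally show ?thesis unfolding S_def .
  qed
  show ?case
    using insert by (simp add: expectation_sketch_insert(1)[OF insert.hyps] step expectation_add_finite)
qed

text \<open>The CountSketch variance bound. The diagonal part of a new column cancels against the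
  exact inner product; what is left carries a random sign, so the squared errors add. It sits in one
  of \<open>r\<close> equally likely rows, hence the factor \<open>1 / r\<close>.\<close>

lemma second_moment_gram:
  fixes a b :: "nat \<Rightarrow> real"
  assumes "finite K"
  shows "E (sketch_pmf r q K) (\<lambda>\<xi>. ((\<Sum>i<r. rowsum K (\<lambda>k _. a k) \<xi> i * rowsum K (\<lambda>k _. b k) \<xi> i)
            - (\<Sum>k\<in>K. a k * b k))\<^sup>2) \<le> 2 / r * ((\<Sum>k\<in>K. (a k)\<^sup>2) * (\<Sum>k\<in>K. (b k)\<^sup>2))"
  using assms
proof (induction K rule: finite_induct)
  case empty
  show ?case by (simp add: rowsum_def)
next
  case (insert x K)
  define za where "za \<xi> = rowsum K (\<lambda>k _. a k) \<xi>" for \<xi>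
  define zb where "zb \<xi> = rowsum K (\<lambda>k _. b k) \<xi>" for \<xi>
  define Q where "Q \<xi> = (\<Sum>i<r. za \<xi> i * zb \<xi> i) - (\<Sum>k\<in>K. a k * b k)" for \<xi>
  \<comment> \<open>The change of the Gram error caused by column \<open>x\<close> is again a row
    sum, of one combined vector, so \<open>second_moment_rowsum\<close> evaluates its
    square.\<close>
  define zc where "zc \<xi> = rowsum K (\<lambda>k _. a x * b k + b x * a k) \<xi>" for \<xi>
  have zc: "zc \<xi> i = a x * zb \<xi> i + b x * za \<xi> i" for \<xi> i
    unfolding zc_def za_def zb_def rowsum_def sum_distrib_left sum.distrib[symmetric]
    by (intro sum.cong) (auto simp: entry_def algebra_simps)
  define \<Phi> where "\<Phi> \<xi> = (\<Sum>i<r. rowsum (insert x K) (\<lambda>k _. a k) \<xi> i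
        * rowsum (insert x K) (\<lambda>k _. b k) \<xi> i) - (\<Sum>k\<in>insert x K. a k * b k)" for \<xi>
  have step: "E (col_pmf r q) (\<lambda>c. (\<Phi> (\<xi>(x := c)))\<^sup>2) = (Q \<xi>)\<^sup>2 + (\<Sum>i<r. (zc \<xi> i)\<^sup>2) / r" for \<xi>
  proof -
    have *: "\<Phi> (\<xi>(x := (h, \<sigma>, s))) = Q \<xi> + \<sigma> * zc \<xi> h" if "h < r" "\<sigma>\<^sup>2 = 1" for h \<sigma> s
    proof -
      have "(\<Sum>i<r. rowsum (insert x K) (\<lambda>k _. a k) (\<xi>(x := (h, \<sigma>, s))) i
        * rowsum (insert x K) (\<lambda>k _. b k) (\<xi>(x := (h, \<sigma>, s))) i)
       = (\<Sum>i<r. za \<xi> i * zb \<xi> i + (if h = i then \<sigma> * zc \<xi> h + \<sigma>\<^sup>2 * a x * b x else 0))"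
        unfolding rowsum_insert[OF insert.hyps] entry_def za_def[symmetric] zb_def[symmetric]
        by (intro sum.cong) (auto simp: zc algebra_simps power2_eq_square)
      also have "\<dots> = (\<Sum>i<r. za \<xi> i * zb \<xi> i) + (\<sigma> * zc \<xi> h + \<sigma>\<^sup>2 * a x * b x)"
        using that(1) by (simp add: sum.distrib)
      finally show ?thesis using insert.hyps that(2) by (simp add: Q_def \<Phi>_def)
    qed
    have "E (col_pmf r q) (\<lambda>c. (\<Phi> (\<xi>(x := c)))\<^sup>2)
       = (\<Sum>i<r. ((Q \<xi> + 1 * zc \<xi> i)\<^sup>2 + (Q \<xi> + (-1) * zc \<xi> i)\<^sup>2) / 2) / r"
      unfolding expectation_col by (intro arg_cong2[where f="(/)"] sum.cong refl) (simp add: *)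
    also have "\<dots> = (\<Sum>i<r. (Q \<xi>)\<^sup>2 + (zc \<xi> i)\<^sup>2) / r"
      by (intro arg_cong2[where f="(/)"] sum.cong refl) (simp add: power2_eq_square algebra_simps)
    also have "\<dots> = (Q \<xi>)\<^sup>2 + (\<Sum>i<r. (zc \<xi> i)\<^sup>2) / r"
      using r by (simp add: sum.distrib add_divide_distrib)
    finally show ?thesis .
  qed
  have fin: "finite (set_pmf (sketch_pmf r q K))" using insert.hyps by simp
  define A where "A = (\<Sum>k\<in>K. (a k)\<^sup>2)"
  define B where "B = (\<Sum>k\<in>K. (b k)\<^sup>2)"
  have "E (sketch_pmf r q K) (\<lambda>\<xi>. (\<Sum>i<r. (zc \<xi> i)\<^sup>2)) = (\<Sum>k\<in>K. (a x * b k + b x * a k)\<^sup>2)"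
    unfolding zc_def by (subst second_moment_rowsum) (use insert.hyps in auto)
  also have "\<dots> \<le> (\<Sum>k\<in>K. 2 * ((a x)\<^sup>2 * (b k)\<^sup>2) + 2 * ((b x)\<^sup>2 * (a k)\<^sup>2))"
  proof (rule sum_mono)
    fix k
    have "0 \<le> (a x * b k - b x * a k)\<^sup>2" by simp
    thus "(a x * b k + b x * a k)\<^sup>2 \<le> 2 * ((a x)\<^sup>2 * (b k)\<^sup>2) + 2 * ((b x)\<^sup>2 * (a k)\<^sup>2)"
      by (simp add: power2_eq_square algebra_simps)
  qed
  also have "\<dots> = 2 * ((a x)\<^sup>2 * B + (b x)\<^sup>2 * A)"
    by (simp add: sum.distrib sum_distrib_left A_def B_def algebra_simps)
  finally have zc_le: "E (sketch_pmf r q K) (\<lambda>\<xi>. (\<Sum>i<r. (zc \<xi> i)\<^sup>2)) \<le> 2 * ((a x)\<^sup>2 * B + (b x)\<^sup>2 * A)" .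
  have IH: "E (sketch_pmf r q K) (\<lambda>\<xi>. (Q \<xi>)\<^sup>2) \<le> 2 / r * (A * B)"
    using insert.IH by (simp add: Q_def za_def zb_def A_def B_def)
  have "E (sketch_pmf r q (insert x K)) (\<lambda>\<xi>. (\<Phi> \<xi>)\<^sup>2)
     = E (sketch_pmf r q K) (\<lambda>\<xi>. (Q \<xi>)\<^sup>2) + E (sketch_pmf r q K) (\<lambda>\<xi>. (\<Sum>i<r. (zc \<xi> i)\<^sup>2)) / r"
    unfolding expectation_sketch_insert(1)[OF insert.hyps] step
    using fin by (simp add: expectation_add_finite)
  also have "\<dots> \<le> 2 / r * (A * B) + 2 * ((a x)\<^sup>2 * B + (b x)\<^sup>2 * A) / r"
    using IH zc_le by (intro add_mono divide_right_mono) auto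
  \<comment> \<open>The slack in this step is the product of the two squares at \<open>x\<close>: a
    column does not collide with itself.\<close>
  also have "\<dots> \<le> 2 / r * (((a x)\<^sup>2 + A) * ((b x)\<^sup>2 + B))"
  proof -
    have eq: "2 / r * (((a x)\<^sup>2 + A) * ((b x)\<^sup>2 + B)) - (2 / r * (A * B) + 2 * ((a x)\<^sup>2 * B + (b x)\<^sup>2 * A) / r)
        = 2 / r * ((a x)\<^sup>2 * (b x)\<^sup>2)"
      using r by (simp add: field_simps)
    have "0 \<le> 2 / r * (((a x)\<^sup>2 + A) * ((b x)\<^sup>2 + B)) - (2 / r * (A * B) + 2 * ((a x)\<^sup>2 * B + (b x)\<^sup>2 * A) / r)"
      unfolding eq by simp
    thus ?thesis by (rule iffD1[OF diff_ge_0_iff_ge])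
  qed
  finally show ?case using insert.hyps by (simp add: \<Phi>_def A_def B_def)
qed

end

subsection \<open>Dyadic scales\<close>

text \<open>The scale $s < L$ stands for the magnitude $2^s$; the scale $L$ stands for the magnitude 0.\<close>

definition mag :: "nat \<Rightarrow> nat \<Rightarrow> real" where
  "mag L s = (if s < L then 2 ^ s else 0)"

text \<open>A discrete Pareto law of index 1: every scale below \<open>L\<close> contributes the
  same \<open>\<epsilon> / 2\<close> to the mean, so the number of usable scales decides. The total
  mass off \<open>L\<close> is at most \<open>\<epsilon>\<close>, which is the budget for the second
  non-zero entry.\<close>

definition scale_weight :: "real \<Rightarrow> nat \<Rightarrow> nat \<Rightarrow> real" where
  "scale_weight \<epsilon> L s = (if s < L then \<epsilon> / 2 ^ Suc s else if s = L then 1 - \<epsilon> * (1 - 1 / 2 ^ L) else 0)"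

definition scale_pmf :: "real \<Rightarrow> nat \<Rightarrow> nat pmf" where
  "scale_pmf \<epsilon> L = embed_pmf (scale_weight \<epsilon> L)"

lemma mag_nonneg [simp]: "mag L s \<ge> 0"
  by (simp add: mag_def)

lemma sum_half_powers: "(\<Sum>s<L. 1 / 2 ^ Suc s) = 1 - 1 / (2::real) ^ L"
  by (induction L) (auto simp: field_simps)

lemma sum_scales_le:
  fixes w t :: real
  assumes "w \<ge> 0" "t \<ge> 0"
  shows "(\<Sum>s<L. if 2 ^ s * w \<le> t then 2 ^ s * w else 0) \<le> 2 * t"
proof (induction L)
  case (Suc L)
  show ?case
  proof (cases "2 ^ L * w \<le> t")
    case True
    have "(\<Sum>s<L. if 2 ^ s * w \<le> t then 2 ^ s * w else 0) \<le> (\<Sum>s<L. 2 ^ s * w)"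
      using assms by (intro sum_mono) auto
    also have "\<dots> = (2 ^ L - 1) * w"
      by (induction L) (auto simp: algebra_simps)
    finally show ?thesis using True assms by (simp add: algebra_simps)
  qed (use Suc in simp)
qed (use assms in simp)

lemma sum_scales_gt:
  fixes w t :: real
  assumes w: "w \<ge> 0" and t: "t > 0"
  shows "(\<Sum>s<L. if 2 ^ s * w > t then 1 / 2 ^ Suc s else 0) \<le> w / t"
proof -
  \<comment> \<open>The subtracted \<open>1 / 2 ^ L\<close> is the missing rest of the geometric
    tail; keeping it makes the induction go through.\<close>
  have "(\<Sum>s<L. if 2 ^ s * w > t then 1 / 2 ^ Suc s else 0) \<le> max 0 (w / t - 1 / 2 ^ L)"
  proof (induction L)
    case (Suc L)
    show ?case
    proof (cases "2 ^ L * w > t")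
      case True
      hence "1 / 2 ^ L < w / t" using t by (simp add: field_simps)
      moreover have "1 / 2 ^ Suc L = (1 / 2 ^ L) / (2 :: real)" by simp
      ultimately show ?thesis using Suc True by (simp add: max_def split: if_splits)
    next
      case False
      have "w / t - 1 / 2 ^ L \<le> w / t - 1 / 2 ^ Suc L" by (simp add: field_simps)
      thus ?thesis using Suc False by (simp add: max_def split: if_splits)
    qed
  qed (use w t in simp)
  also have "\<dots> \<le> w / t" using w t by auto
  finally show ?thesis .
qed

lemma count_scales_le:
  fixes w t u :: real
  assumes w: "w \<ge> 0" and J: "u \<le> t * 2 ^ J"
  shows "(\<Sum>s<L. if t < 2 ^ s * w \<and> 2 ^ s * w \<le> u then 1 else 0) \<le> real J"
proof -
  define S where "S = {s. s < L \<and> t < 2 ^ s * w \<and> 2 ^ s * w \<le> u}"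
  have "card S \<le> J"
  proof (cases "S = {}")
    case False
    define m where "m = Min S"
    have fin: "finite S" unfolding S_def by auto
    have m: "m \<in> S" unfolding m_def by (rule Min_in[OF fin False])
    have "S \<subseteq> {m..<m + J}"
    proof
      fix s assume s: "s \<in> S"
      have ms: "m \<le> s" unfolding m_def by (rule Min_le[OF fin s])
      moreover have "s < m + J"
      proof (rule ccontr)
        assume "\<not> s < m + J"
        hence "2 ^ (m + J) * w \<le> 2 ^ s * w" using w by (intro mult_right_mono power_increasing) auto
        also have "\<dots> \<le> u" using s by (simp add: S_def)
        also have "\<dots> \<le> t * 2 ^ J" by (rule J)
        also have "\<dots> < 2 ^ m * w * 2 ^ J"
          using m by (intro mult_strict_right_mono) (auto simp: S_def)
        finally show False by (simp add: power_add mult_ac)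
      qed
      ultimately show "s \<in> {m..<m + J}" by simp
    qed
    hence "card S \<le> card {m..<m + J}" by (intro card_mono) auto
    thus ?thesis by simp
  qed simp
  moreover have "(\<Sum>s<L. if t < 2 ^ s * w \<and> 2 ^ s * w \<le> u then 1 else (0::real)) = real (card S)"
    unfolding S_def by (subst sum.If_cases) (auto simp: Int_def)
  ultimately show ?thesis by simp
qed

text \<open>The first scale reaching the lower end overshoots it by at most a factor 2, so
  \<open>N\<close> consecutive doublings starting there stay within 1/2. The condition on
  \<open>L\<close> ensures that none of them is cut off.\<close>

lemma count_scales_ge:
  fixes w a :: real
  assumes w: "w > 0" "w \<le> 1 / 2 ^ Suc N" and L: "2 ^ L * w \<ge> 1"
  shows "(\<Sum>s<L. if 1 / 2 ^ Suc N \<le> 2 ^ s * w \<and> 2 ^ s * w \<le> 1 / 2 then 1 else 0) \<ge> real N"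
proof -
  define a where "a = 1 / (2::real) ^ Suc N"
  define m where "m = (LEAST s. a \<le> 2 ^ s * w)"
  have "(1::real) \<le> 2 ^ Suc N" by (rule one_le_power) simp
  hence "a \<le> 1" by (simp add: a_def divide_le_eq)
  hence "a \<le> 2 ^ L * w" using L by linarith
  hence m: "a \<le> 2 ^ m * w" unfolding m_def by (rule LeastI)
  have m2: "2 ^ m * w \<le> 2 * a"
  proof (cases m)
    case 0
    thus ?thesis using w by (simp add: a_def) 
  next
    case (Suc m')
    hence "\<not> a \<le> 2 ^ m' * w" unfolding m_def using not_less_Least[of m' "\<lambda>s. a \<le> 2 ^ s * w"] by auto
    thus ?thesis using Suc by simp
  qed
  have "{m..<m + N} \<subseteq> {s. s < L \<and> a \<le> 2 ^ s * w \<and> 2 ^ s * w \<le> 1 / 2}"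
  proof
    fix s assume s: "s \<in> {m..<m + N}"
    hence N: "N > 0" by auto
    have "2 ^ m * w \<le> 2 ^ s * w" using s w by (intro mult_right_mono power_increasing) auto
    with m have 1: "a \<le> 2 ^ s * w" by simp
    have "2 ^ s * w \<le> 2 ^ (m + (N - 1)) * w" using s w N by (intro mult_right_mono power_increasing) auto
    also have "\<dots> = 2 ^ (N - 1) * (2 ^ m * w)" by (simp add: power_add)
    also have "\<dots> \<le> 2 ^ (N - 1) * (2 * a)" using m2 by (intro mult_left_mono) auto
    also have "\<dots> = 1 / 2" using N unfolding a_def by (cases N) auto
    finally have 2: "2 ^ s * w \<le> 1 / 2" .
    have "2 ^ s * w < 2 ^ L * w" using 2 L by simp
    hence "s < L" using w by simp
    with 1 2 show "s \<in> {s. s < L \<and> a \<le> 2 ^ s * w \<and> 2 ^ s * w \<le> 1 / 2}" by simp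
  qed
  hence "card {m..<m + N} \<le> card {s. s < L \<and> a \<le> 2 ^ s * w \<and> 2 ^ s * w \<le> 1 / 2}"
    by (intro card_mono) auto
  moreover have "(\<Sum>s<L. if a \<le> 2 ^ s * w \<and> 2 ^ s * w \<le> 1 / 2 then 1 else (0::real))
      = real (card {s. s < L \<and> a \<le> 2 ^ s * w \<and> 2 ^ s * w \<le> 1 / 2})"
    by (subst sum.If_cases) (auto simp: Int_def)
  ultimately show ?thesis by (simp add: a_def)
qed

section \<open>Expectations under the scale distribution\<close>

context
  fixes \<epsilon> :: real and L :: nat
  assumes eps: "0 \<le> \<epsilon>" "\<epsilon> \<le> 1"
begin

lemma pmf_scale: "pmf (scale_pmf \<epsilon> L) s = scale_weight \<epsilon> L s"
  unfolding scale_pmf_def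
proof (rule pmf_embed_pmf)
  have "\<epsilon> * (1 - 1 / 2 ^ L) \<le> 1 * 1" using eps by (intro mult_mono) auto
  thus nonneg: "0 \<le> scale_weight \<epsilon> L s" for s using eps by (auto simp: scale_weight_def)
  have "(\<integral>\<^sup>+ s. ennreal (scale_weight \<epsilon> L s) \<partial>count_space UNIV) = (\<Sum>s\<le>L. ennreal (scale_weight \<epsilon> L s))"
    by (rule nn_integral_count_space'[where A = "{..L}"]) (auto simp: scale_weight_def)
  also have "\<dots> = ennreal (\<Sum>s\<le>L. scale_weight \<epsilon> L s)" using nonneg by simp
  also have "(\<Sum>s\<le>L. scale_weight \<epsilon> L s) = (\<Sum>s<L. \<epsilon> * (1 / 2 ^ Suc s)) + (1 - \<epsilon> * (1 - 1 / 2 ^ L))"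
    by (simp add: scale_weight_def lessThan_Suc_atMost[symmetric])
  also have "\<dots> = 1" unfolding sum_distrib_left[symmetric] sum_half_powers by simp
  finally show "(\<integral>\<^sup>+ s. ennreal (scale_weight \<epsilon> L s) \<partial>count_space UNIV) = 1" by simp
qed

lemma set_scale_pmf: "set_pmf (scale_pmf \<epsilon> L) \<subseteq> {..L}"
  by (auto simp: set_pmf_eq pmf_scale scale_weight_def split: if_splits)

lemma finite_scale_pmf [simp]: "finite (set_pmf (scale_pmf \<epsilon> L))"
  using set_scale_pmf finite_subset by blast

lemma expectation_scale:
  "E (scale_pmf \<epsilon> L) f = \<epsilon> * (\<Sum>s<L. f s / 2 ^ Suc s) + (1 - \<epsilon> * (1 - 1 / 2 ^ L)) * f L"
proof -
  have "E (scale_pmf \<epsilon> L) f = (\<Sum>s\<le>L. f s * pmf (scale_pmf \<epsilon> L) s)"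
    using set_scale_pmf by (intro integral_measure_pmf_real) auto
  also have "\<dots> = (\<Sum>s<L. \<epsilon> * (f s / 2 ^ Suc s)) + (1 - \<epsilon> * (1 - 1 / 2 ^ L)) * f L"
    by (simp add: pmf_scale scale_weight_def lessThan_Suc_atMost[symmetric] mult.commute)
  finally show ?thesis by (simp add: sum_distrib_left)
qed

lemma expectation_scale_mag:
  assumes "f L = 0"
  shows "E (scale_pmf \<epsilon> L) f = \<epsilon> * (\<Sum>s<L. f s / 2 ^ Suc s)"
  using assms by (simp add: expectation_scale)

end

subsection \<open>Upper bound for the heavy-tailed part\<close>

lemma heavy_part_upper:
  fixes v :: "nat \<Rightarrow> nat \<Rightarrow> real"
  assumes eps: "0 \<le> \<epsilon>" "\<epsilon> \<le> 1" and r: "r > 0" and T: "T > 0" "T * r \<le> 2 ^ J" and t: "t > 0"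
    and v: "\<And>j. j < m \<Longrightarrow> (\<Sum>k<n. \<bar>v j k\<bar>) \<le> 1"
  shows "measure_pmf.prob (sketch_pmf r (scale_pmf \<epsilon> L) {..<n})
      {\<xi>. (\<Sum>j<m. \<Sum>i<r. \<bar>rowsum {..<n} (\<lambda>k s. v j k * mag L s) \<xi> i\<bar>) \<ge> t}
    \<le> m / T + m * (1 + J) / t"
proof -
  let ?q = "scale_pmf \<epsilon> L"
  let ?P = "sketch_pmf r ?q {..<n}"
  have q: "finite (set_pmf ?q)" using eps by simp
  have finP: "finite (set_pmf ?P)" using r q by simp
  \<comment> \<open>Truncation is governed by \<open>w k\<close>, common to all \<open>j\<close>,
    and not by single entries \<open>v j k\<close>. One event then serves all \<open>m\<close>
    vectors, and since the \<open>w k\<close> sum to at most \<open>m\<close>, it costs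
    \<open>m / T\<close> in total.\<close>
  define w where "w k = (\<Sum>j<m. \<bar>v j k\<bar>)" for k
  have w0: "w k \<ge> 0" for k by (simp add: w_def sum_nonneg)
  have vw: "\<bar>v j k\<bar> \<le> w k" if "j < m" for j k
    unfolding w_def using that by (intro member_le_sum) auto
  have sw: "(\<Sum>k<n. w k) \<le> m"
  proof -
    have "(\<Sum>k<n. w k) = (\<Sum>j<m. \<Sum>k<n. \<bar>v j k\<bar>)" unfolding w_def by (rule sum.swap)
    also have "\<dots> \<le> (\<Sum>j<m. 1)" using v by (intro sum_mono) auto
    finally show ?thesis by simp
  qed
  define sm where "sm k s = (if mag L s * w k \<le> 1 / r then mag L s else 0)" for k s
  define mid where "mid k s = (if 1 / r < mag L s * w k \<and> mag L s * w k \<le> T then mag L s else 0)" for k s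
  define big where "big k s = (if mag L s * w k > T then 1 else (0::real))" for k s
  have smL: "sm k L = 0" "mid k L = 0" "big k L = 0" for k
    using T by (auto simp: sm_def mid_def big_def mag_def)
  text \<open>Three ranges of magnitudes: below $1/r$ the signs cancel (second moment), between $1/r$
    and $T$ the expectation is logarithmic, and above $T$ nothing happens with high probability.\<close>
  have E_big: "E ?q (big k) \<le> w k / T" for k
  proof -
    have "E ?q (big k) = \<epsilon> * (\<Sum>s<L. if 2 ^ s * w k > T then 1 / 2 ^ Suc s else 0)"
      unfolding expectation_scale_mag[of \<epsilon> "big k" L, OF eps smL(3)]
      by (intro arg_cong2[where f="(*)"] sum.cong) (auto simp: big_def mag_def)
    also have "\<dots> \<le> 1 * (w k / T)"
      using eps w0 T by (intro mult_mono sum_scales_gt sum_nonneg) auto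
    finally show ?thesis by simp
  qed
  have E_mid: "E ?q (mid k) \<le> J" for k
  proof -
    have "E ?q (mid k) = \<epsilon> * (\<Sum>s<L. (if 1 / r < 2 ^ s * w k \<and> 2 ^ s * w k \<le> T then 1 else 0) / 2)"
      unfolding expectation_scale_mag[of \<epsilon> "mid k" L, OF eps smL(2)]
      by (intro arg_cong2[where f="(*)"] sum.cong) (auto simp: mid_def mag_def)
    also have "\<dots> \<le> 1 * (\<Sum>s<L. (if 1 / r < 2 ^ s * w k \<and> 2 ^ s * w k \<le> T then 1 else 0))"
      using eps by (intro mult_mono sum_mono sum_nonneg) auto
    also have "\<dots> \<le> J"
      using count_scales_le[where w = "w k" and u = T and t = "1 / r" and J = J and L = L, OF w0] T r by (simp add: field_simps)
    finally show ?thesis .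
  qed
  have E_sm: "E ?q (\<lambda>s. (v j k * sm k s)\<^sup>2) \<le> \<bar>v j k\<bar> / r" if "j < m" for j k
  proof -
    have "E ?q (\<lambda>s. (v j k * sm k s)\<^sup>2) = \<epsilon> * (\<Sum>s<L. (v j k * sm k s)\<^sup>2 / 2 ^ Suc s)"
      by (rule expectation_scale_mag[OF eps]) (simp add: smL)
    also have "\<dots> \<le> 1 * (\<Sum>s<L. (\<bar>v j k\<bar> / 2) * (if 2 ^ s * w k \<le> 1 / r then 2 ^ s * w k else 0))"
    proof (intro mult_mono sum_mono sum_nonneg)
      fix s assume s: "s \<in> {..<L}"
      have sq: "(v j k)\<^sup>2 = \<bar>v j k\<bar> * \<bar>v j k\<bar>" by (simp add: power2_eq_square)
      have "(v j k * 2 ^ s)\<^sup>2 / 2 ^ Suc s = (v j k)\<^sup>2 * (2 ^ s * 2 ^ s) / (2 * 2 ^ s)"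
        by (simp add: power_mult_distrib power2_eq_square)
      also have "\<dots> = \<bar>v j k\<bar> / 2 * (2 ^ s * \<bar>v j k\<bar>)" unfolding sq by simp
      also have "\<dots> \<le> \<bar>v j k\<bar> / 2 * (2 ^ s * w k)"
        using vw[OF that] by (intro mult_left_mono) auto
      finally show "(v j k * sm k s)\<^sup>2 / 2 ^ Suc s
          \<le> (\<bar>v j k\<bar> / 2) * (if 2 ^ s * w k \<le> 1 / r then 2 ^ s * w k else 0)"
        using s by (auto simp: sm_def mag_def)
    qed (use eps in auto)
    also have "\<dots> = \<bar>v j k\<bar> / 2 * (\<Sum>s<L. if 2 ^ s * w k \<le> 1 / r then 2 ^ s * w k else 0)"
      by (simp add: sum_distrib_left)
    also have "\<dots> \<le> \<bar>v j k\<bar> / 2 * (2 * (1 / r))"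
      using w0 by (intro mult_left_mono sum_scales_le) auto
    finally show ?thesis by simp
  qed
  define S where "S \<xi> = (\<Sum>j<m. \<Sum>i<r. \<bar>rowsum {..<n} (\<lambda>k s. v j k * sm k s) \<xi> i\<bar>)" for \<xi>
  define M where "M \<xi> = (\<Sum>j<m. \<Sum>k<n. \<bar>v j k\<bar> * mid k (snd (snd (\<xi> k))))" for \<xi> :: "nat \<Rightarrow> nat \<times> real \<times> nat"
  define B where "B \<xi> = (\<Sum>k<n. big k (snd (snd (\<xi> k))))" for \<xi> :: "nat \<Rightarrow> nat \<times> real \<times> nat"
  have comp: "E ?P (\<lambda>\<xi>. f (snd (snd (\<xi> k)))) = E ?q f" if "k < n" for k f
  proof -
    have "E ?P (\<lambda>\<xi>. f (snd (snd (\<xi> k)))) = E (col_pmf r ?q) (\<lambda>c. f (snd (snd c)))"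
      using that expectation_sketch_component[OF r q, of "{..<n}" k "\<lambda>c. f (snd (snd c))"] by simp
    also have "\<dots> = E ?q f" using r by (simp add: expectation_col[OF r q])
    finally show ?thesis .
  qed
  have EB: "E ?P B \<le> m / T"
  proof -
    have "E ?P B = (\<Sum>k<n. E ?q (big k))"
      unfolding B_def by (simp add: expectation_sum_finite[OF finP] comp)
    also have "\<dots> \<le> (\<Sum>k<n. w k / T)" by (intro sum_mono E_big)
    also have "\<dots> \<le> m / T" using sw T by (simp add: sum_divide_distrib[symmetric] divide_right_mono)
    finally show ?thesis .
  qed
  have EM: "E ?P M \<le> m * J"
  proof -
    have "E ?P M = (\<Sum>j<m. \<Sum>k<n. \<bar>v j k\<bar> * E ?q (mid k))"
      unfolding M_def by (simp add: expectation_sum_finite[OF finP] comp)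
    also have "\<dots> \<le> (\<Sum>j<m. \<Sum>k<n. \<bar>v j k\<bar> * J)" by (intro sum_mono mult_left_mono E_mid) auto
    also have "\<dots> \<le> (\<Sum>j<m. 1 * real J)"
      unfolding sum_distrib_right[symmetric] using v by (intro mult_right_mono sum_mono) auto
    finally show ?thesis by simp
  qed
  have ES: "E ?P S \<le> m"
  proof -
    have "E ?P S = (\<Sum>j<m. E ?P (\<lambda>\<xi>. \<Sum>i<r. \<bar>rowsum {..<n} (\<lambda>k s. v j k * sm k s) \<xi> i\<bar>))"
      unfolding S_def by (rule expectation_sum_finite[OF finP])
    also have "\<dots> \<le> (\<Sum>j<m. 1)"
    proof (rule sum_mono)
      fix j assume "j \<in> {..<m}"
      hence j: "j < m" by simp
      have "E ?P (\<lambda>\<xi>. \<Sum>i<r. \<bar>rowsum {..<n} (\<lambda>k s. v j k * sm k s) \<xi> i\<bar>)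
          \<le> E ?P (\<lambda>\<xi>. r / 2 * (\<Sum>i<r. (rowsum {..<n} (\<lambda>k s. v j k * sm k s) \<xi> i)\<^sup>2) + 1 / 2)"
      proof (rule expectation_mono_finite[OF finP])
        fix \<xi>
        let ?z = "rowsum {..<n} (\<lambda>k s. v j k * sm k s) \<xi>"
        \<comment> \<open>AM-GM tuned to the number of rows: the constants add up to 1/2 over
          \<open>r\<close> rows, and a second moment of at most \<open>1 / r\<close> contributes the
          other 1/2.\<close>
        have "\<bar>?z i\<bar> \<le> r / 2 * (?z i)\<^sup>2 + 1 / (2 * r)" for i
        proof -
          have "0 \<le> (r * \<bar>?z i\<bar> - 1)\<^sup>2 / (2 * r)" by simp
          also have "\<dots> = r / 2 * (?z i)\<^sup>2 + 1 / (2 * r) - \<bar>?z i\<bar>"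
            using r by (simp add: power2_eq_square field_simps)
          finally show ?thesis by simp
        qed
        hence "(\<Sum>i<r. \<bar>?z i\<bar>) \<le> (\<Sum>i<r. r / 2 * (?z i)\<^sup>2 + 1 / (2 * r))" by (intro sum_mono)
        also have "\<dots> = r / 2 * (\<Sum>i<r. (?z i)\<^sup>2) + 1 / 2"
          using r by (simp add: sum.distrib sum_distrib_left)
        finally show "(\<Sum>i<r. \<bar>?z i\<bar>) \<le> r / 2 * (\<Sum>i<r. (?z i)\<^sup>2) + 1 / 2" .
      qed
      also have "\<dots> = r / 2 * (\<Sum>k<n. E ?q (\<lambda>s. (v j k * sm k s)\<^sup>2)) + 1 / 2"
        using finP by (simp add: expectation_add_finite second_moment_rowsum[OF r q])
      also have "\<dots> \<le> r / 2 * (\<Sum>k<n. \<bar>v j k\<bar> / r) + 1 / 2"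
        by (intro add_mono mult_left_mono sum_mono E_sm j) auto
      also have "\<dots> \<le> 1" using r v[OF j] by (simp add: sum_divide_distrib[symmetric])
      finally show "E ?P (\<lambda>\<xi>. \<Sum>i<r. \<bar>rowsum {..<n} (\<lambda>k s. v j k * sm k s) \<xi> i\<bar>) \<le> 1" .
    qed
    finally show ?thesis by simp
  qed
  have "measure_pmf.prob ?P {\<xi>. (\<Sum>j<m. \<Sum>i<r. \<bar>rowsum {..<n} (\<lambda>k s. v j k * mag L s) \<xi> i\<bar>) \<ge> t}
      \<le> measure_pmf.prob ?P ({\<xi>. B \<xi> \<ge> 1} \<union> {\<xi>. S \<xi> + M \<xi> \<ge> t})"
  proof (rule measure_pmf.finite_measure_mono_AE)
    show "AE \<xi> in ?P. \<xi> \<in> {\<xi>. (\<Sum>j<m. \<Sum>i<r. \<bar>rowsum {..<n} (\<lambda>k s. v j k * mag L s) \<xi> i\<bar>) \<ge> t}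
        \<longrightarrow> \<xi> \<in> {\<xi>. B \<xi> \<ge> 1} \<union> {\<xi>. S \<xi> + M \<xi> \<ge> t}"
    proof (subst AE_measure_pmf_iff, intro ballI impI)
      fix \<xi> assume \<xi>: "\<xi> \<in> set_pmf ?P"
        and large: "\<xi> \<in> {\<xi>. (\<Sum>j<m. \<Sum>i<r. \<bar>rowsum {..<n} (\<lambda>k s. v j k * mag L s) \<xi> i\<bar>) \<ge> t}"
      have col: "fst (\<xi> k) < r" "\<bar>fst (snd (\<xi> k))\<bar> = 1" if "k < n" for k
      proof -
        have "\<xi> \<in> PiE_dflt {..<n} (0, 0, 0) (\<lambda>_. {..<r} \<times> {- 1, 1} \<times> set_pmf ?q)"
          using \<xi> set_sketch_pmf[OF r q, of "{..<n}"] by simp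
        hence "\<xi> k \<in> {..<r} \<times> {- 1, 1} \<times> set_pmf ?q" using that unfolding PiE_dflt_def by blast
        thus "fst (\<xi> k) < r" "\<bar>fst (snd (\<xi> k))\<bar> = 1" by auto
      qed
      show "\<xi> \<in> {\<xi>. B \<xi> \<ge> 1} \<union> {\<xi>. S \<xi> + M \<xi> \<ge> t}"
      proof (cases "\<exists>k<n. mag L (snd (snd (\<xi> k))) * w k > T")
        case True
        then obtain k where k: "k < n" "mag L (snd (snd (\<xi> k))) * w k > T" by blast
        hence "1 \<le> big k (snd (snd (\<xi> k)))" by (simp add: big_def)
        also have "\<dots> \<le> B \<xi>" unfolding B_def using k by (intro member_le_sum) (auto simp: big_def)
        finally show ?thesis by simp
      next
        case False
        have split: "mag L (snd (snd (\<xi> k))) = sm k (snd (snd (\<xi> k))) + mid k (snd (snd (\<xi> k)))"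
          if "k < n" for k
        proof -
          have "mag L (snd (snd (\<xi> k))) * w k \<le> T" using False that by (meson not_less)
          thus ?thesis by (simp add: sm_def mid_def)
        qed
        have "(\<Sum>i<r. \<bar>rowsum {..<n} (\<lambda>k s. v j k * mag L s) \<xi> i\<bar>)
            \<le> (\<Sum>i<r. \<bar>rowsum {..<n} (\<lambda>k s. v j k * sm k s) \<xi> i\<bar>)
              + (\<Sum>k<n. \<bar>v j k\<bar> * mid k (snd (snd (\<xi> k))))" for j
        proof -
          have "rowsum {..<n} (\<lambda>k s. v j k * mag L s) \<xi> i
             = rowsum {..<n} (\<lambda>k s. v j k * sm k s) \<xi> i + rowsum {..<n} (\<lambda>k s. v j k * mid k s) \<xi> i" for i
            unfolding rowsum_def sum.distrib[symmetric]
            by (intro sum.cong) (auto simp: entry_def split algebra_simps)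
          hence "(\<Sum>i<r. \<bar>rowsum {..<n} (\<lambda>k s. v j k * mag L s) \<xi> i\<bar>)
            \<le> (\<Sum>i<r. \<bar>rowsum {..<n} (\<lambda>k s. v j k * sm k s) \<xi> i\<bar>)
              + (\<Sum>i<r. \<bar>rowsum {..<n} (\<lambda>k s. v j k * mid k s) \<xi> i\<bar>)"
            unfolding sum.distrib[symmetric] by (intro sum_mono) (simp add: abs_triangle_ineq)
          also have "(\<Sum>i<r. \<bar>rowsum {..<n} (\<lambda>k s. v j k * mid k s) \<xi> i\<bar>)
              \<le> (\<Sum>i<r. \<Sum>k<n. \<bar>entry (\<lambda>s. v j k * mid k s) (\<xi> k) i\<bar>)"
            unfolding rowsum_def by (intro sum_mono sum_abs)
          also have "\<dots> = (\<Sum>k<n. \<Sum>i<r. if fst (\<xi> k) = i then \<bar>v j k\<bar> * mid k (snd (snd (\<xi> k))) else 0)"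
            by (subst sum.swap) (auto simp: entry_def abs_mult col mid_def intro!: sum.cong)
          also have "\<dots> = (\<Sum>k<n. \<bar>v j k\<bar> * mid k (snd (snd (\<xi> k))))"
            using col by (intro sum.cong) auto
          finally show ?thesis by simp
        qed
        hence "(\<Sum>j<m. \<Sum>i<r. \<bar>rowsum {..<n} (\<lambda>k s. v j k * mag L s) \<xi> i\<bar>) \<le> S \<xi> + M \<xi>"
          unfolding S_def M_def sum.distrib[symmetric] by (intro sum_mono)
        thus ?thesis using large by simp
      qed
    qed
  qed simp
  also have "\<dots> \<le> measure_pmf.prob ?P {\<xi>. B \<xi> \<ge> 1} + measure_pmf.prob ?P {\<xi>. S \<xi> + M \<xi> \<ge> t}"
    by (rule measure_Un_le) auto
  also have "\<dots> \<le> m / T + m * (1 + J) / t"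
  proof (rule add_mono)
    show "measure_pmf.prob ?P {\<xi>. B \<xi> \<ge> 1} \<le> m / T"
      by (rule markov_finite[OF finP]) (use EB in \<open>simp_all add: B_def[abs_def] big_def sum_nonneg\<close>)
    show "measure_pmf.prob ?P {\<xi>. S \<xi> + M \<xi> \<ge> t} \<le> m * (1 + J) / t"
    proof (rule markov_finite[OF finP])
      show "E ?P (\<lambda>\<xi>. S \<xi> + M \<xi>) \<le> m * (1 + J) / t * t"
      proof -
        have "E ?P (\<lambda>\<xi>. S \<xi> + M \<xi>) \<le> m + m * J"
          using ES EM unfolding expectation_add_finite[OF finP] by linarith
        also have "\<dots> = m * (1 + J) / t * t" using t by (simp add: distrib_left)
        finally show ?thesis .
      qed
    qed (auto simp: S_def M_def mid_def t intro!: add_nonneg_nonneg sum_nonneg)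
  qed
  finally show ?thesis by (simp add: distrib_left)
qed

subsection \<open>Lower tail of the heavy-tailed part\<close>

text \<open>A plain tent would have convex corners at -1 and 1, where averaging loses an amount
  linear in the step. Squaring removes these, so the loss is quadratic everywhere, and keeps the
  concave corner at 0 with its linear gain.\<close>

definition bump :: "real \<Rightarrow> real" where
  "bump u = (max 0 (1 - \<bar>u\<bar>))\<^sup>2"

text \<open>The floor 1/2 keeps all ratios of values at most 2. With exp (- 2 |z|) instead, a step
  \<open>a\<close> could multiply the value by cosh (2 a), far too much for magnitudes up to
  \<open>2 ^ L\<close>.\<close>

definition phi :: "real \<Rightarrow> real" where
  "phi u = (1 + bump u) / 2"

lemma bump_minus [simp]: "bump (- u) = bump u"
  by (simp add: bump_def)

lemma bump_bounds: "0 \<le> bump u" "bump u \<le> 1"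
proof -
  show "0 \<le> bump u" by (simp add: bump_def)
  have "max 0 (1 - \<bar>u\<bar>) ^ 2 \<le> 1 ^ 2" by (intro power_mono) auto
  thus "bump u \<le> 1" by (simp add: bump_def)
qed

lemma phi_bounds: "1 / 2 \<le> phi u" "phi u \<le> 1" "0 < phi u"
  using bump_bounds[of u] by (auto simp: phi_def)

lemma phi_minus [simp]: "phi (- u) = phi u"
  by (simp add: phi_def)

text \<open>The right-hand side is the parabola touching \<open>bump\<close> at \<open>z\<close> from above; averaging it over
  \<open>w = z \<plusminus> a\<close> bounds the loss, and the kink of \<open>bump\<close> at 0 provides the gain.\<close>

lemma bump_majorant:
  assumes "z \<ge> 0"
  shows "bump w \<le> (max 0 (1 - z) - (w - z))\<^sup>2"
proof (cases "z \<le> 1")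
  case True
  hence "(max 0 (1 - z) - (w - z))\<^sup>2 = \<bar>1 - w\<bar>\<^sup>2" by simp
  also have "\<dots> \<ge> bump w" unfolding bump_def by (intro power_mono) auto
  finally show ?thesis .
next
  case False
  hence "(max 0 (1 - z) - (w - z))\<^sup>2 = \<bar>z - w\<bar>\<^sup>2" by simp
  also have "\<dots> \<ge> bump w" unfolding bump_def using False by (intro power_mono) auto
  finally show ?thesis .
qed

lemma bump_avg:
  assumes z: "z \<ge> 0"
  shows "bump (z + a) + bump (z - a) \<le> 2 * bump z + 2 * a\<^sup>2"
proof -
  have "bump (z + a) + bump (z - a) \<le> (max 0 (1 - z) - a)\<^sup>2 + (max 0 (1 - z) + a)\<^sup>2"
    using bump_majorant[OF z, of "z + a"] bump_majorant[OF z, of "z - a"] by simp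
  also have "\<dots> = 2 * bump z + 2 * a\<^sup>2" using z by (simp add: bump_def power2_eq_square algebra_simps)
  finally show ?thesis .
qed

lemma bump_gain:
  assumes z: "z \<ge> 0" "z \<le> a / 2" and a: "a \<le> 1 / 2"
  shows "bump (z + a) + bump (z - a) \<le> 2 * bump z + 2 * a\<^sup>2 - 2 * a"
proof -
  have "bump (z + a) + bump (z - a) = (1 - z - a)\<^sup>2 + (1 - a + z)\<^sup>2"
    using z a by (simp add: bump_def max_def algebra_simps)
  also have "\<dots> = 2 * bump z + 2 * a\<^sup>2 - 4 * (a - z)"
    using z a by (simp add: bump_def max_def power2_eq_square algebra_simps)
  finally show ?thesis using z by simp
qed

section \<open>Effect of a random signed step on the test function\<close>

lemma phi_avg: "(phi (z + a) + phi (z - a)) / 2 \<le> phi z * (1 + a\<^sup>2)"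
proof -
  have *: "(phi (z + a) + phi (z - a)) / 2 \<le> phi z * (1 + a\<^sup>2)" if "z \<ge> 0" for z
  proof -
    have "a\<^sup>2 / 2 \<le> phi z * a\<^sup>2"
      using mult_right_mono[OF phi_bounds(1)[of z], of "a\<^sup>2"] by simp
    thus ?thesis using bump_avg[OF that, of a] by (simp add: phi_def field_simps)
  qed
  show ?thesis
  proof (cases "z \<ge> 0")
    case False
    hence "(phi (- z + a) + phi (- z - a)) / 2 \<le> phi (- z) * (1 + a\<^sup>2)" by (intro *) auto
    moreover have "- z + a = - (z - a)" "- z - a = - (z + a)" by simp_all
    hence "phi (- z + a) = phi (z - a)" "phi (- z - a) = phi (z + a)" by (simp_all only: phi_minus)
    ultimately show ?thesis by simp
  qed (rule *)
qed

text \<open>For steps beyond 1/2, where the quadratic bound would be wasteful. The form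
  \<open>1 + 1\<close> matches \<open>1 + loss a\<close>.\<close>

lemma phi_avg_trivial: "(phi (z + a) + phi (z - a)) / 2 \<le> phi z * (1 + 1)"
  using phi_bounds(1)[of z] phi_bounds(2)[of "z + a"] phi_bounds(2)[of "z - a"] by simp

text \<open>A row sum small compared with the step lies near the corner of \<open>bump\<close>, so a
  step of either sign moves it down the slope. This is the source of all progress in the lower
  bound.\<close>

lemma phi_gain:
  assumes "\<bar>z\<bar> \<le> a / 2" "a \<le> 1 / 2"
  shows "(phi (z + a) + phi (z - a)) / 2 \<le> phi z * (1 + a\<^sup>2 - a / 2)"
proof -
  have a: "a \<ge> 0" using assms by linarith
  have *: "(phi (z + a) + phi (z - a)) / 2 \<le> phi z * (1 + a\<^sup>2 - a / 2)" if "z \<ge> 0" "z \<le> a / 2" for z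
  proof -
    have "a\<^sup>2 / 2 \<le> phi z * a\<^sup>2"
      using mult_right_mono[OF phi_bounds(1)[of z], of "a\<^sup>2"] by simp
    moreover have "phi z * (a / 2) \<le> a / 2"
      using a mult_right_mono[OF phi_bounds(2)[of z], of "a / 2"] by simp
    moreover have "(phi (z + a) + phi (z - a)) / 2 \<le> phi z + a\<^sup>2 / 2 - a / 2"
      using bump_gain[OF that assms(2)] by (simp add: phi_def field_simps)
    ultimately show ?thesis unfolding distrib_left right_diff_distrib by linarith
  qed
  show ?thesis
  proof (cases "z \<ge> 0")
    case False
    hence "(phi (- z + a) + phi (- z - a)) / 2 \<le> phi (- z) * (1 + a\<^sup>2 - a / 2)" using assms by (intro *) auto
    moreover have "- z + a = - (z - a)" "- z - a = - (z + a)" by simp_all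
    hence "phi (- z + a) = phi (z - a)" "phi (- z - a) = phi (z + a)" by (simp_all only: phi_minus)
    ultimately show ?thesis by simp
  qed (use assms * in simp)
qed

text \<open>Up to 1/2, AM-GM gives \<open>phi z\<close> at least \<open>1 - \<bar>z\<bar>\<close>,
  and a logarithm estimate does the rest; beyond that the floor 1/2 takes over. It turns a small l1
  norm of the row sums into a large potential.\<close>

lemma phi_ge_exp: "exp (- 2 * \<bar>z\<bar>) \<le> phi z"
proof (cases "\<bar>z\<bar> \<le> 1 / 2")
  case True
  have "- \<bar>z\<bar> - 2 * \<bar>z\<bar>\<^sup>2 \<le> ln (1 - \<bar>z\<bar>)"
    using True by (intro ln_one_minus_pos_lower_bound) auto
  moreover have "2 * \<bar>z\<bar>\<^sup>2 \<le> \<bar>z\<bar>"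
    using mult_left_mono[OF True, of "\<bar>z\<bar>"] by (simp add: power2_eq_square)
  ultimately have "- 2 * \<bar>z\<bar> \<le> ln (1 - \<bar>z\<bar>)" by linarith
  hence "exp (- 2 * \<bar>z\<bar>) \<le> exp (ln (1 - \<bar>z\<bar>))" by simp
  also have "\<dots> = 1 - \<bar>z\<bar>" using True by simp
  also have "\<dots> \<le> phi z" using True by (simp add: phi_def bump_def max_def power2_eq_square algebra_simps)
  finally show ?thesis .
next
  case False
  hence "exp (- 2 * \<bar>z\<bar>) \<le> exp (- 1)" by simp
  also have "\<dots> \<le> 1 / 2" using exp_ge_add_one_self[of 1] by (simp add: exp_minus field_simps)
  also have "\<dots> \<le> phi z" by (rule phi_bounds)
  finally show ?thesis .
qed

lemma phi_le_exp:
  assumes "0 \<le> x" "x \<le> 1" "x \<le> \<bar>z\<bar>"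
  shows "phi z \<le> exp (- x / 2)"
proof -
  have "bump z \<le> (1 - x)\<^sup>2" unfolding bump_def using assms by (intro power_mono) auto
  also have "\<dots> \<le> 1 - x" using assms mult_left_mono[of "1 - x" 1 "1 - x"] by (simp add: power2_eq_square)
  finally have "phi z \<le> 1 + (- x / 2)" by (simp add: phi_def)
  also have "\<dots> \<le> exp (- x / 2)" by (rule exp_ge_add_one_self)
  finally show ?thesis .
qed

text \<open>A bounded-ratio substitute for the exponential of minus twice the l1 norm. As a product
  over rows it changes by a single ratio when one column is added.\<close>

definition potential :: "nat \<Rightarrow> (nat \<Rightarrow> real) \<Rightarrow> real" where
  "potential r z = (\<Prod>i<r. phi (z i))"

lemma potential_bounds: "0 < potential r z" "potential r z \<le> 1"
  unfolding potential_def using phi_bounds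
  by (intro prod_pos, simp) (intro prod_le_1, simp add: less_imp_le phi_bounds)

lemma potential_update:
  assumes "h < r"
  shows "potential r (\<lambda>i. z i + (if h = i then x else 0)) = potential r z * (phi (z h + x) / phi (z h))"
proof -
  have "potential r (\<lambda>i. z i + (if h = i then x else 0))
      = phi (z h + x) * (\<Prod>i\<in>{..<r}-{h}. phi (z i + (if h = i then x else 0)))"
    unfolding potential_def using assms by (subst prod.remove[of _ h]) auto
  also have "(\<Prod>i\<in>{..<r}-{h}. phi (z i + (if h = i then x else 0))) = (\<Prod>i\<in>{..<r}-{h}. phi (z i))"
    by (intro prod.cong) auto
  also have "potential r z = phi (z h) * (\<Prod>i\<in>{..<r}-{h}. phi (z i))"
    unfolding potential_def using assms by (subst prod.remove[of _ h]) auto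
  ultimately show ?thesis using phi_bounds(3)[of "z h"] by simp
qed

section \<open>Drift of the potential under one column, and the resulting tail bound\<close>

context
  fixes r L N :: nat and \<epsilon> :: real
  assumes r: "r > 0" and eps: "0 \<le> \<epsilon>" "\<epsilon> \<le> 1" and N: "N \<ge> 40"
begin

text \<open>The threshold is half of the lower end of the window of step sizes. Unless the state is
  spread, at least half of the rows satisfy the hypothesis of \<open>phi_gain\<close> for every step
  in the window.\<close>

definition spread_state :: "(nat \<Rightarrow> real) \<Rightarrow> bool" where
  "spread_state z \<longleftrightarrow> 2 * card {i. i < r \<and> \<bar>z i\<bar> > 1 / 2 ^ Suc N / 2} > r"

lemma potential_spread:
  assumes "spread_state z"
  shows "potential r z \<le> exp (- (r / 2 ^ Suc N / 8))"
proof -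
  define B where "B = {i. i < r \<and> \<bar>z i\<bar> > 1 / 2 ^ Suc N / 2}"
  have B: "B \<subseteq> {..<r}" "finite B" unfolding B_def by auto
  have "potential r z \<le> (\<Prod>i\<in>B. phi (z i))"
    unfolding potential_def prod.subset_diff[OF B(1) finite_lessThan]
    using phi_bounds by (intro mult_left_le_one_le prod_le_1 prod_nonneg) (auto intro: less_imp_le)
  also have "\<dots> \<le> (\<Prod>i\<in>B. exp (- (1 / 2 ^ Suc N / 2) / 2))"
  proof (intro prod_mono conjI)
    fix i assume "i \<in> B"
    hence "1 / 2 ^ Suc N / 2 < \<bar>z i\<bar>" by (simp only: B_def mem_Collect_eq)
    moreover have "(1::real) \<le> 2 ^ Suc N" by (rule one_le_power) simp
    hence "1 / 2 ^ Suc N / 2 \<le> (1::real)" by (simp add: divide_le_eq)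
    ultimately show "phi (z i) \<le> exp (- (1 / 2 ^ Suc N / 2) / 2)"
      by (intro phi_le_exp less_imp_le[of _ "\<bar>z i\<bar>"]) simp_all
  qed (use phi_bounds in \<open>auto intro: less_imp_le\<close>)
  also have "\<dots> = exp (- (card B * (1 / 2 ^ Suc N / 4)))"
    by (simp add: exp_of_nat_mult[symmetric])
  also have "\<dots> \<le> exp (- (r / 2 * (1 / 2 ^ Suc N / 4)))"
  proof -
    have "real r / 2 \<le> card B" using assms unfolding spread_state_def B_def[symmetric] by linarith
    hence "r / 2 * (1 / 2 ^ Suc N / 4) \<le> card B * (1 / 2 ^ Suc N / 4)" by (intro mult_right_mono) auto
    thus ?thesis by simp
  qed
  finally show ?thesis by simp
qed

definition loss :: "real \<Rightarrow> real" where
  "loss a = (if a \<le> 1 / 2 then a\<^sup>2 else 1)"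

lemma phi_ratio_le:
  assumes "a \<ge> 0"
  shows "(phi (z + a) + phi (z - a)) / 2 / phi z \<le> 1 + loss a"
  using phi_avg[of z a] phi_avg_trivial[of z a] phi_bounds(3)[of z]
  by (simp add: loss_def divide_le_eq mult.commute)

lemma expected_loss:
  assumes w: "w \<ge> 0"
  shows "E (scale_pmf \<epsilon> L) (\<lambda>s. loss (w * mag L s)) \<le> 5 / 2 * \<epsilon> * w"
proof -
  have "E (scale_pmf \<epsilon> L) (\<lambda>s. loss (w * mag L s)) = \<epsilon> * (\<Sum>s<L. loss (w * mag L s) / 2 ^ Suc s)"
    by (rule expectation_scale_mag[OF eps]) (simp add: mag_def loss_def)
  also have "(\<Sum>s<L. loss (w * mag L s) / 2 ^ Suc s)
     = (\<Sum>s<L. w / 2 * (if 2 ^ s * w \<le> 1 / 2 then 2 ^ s * w else 0)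
          + (if 2 ^ s * w > 1 / 2 then 1 / 2 ^ Suc s else 0))"
    by (intro sum.cong) (auto simp: loss_def mag_def power2_eq_square mult.commute)
  also have "\<dots> = w / 2 * (\<Sum>s<L. if 2 ^ s * w \<le> 1 / 2 then 2 ^ s * w else 0)
          + (\<Sum>s<L. if 2 ^ s * w > 1 / 2 then 1 / 2 ^ Suc s else 0)"
    by (simp add: sum.distrib sum_distrib_left)
  finally have "E (scale_pmf \<epsilon> L) (\<lambda>s. loss (w * mag L s))
      = \<epsilon> * (w / 2 * (\<Sum>s<L. if 2 ^ s * w \<le> 1 / 2 then 2 ^ s * w else 0)
          + (\<Sum>s<L. if 2 ^ s * w > 1 / 2 then 1 / 2 ^ Suc s else 0))" .
  \<comment> \<open>The 5/2 is 1/2 from the quadratic loss at steps up to 1/2, plus 2 from the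
    probability of a larger step, whose loss is capped at 1. The bound is free of
    \<open>L\<close>.\<close>
  also have "\<dots> \<le> \<epsilon> * (w / 2 * (2 * (1 / 2)) + w / (1 / 2))"
    using w eps by (intro mult_left_mono add_mono sum_scales_le sum_scales_gt) auto
  finally show ?thesis by (simp add: algebra_simps)
qed

text \<open>Each of the \<open>N\<close> scales in the window has probability
  \<open>\<epsilon> / 2 ^ Suc s\<close> and gain \<open>2 ^ s * w / 4\<close>, that is
  \<open>\<epsilon> * w / 8\<close> regardless of the scale.\<close>

lemma expected_window:
  assumes w: "w \<le> 1 / 2 ^ Suc N" "1 \<le> 2 ^ L * w"
  shows "E (scale_pmf \<epsilon> L) (\<lambda>s. if 1 / 2 ^ Suc N \<le> w * mag L s \<and> w * mag L s \<le> 1 / 2 then w * mag L s / 4 else 0)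
    \<ge> \<epsilon> * w * N / 8"
proof -
  have "0 < 2 ^ L * w" using w(2) by linarith
  hence w0: "w > 0" by (simp add: zero_less_mult_iff)
  have "\<epsilon> * w * N / 8 = \<epsilon> * (w / 8 * N)" by simp
  also have "\<dots> \<le> \<epsilon> * (w / 8 * (\<Sum>s<L. if 1 / 2 ^ Suc N \<le> 2 ^ s * w \<and> 2 ^ s * w \<le> 1 / 2 then 1 else 0))"
    using w w0 eps by (intro mult_left_mono count_scales_ge) auto
  also have "\<dots> = \<epsilon> * (\<Sum>s<L. (if 1 / 2 ^ Suc N \<le> w * mag L s \<and> w * mag L s \<le> 1 / 2 then w * mag L s / 4 else 0) / 2 ^ Suc s)"
    unfolding sum_distrib_left
    by (intro arg_cong2[where f="(*)"] sum.cong refl) (auto simp: mag_def mult.commute)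
  also have "\<dots> = E (scale_pmf \<epsilon> L) (\<lambda>s. if 1 / 2 ^ Suc N \<le> w * mag L s \<and> w * mag L s \<le> 1 / 2 then w * mag L s / 4 else 0)"
    by (rule expectation_scale_mag[symmetric, OF eps]) (simp add: mag_def)
  finally show ?thesis .
qed

text \<open>Only the row that is hit changes its factor, so the old potential factors out. The
  random sign makes \<open>y\<close> and \<open>- y\<close> indistinguishable, whence the absolute
  value.\<close>

lemma potential_step_eq:
  "E (col_pmf r (scale_pmf \<epsilon> L)) (\<lambda>c. potential r (\<lambda>i. z i + entry (\<lambda>s. y * mag L s) c i))
   = potential r z * E (scale_pmf \<epsilon> L) (\<lambda>s. (\<Sum>h<r. (phi (z h + \<bar>y\<bar> * mag L s) + phi (z h - \<bar>y\<bar> * mag L s)) / 2 / phi (z h)) / r)"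
proof -
  have fin: "finite (set_pmf (scale_pmf \<epsilon> L))" using eps by simp
  have sgn: "phi (u + y * x) + phi (u - y * x) = phi (u + \<bar>y\<bar> * x) + phi (u - \<bar>y\<bar> * x)" for u x
    by (cases "y \<ge> 0") (auto simp: abs_if)
  have upd: "potential r (\<lambda>i. z i + entry (\<lambda>s. y * mag L s) (h, \<sigma>, s) i)
      = potential r z * (phi (z h + \<sigma> * (y * mag L s)) / phi (z h))" if "h < r" for h \<sigma> s
    using potential_update[OF that, of z "\<sigma> * (y * mag L s)"] by (simp add: entry_def cong: if_cong)
  have "E (col_pmf r (scale_pmf \<epsilon> L)) (\<lambda>c. potential r (\<lambda>i. z i + entry (\<lambda>s. y * mag L s) c i))
    = (\<Sum>h<r. E (scale_pmf \<epsilon> L) (\<lambda>s. potential r z * ((phi (z h + \<bar>y\<bar> * mag L s) + phi (z h - \<bar>y\<bar> * mag L s)) / 2 / phi (z h)))) / r"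
    unfolding expectation_col[OF r fin]
  proof (intro arg_cong2[where f="(/)"] sum.cong refl)
    fix h assume "h \<in> {..<r}"
    hence h: "h < r" by simp
    show "(E (scale_pmf \<epsilon> L) (\<lambda>s. potential r (\<lambda>i. z i + entry (\<lambda>s. y * mag L s) (h, 1, s) i))
        + E (scale_pmf \<epsilon> L) (\<lambda>s. potential r (\<lambda>i. z i + entry (\<lambda>s. y * mag L s) (h, - 1, s) i))) / 2
      = E (scale_pmf \<epsilon> L) (\<lambda>s. potential r z * ((phi (z h + \<bar>y\<bar> * mag L s) + phi (z h - \<bar>y\<bar> * mag L s)) / 2 / phi (z h)))"
      unfolding upd[OF h] expectation_add_finite[OF fin, symmetric] sgn[symmetric]
      by (subst Bochner_Integration.integral_divide_zero[symmetric])
        (intro Bochner_Integration.integral_cong refl, simp add: add_divide_distrib algebra_simps)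
  qed
  also have "\<dots> = E (scale_pmf \<epsilon> L) (\<lambda>s. \<Sum>h<r. potential r z * ((phi (z h + \<bar>y\<bar> * mag L s) + phi (z h - \<bar>y\<bar> * mag L s)) / 2 / phi (z h))) / r"
    by (subst expectation_sum_finite[OF fin]) simp
  also have "\<dots> = E (scale_pmf \<epsilon> L) (\<lambda>s. potential r z * ((\<Sum>h<r. (phi (z h + \<bar>y\<bar> * mag L s) + phi (z h - \<bar>y\<bar> * mag L s)) / 2 / phi (z h)) / r))"
    by (subst Bochner_Integration.integral_divide_zero[symmetric]) (simp add: sum_distrib_left)
  also have "\<dots> = potential r z * E (scale_pmf \<epsilon> L) (\<lambda>s. (\<Sum>h<r. (phi (z h + \<bar>y\<bar> * mag L s) + phi (z h - \<bar>y\<bar> * mag L s)) / 2 / phi (z h)) / r)"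
    by simp
  finally show ?thesis .
qed

lemma potential_step_any:
  "E (col_pmf r (scale_pmf \<epsilon> L)) (\<lambda>c. potential r (\<lambda>i. z i + entry (\<lambda>s. y * mag L s) c i))
   \<le> potential r z * (1 + 5 / 2 * \<epsilon> * \<bar>y\<bar>)"
proof -
  have fin: "finite (set_pmf (scale_pmf \<epsilon> L))" using eps by simp
  have "E (scale_pmf \<epsilon> L) (\<lambda>s. (\<Sum>h<r. (phi (z h + \<bar>y\<bar> * mag L s) + phi (z h - \<bar>y\<bar> * mag L s)) / 2 / phi (z h)) / r)
     \<le> E (scale_pmf \<epsilon> L) (\<lambda>s. 1 + loss (\<bar>y\<bar> * mag L s))"
  proof (rule expectation_mono_finite[OF fin])
    fix s
    have "(\<Sum>h<r. (phi (z h + \<bar>y\<bar> * mag L s) + phi (z h - \<bar>y\<bar> * mag L s)) / 2 / phi (z h)) / r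
        \<le> (\<Sum>h<r. 1 + loss (\<bar>y\<bar> * mag L s)) / r"
      by (intro divide_right_mono sum_mono phi_ratio_le) auto
    also have "\<dots> = 1 + loss (\<bar>y\<bar> * mag L s)" using r by simp
    finally show "(\<Sum>h<r. (phi (z h + \<bar>y\<bar> * mag L s) + phi (z h - \<bar>y\<bar> * mag L s)) / 2 / phi (z h)) / r
        \<le> 1 + loss (\<bar>y\<bar> * mag L s)" .
  qed
  also have "\<dots> \<le> 1 + 5 / 2 * \<epsilon> * \<bar>y\<bar>"
    using expected_loss[of "\<bar>y\<bar>"] by (simp add: expectation_add_finite[OF fin])
  finally show ?thesis
    unfolding potential_step_eq using potential_bounds(1)[of r z] by (intro mult_left_mono) auto
qed

text \<open>The gain is \<open>\<epsilon> * \<bar>y\<bar> * N / 8\<close>. From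
  \<open>N \<ge> 40\<close> the loss 5/2 is at most \<open>N / 16\<close>, so it consumes no more
  than half of the gain.\<close>

lemma potential_step_light:
  assumes z: "\<not> spread_state z" and y: "\<bar>y\<bar> \<le> 1 / 2 ^ Suc N" "1 \<le> 2 ^ L * \<bar>y\<bar>"
  shows "E (col_pmf r (scale_pmf \<epsilon> L)) (\<lambda>c. potential r (\<lambda>i. z i + entry (\<lambda>s. y * mag L s) c i))
   \<le> potential r z * (1 - \<epsilon> * \<bar>y\<bar> * N / 16)"
proof -
  have fin: "finite (set_pmf (scale_pmf \<epsilon> L))" using eps by simp
  define win where "win s = (if 1 / 2 ^ Suc N \<le> \<bar>y\<bar> * mag L s \<and> \<bar>y\<bar> * mag L s \<le> 1 / 2 then \<bar>y\<bar> * mag L s / 4 else 0)" for s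
  have "E (scale_pmf \<epsilon> L) (\<lambda>s. (\<Sum>h<r. (phi (z h + \<bar>y\<bar> * mag L s) + phi (z h - \<bar>y\<bar> * mag L s)) / 2 / phi (z h)) / r)
     \<le> E (scale_pmf \<epsilon> L) (\<lambda>s. (1 + loss (\<bar>y\<bar> * mag L s)) - win s)"
  proof (rule expectation_mono_finite[OF fin])
    fix s
    define a where "a = \<bar>y\<bar> * mag L s"
    define B where "B = {i. i < r \<and> \<bar>z i\<bar> > 1 / 2 ^ Suc N / 2}"
    have a0: "a \<ge> 0" by (simp add: a_def)
    have B: "B \<subseteq> {..<r}" "finite B" unfolding B_def by auto
    \<comment> \<open>On rows outside \<open>B\<close> and for steps in the window,
      \<open>phi_gain\<close> saves \<open>a / 2\<close>, which is \<open>2 * win s\<close>. These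
      are at least half of the rows, so the average saving is at least \<open>win s\<close>.\<close>
    have "(\<Sum>h<r. (phi (z h + a) + phi (z h - a)) / 2 / phi (z h))
        \<le> (\<Sum>h<r. (1 + loss a) - (if h \<in> {..<r} - B then 2 * win s else 0))"
    proof (rule sum_mono)
      fix h assume h: "h \<in> {..<r}"
      show "(phi (z h + a) + phi (z h - a)) / 2 / phi (z h) \<le> (1 + loss a) - (if h \<in> {..<r} - B then 2 * win s else 0)"
      proof (cases "h \<notin> B \<and> 1 / 2 ^ Suc N \<le> a \<and> a \<le> 1 / 2")
        case True
        hence "(phi (z h + a) + phi (z h - a)) / 2 \<le> phi (z h) * (1 + a\<^sup>2 - a / 2)"
          using h by (intro phi_gain) (auto simp: B_def)
        hence "(phi (z h + a) + phi (z h - a)) / 2 / phi (z h) \<le> 1 + a\<^sup>2 - a / 2"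
          using phi_bounds(3)[of "z h"] by (simp add: divide_le_eq mult.commute)
        thus ?thesis using True h by (simp add: win_def a_def loss_def)
      next
        case False
        hence "(if h \<in> {..<r} - B then 2 * win s else 0) = 0" using h by (auto simp: win_def a_def)
        thus ?thesis using phi_ratio_le[OF a0, of "z h"] by simp
      qed
    qed
    also have "\<dots> = r * (1 + loss a) - card ({..<r} - B) * (2 * win s)"
      by (subst sum_subtractf, subst sum.inter_restrict[symmetric]) (auto simp: Int_absorb1)
    also have "\<dots> \<le> r * (1 + loss a) - r / 2 * (2 * win s)"
    proof -
      have "card ({..<r} - B) = r - card B" using B by (simp add: card_Diff_subset)
      moreover have "card B \<le> r" using card_mono[OF _ B(1)] by simp
      ultimately have "real r / 2 \<le> card ({..<r} - B)"
        using z unfolding spread_state_def B_def[symmetric] by (simp add: of_nat_diff)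
      hence "r / 2 * (2 * win s) \<le> card ({..<r} - B) * (2 * win s)"
        by (intro mult_right_mono) (auto simp: win_def)
      thus ?thesis by simp
    qed
    finally have "(\<Sum>h<r. (phi (z h + a) + phi (z h - a)) / 2 / phi (z h)) / r
        \<le> (r * (1 + loss a) - r / 2 * (2 * win s)) / r" by (rule divide_right_mono) simp
    also have "\<dots> = (1 + loss a) - win s" using r by (simp add: field_simps)
    finally show "(\<Sum>h<r. (phi (z h + \<bar>y\<bar> * mag L s) + phi (z h - \<bar>y\<bar> * mag L s)) / 2 / phi (z h)) / r
        \<le> (1 + loss (\<bar>y\<bar> * mag L s)) - win s" by (simp add: a_def)
  qed
  also have "\<dots> = 1 + E (scale_pmf \<epsilon> L) (\<lambda>s. loss (\<bar>y\<bar> * mag L s)) - E (scale_pmf \<epsilon> L) win"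
    by (simp add: expectation_add_finite[OF fin] expectation_diff_finite[OF fin])
  also have "\<dots> \<le> 1 + 5 / 2 * \<epsilon> * \<bar>y\<bar> - \<epsilon> * \<bar>y\<bar> * N / 8"
    using expected_loss[of "\<bar>y\<bar>"] expected_window[OF y] unfolding win_def[abs_def] by simp
  also have "\<dots> \<le> 1 - \<epsilon> * \<bar>y\<bar> * N / 16"
  proof -
    have "\<epsilon> * \<bar>y\<bar> * 40 \<le> \<epsilon> * \<bar>y\<bar> * N" using N eps by (intro mult_left_mono) auto
    thus ?thesis by simp
  qed
  finally show ?thesis
    unfolding potential_step_eq using potential_bounds(1)[of r z] by (intro mult_left_mono) auto
qed

text \<open>In a spread state the potential is already tiny; otherwise a light coordinate shrinks it.
  Coordinates outside \<open>\<Lambda>\<close> are absorbed into the arbitrary initial state \<open>z\<close>.\<close>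

lemma expected_potential:
  assumes K: "finite K"
    and light: "\<And>k. k \<in> \<Lambda> \<Longrightarrow> \<bar>y k\<bar> \<le> 1 / 2 ^ Suc N \<and> 1 \<le> 2 ^ L * \<bar>y k\<bar>"
  shows "E (sketch_pmf r (scale_pmf \<epsilon> L) K) (\<lambda>\<xi>. potential r (\<lambda>i. z i + rowsum K (\<lambda>k s. y k * mag L s) \<xi> i))
    \<le> exp (- (\<Sum>k\<in>K \<inter> \<Lambda>. \<epsilon> * \<bar>y k\<bar> * N / 16))
      + 2 * (\<Sum>k\<in>K \<inter> \<Lambda>. \<epsilon> * \<bar>y k\<bar> * N / 16) * exp (- (r / 2 ^ Suc N / 8))"
  using K
proof (induction K arbitrary: z rule: finite_induct)
  case empty
  show ?case using potential_bounds(2)[of r z] by (simp add: sketch_pmf_def rowsum_def)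
next
  case (insert x K)
  let ?q = "scale_pmf \<epsilon> L"
  let ?g = "\<lambda>k s. y k * mag L s"
  define \<delta> where "\<delta> = exp (- (r / 2 ^ Suc N / 8))"
  define G where "G K = (\<Sum>k\<in>K \<inter> \<Lambda>. \<epsilon> * \<bar>y k\<bar> * N / 16)" for K
  have q: "finite (set_pmf ?q)" using eps by simp
  have fin: "finite (set_pmf (sketch_pmf r ?q K))" using insert.hyps r q by simp
  have \<delta>: "\<delta> > 0" by (simp add: \<delta>_def)
  have G0: "G K \<ge> 0" for K using eps by (auto simp: G_def intro!: sum_nonneg)
  have IH: "E (sketch_pmf r ?q K) (\<lambda>\<xi>. potential r (\<lambda>i. z i + rowsum K ?g \<xi> i)) \<le> exp (- G K) + 2 * G K * \<delta>" for z
    using insert.IH[of z] by (simp add: G_def \<delta>_def)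
  have "E (sketch_pmf r ?q (insert x K)) (\<lambda>\<xi>. potential r (\<lambda>i. z i + rowsum (insert x K) ?g \<xi> i))
      \<le> exp (- G (insert x K)) + 2 * G (insert x K) * \<delta>"
  proof (cases "x \<in> \<Lambda>")
    case True
    define g where "g = \<epsilon> * \<bar>y x\<bar> * N / 16"
    have g0: "g \<ge> 0" using eps by (simp add: g_def)
    have G_ins: "G (insert x K) = g + G K" using True insert.hyps by (simp add: G_def g_def)
    have step: "E (col_pmf r ?q) (\<lambda>c. potential r (\<lambda>i. z i + rowsum (insert x K) ?g (\<xi>(x := c)) i))
        \<le> exp (- g) * potential r (\<lambda>i. z i + rowsum K ?g \<xi> i) + 2 * g * \<delta>" for \<xi>
    proof -
      define u where "u = (\<lambda>i. z i + rowsum K ?g \<xi> i)"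
      have eq: "(\<lambda>c. potential r (\<lambda>i. z i + rowsum (insert x K) ?g (\<xi>(x := c)) i))
          = (\<lambda>c. potential r (\<lambda>i. u i + entry (\<lambda>s. y x * mag L s) c i))"
        unfolding rowsum_insert[OF insert.hyps] u_def by (simp add: add.assoc)
      have g1: "1 - g \<le> exp (- g)" using exp_ge_add_one_self[of "- g"] by simp
      show ?thesis
      proof (cases "spread_state u")
        case False
        have "E (col_pmf r ?q) (\<lambda>c. potential r (\<lambda>i. u i + entry (\<lambda>s. y x * mag L s) c i)) \<le> potential r u * (1 - g)"
          using potential_step_light[OF False] light[OF True] unfolding g_def by blast
        also have "\<dots> \<le> potential r u * exp (- g)"
          using g1 potential_bounds(1)[of r u] by (intro mult_left_mono) auto
        finally show ?thesis unfolding eq using g0 \<delta> by (simp add: u_def[symmetric] mult.commute add_increasing2)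
      next
        case sp: True
        have pu: "potential r u \<le> \<delta>" unfolding \<delta>_def by (rule potential_spread[OF sp])
        have "\<epsilon> * \<bar>y x\<bar> * 40 \<le> \<epsilon> * \<bar>y x\<bar> * N" using N eps by (intro mult_left_mono) auto
        hence l: "5 / 2 * \<epsilon> * \<bar>y x\<bar> \<le> g" by (simp add: g_def)
        have "E (col_pmf r ?q) (\<lambda>c. potential r (\<lambda>i. u i + entry (\<lambda>s. y x * mag L s) c i))
            \<le> potential r u * (1 + 5 / 2 * \<epsilon> * \<bar>y x\<bar>)" by (rule potential_step_any)
        \<comment> \<open>Splitting \<open>1 + g\<close> this way gives both cases one recursion:
          the first part contracts like a light step, and the second is charged to
          \<open>\<delta>\<close>.\<close>
        also have "\<dots> \<le> potential r u * ((1 - g) + 2 * g)"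
          using l potential_bounds(1)[of r u] by (intro mult_left_mono) auto
        also have "\<dots> = potential r u * (1 - g) + potential r u * (2 * g)" by (simp only: distrib_left)
        also have "\<dots> \<le> potential r u * exp (- g) + \<delta> * (2 * g)"
          using pu g1 g0 potential_bounds(1)[of r u] by (intro add_mono mult_left_mono mult_right_mono) auto
        finally show ?thesis unfolding eq by (simp add: u_def[symmetric] mult.commute)
      qed
    qed
    have "E (sketch_pmf r ?q (insert x K)) (\<lambda>\<xi>. potential r (\<lambda>i. z i + rowsum (insert x K) ?g \<xi> i))
       \<le> E (sketch_pmf r ?q K) (\<lambda>\<xi>. exp (- g) * potential r (\<lambda>i. z i + rowsum K ?g \<xi> i) + 2 * g * \<delta>)"
      unfolding expectation_sketch_insert(1)[OF r q insert.hyps]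
      by (intro expectation_mono_finite[OF fin] step)
    also have "\<dots> = exp (- g) * E (sketch_pmf r ?q K) (\<lambda>\<xi>. potential r (\<lambda>i. z i + rowsum K ?g \<xi> i)) + 2 * g * \<delta>"
      by (simp add: expectation_add_finite[OF fin])
    also have "\<dots> \<le> exp (- g) * (exp (- G K) + 2 * G K * \<delta>) + 2 * g * \<delta>"
      by (intro add_right_mono mult_left_mono IH) simp
    also have "\<dots> \<le> (exp (- g) * exp (- G K) + 1 * (2 * G K * \<delta>)) + 2 * g * \<delta>"
    proof -
      have "exp (- g) * (2 * G K * \<delta>) \<le> 1 * (2 * G K * \<delta>)"
        using g0 G0[of K] \<delta> by (intro mult_right_mono) simp_all
      thus ?thesis unfolding distrib_left by simp
    qed
    finally show ?thesis unfolding G_ins by (simp add: exp_add[symmetric] algebra_simps)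
  next
    case False
    hence G_ins: "G (insert x K) = G K" by (simp add: G_def)
    have "E (sketch_pmf r ?q (insert x K)) (\<lambda>\<xi>. potential r (\<lambda>i. z i + rowsum (insert x K) ?g \<xi> i))
      \<le> E (col_pmf r ?q) (\<lambda>c. exp (- G K) + 2 * G K * \<delta>)"
      unfolding expectation_sketch_insert(2)[OF r q insert.hyps]
    proof (rule expectation_mono_finite)
      fix c
      show "E (sketch_pmf r ?q K) (\<lambda>\<xi>. potential r (\<lambda>i. z i + rowsum (insert x K) ?g (\<xi>(x := c)) i))
         \<le> exp (- G K) + 2 * G K * \<delta>"
        using IH[of "\<lambda>i. z i + entry (?g x) c i"] unfolding rowsum_insert[OF insert.hyps]
        by (simp add: algebra_simps)
    qed (use r q in simp)
    thus ?thesis unfolding G_ins by simp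
  qed
  thus ?case by (simp add: G_def \<delta>_def)
qed

text \<open>An exponential Markov inequality: an l1 norm of at most \<open>b * G / 4\<close> forces
  the potential of the rescaled row sums up to \<open>exp (- G / 2)\<close>, while its mean is at
  most \<open>2 * exp (- G)\<close>. Dividing by \<open>b\<close> puts the light coordinates at or
  below the window, so that all \<open>N\<close> scales serve each of them.\<close>

lemma heavy_part_lower:
  assumes K: "finite K" "\<Lambda> \<subseteq> K" and b: "b > 0"
    and light: "\<And>k. k \<in> \<Lambda> \<Longrightarrow> \<bar>y k\<bar> \<le> b / 2 ^ Suc N \<and> b \<le> 2 ^ L * \<bar>y k\<bar>"
    and G: "G = \<epsilon> * N * (\<Sum>k\<in>\<Lambda>. \<bar>y k\<bar>) / (16 * b)" and rows: "24 * G \<le> r / 2 ^ Suc N"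
  shows "measure_pmf.prob (sketch_pmf r (scale_pmf \<epsilon> L) K)
      {\<xi>. (\<Sum>i<r. \<bar>rowsum K (\<lambda>k s. y k * mag L s) \<xi> i\<bar>) \<le> b * G / 4} \<le> 2 * exp (- G / 2)"
proof -
  let ?q = "scale_pmf \<epsilon> L"
  let ?P = "sketch_pmf r ?q K"
  have q: "finite (set_pmf ?q)" using eps by simp
  have fin: "finite (set_pmf ?P)" using K r q by simp
  have G': "(\<Sum>k\<in>K \<inter> \<Lambda>. \<epsilon> * \<bar>y k / b\<bar> * N / 16) = G"
    using K(2) b by (simp add: Int_absorb1 G sum_distrib_left sum_divide_distrib abs_divide field_simps)
  have G0: "G \<ge> 0" unfolding G using eps b by (auto intro!: divide_nonneg_nonneg mult_nonneg_nonneg sum_nonneg)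
  have E_le: "E ?P (\<lambda>\<xi>. potential r (rowsum K (\<lambda>k s. y k / b * mag L s) \<xi>)) \<le> 2 * exp (- G)"
  proof -
    have "E ?P (\<lambda>\<xi>. potential r (\<lambda>i. 0 + rowsum K (\<lambda>k s. y k / b * mag L s) \<xi> i))
        \<le> exp (- G) + 2 * G * exp (- (r / 2 ^ Suc N / 8))"
      unfolding G'[symmetric] using b light
      by (intro expected_potential K) (auto simp: abs_divide field_simps)
    \<comment> \<open>The assumption \<open>rows\<close> bounds the spread-state term by
      \<open>exp (- (3 * G))\<close>, leaving room to absorb its factor \<open>2 * G\<close> into
      \<open>exp (2 * G)\<close>.\<close>
    also have "\<dots> \<le> exp (- G) + exp (2 * G) * exp (- (3 * G))"
    proof (intro add_left_mono mult_mono)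
      show "2 * G \<le> exp (2 * G)" using exp_ge_add_one_self[of "2 * G"] by linarith
    qed (use rows G0 in auto)
    also have "exp (2 * G) * exp (- (3 * G)) = exp (- G)" by (simp add: exp_add[symmetric])
    finally show ?thesis by simp
  qed
  have "measure_pmf.prob ?P {\<xi>. (\<Sum>i<r. \<bar>rowsum K (\<lambda>k s. y k * mag L s) \<xi> i\<bar>) \<le> b * G / 4}
      \<le> measure_pmf.prob ?P {\<xi>. potential r (rowsum K (\<lambda>k s. y k / b * mag L s) \<xi>) \<ge> exp (- G / 2)}"
  proof (intro measure_pmf.finite_measure_mono subsetI CollectI; (simp; fail)?)
    fix \<xi> assume "\<xi> \<in> {\<xi>. (\<Sum>i<r. \<bar>rowsum K (\<lambda>k s. y k * mag L s) \<xi> i\<bar>) \<le> b * G / 4}"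
    hence *: "(\<Sum>i<r. \<bar>rowsum K (\<lambda>k s. y k * mag L s) \<xi> i\<bar>) \<le> b * G / 4" by simp
    have sc: "rowsum K (\<lambda>k s. y k / b * mag L s) \<xi> i = rowsum K (\<lambda>k s. y k * mag L s) \<xi> i / b" for i
      unfolding rowsum_def sum_divide_distrib by (intro sum.cong) (auto simp: entry_def)
    have "(\<Sum>i<r. \<bar>rowsum K (\<lambda>k s. y k / b * mag L s) \<xi> i\<bar>)
        = (\<Sum>i<r. \<bar>rowsum K (\<lambda>k s. y k * mag L s) \<xi> i\<bar>) / b"
      using b by (simp only: sc abs_divide sum_divide_distrib abs_of_pos)
    also have "\<dots> \<le> G / 4" using * b by (simp add: divide_le_eq mult.commute)
    finally have "- G / 2 \<le> (\<Sum>i<r. - 2 * \<bar>rowsum K (\<lambda>k s. y k / b * mag L s) \<xi> i\<bar>)"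
      unfolding sum_distrib_left[symmetric] by linarith
    hence "exp (- G / 2) \<le> exp (\<Sum>i<r. - 2 * \<bar>rowsum K (\<lambda>k s. y k / b * mag L s) \<xi> i\<bar>)"
      by (simp only: exp_le_cancel_iff)
    also have "\<dots> = (\<Prod>i<r. exp (- 2 * \<bar>rowsum K (\<lambda>k s. y k / b * mag L s) \<xi> i\<bar>))"
      by (rule exp_sum) simp
    also have "\<dots> \<le> potential r (rowsum K (\<lambda>k s. y k / b * mag L s) \<xi>)"
      unfolding potential_def by (intro prod_mono conjI phi_ge_exp) auto
    finally show "potential r (rowsum K (\<lambda>k s. y k / b * mag L s) \<xi>) \<ge> exp (- G / 2)" .
  qed
  also have "\<dots> \<le> 2 * exp (- G / 2)"
  proof (rule markov_finite[OF fin])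
    have "exp (- G) = exp (- G / 2) * exp (- G / 2)" by (simp add: exp_add[symmetric])
    thus "E ?P (\<lambda>\<xi>. potential r (rowsum K (\<lambda>k s. y k / b * mag L s) \<xi>)) \<le> 2 * exp (- G / 2) * exp (- G / 2)"
      using E_le by simp
  qed (use potential_bounds in \<open>auto intro: less_imp_le\<close>)
  finally show ?thesis .
qed

end

subsection \<open>The two parts of the embedding\<close>

definition sign_norm :: "nat \<Rightarrow> nat \<Rightarrow> (nat \<Rightarrow> nat \<times> real \<times> nat) \<Rightarrow> (nat \<Rightarrow> real) \<Rightarrow> real" where
  "sign_norm n r \<xi> y = (\<Sum>i<r. \<bar>rowsum {..<n} (\<lambda>k _. y k) \<xi> i\<bar>)"

definition heavy_norm :: "nat \<Rightarrow> nat \<Rightarrow> nat \<Rightarrow> (nat \<Rightarrow> nat \<times> real \<times> nat) \<Rightarrow> (nat \<Rightarrow> real) \<Rightarrow> real" where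
  "heavy_norm L n r \<xi> y = (\<Sum>i<r. \<bar>rowsum {..<n} (\<lambda>k s. y k * mag L s) \<xi> i\<bar>)"

section \<open>Linearity and norm inequalities for the two blocks\<close>

lemma rowsum_cong:
  assumes "\<And>k s. k \<in> K \<Longrightarrow> g k s = g' k s"
  shows "rowsum K g \<xi> i = rowsum K g' \<xi> i"
  unfolding rowsum_def using assms by (intro sum.cong) (auto simp: entry_def)

lemma rowsum_linear:
  "rowsum K (\<lambda>k s. \<Sum>j\<in>I. \<alpha> j * g j k s) \<xi> i = (\<Sum>j\<in>I. \<alpha> j * rowsum K (g j) \<xi> i)"
proof -
  have "rowsum K (\<lambda>k s. \<Sum>j\<in>I. \<alpha> j * g j k s) \<xi> i = (\<Sum>k\<in>K. \<Sum>j\<in>I. \<alpha> j * entry (g j k) (\<xi> k) i)"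
    unfolding rowsum_def by (intro sum.cong) (auto simp: entry_def sum_distrib_left mult_ac)
  also have "\<dots> = (\<Sum>j\<in>I. \<Sum>k\<in>K. \<alpha> j * entry (g j k) (\<xi> k) i)" by (rule sum.swap)
  finally show ?thesis by (simp add: rowsum_def sum_distrib_left)
qed

lemma heavy_norm_cong:
  "(\<And>k. k < n \<Longrightarrow> y k = y' k) \<Longrightarrow> heavy_norm L n r \<xi> y = heavy_norm L n r \<xi> y'"
  unfolding heavy_norm_def
  by (intro sum.cong arg_cong[where f = abs] rowsum_cong refl) auto

lemma heavy_norm_combination_le:
  "heavy_norm L n r \<xi> (\<lambda>k. \<Sum>j<m. \<alpha> j * v j k) \<le> (\<Sum>j<m. \<bar>\<alpha> j\<bar> * heavy_norm L n r \<xi> (v j))"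
proof -
  have "rowsum {..<n} (\<lambda>k s. (\<Sum>j<m. \<alpha> j * v j k) * mag L s) \<xi> i
      = (\<Sum>j<m. \<alpha> j * rowsum {..<n} (\<lambda>k s. v j k * mag L s) \<xi> i)" for i
    by (subst rowsum_linear[symmetric]) (simp add: sum_distrib_right mult.assoc)
  hence "heavy_norm L n r \<xi> (\<lambda>k. \<Sum>j<m. \<alpha> j * v j k)
      \<le> (\<Sum>i<r. \<Sum>j<m. \<bar>\<alpha> j\<bar> * \<bar>rowsum {..<n} (\<lambda>k s. v j k * mag L s) \<xi> i\<bar>)"
    unfolding heavy_norm_def by (intro sum_mono) (simp add: abs_mult[symmetric] sum_abs)
  also have "\<dots> = (\<Sum>j<m. \<bar>\<alpha> j\<bar> * heavy_norm L n r \<xi> (v j))"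
    unfolding heavy_norm_def by (subst sum.swap) (simp add: sum_distrib_left)
  finally show ?thesis .
qed

lemma heavy_norm_triangle:
  "heavy_norm L n r \<xi> (\<lambda>k. y k + y' k) \<le> heavy_norm L n r \<xi> y + heavy_norm L n r \<xi> y'"
proof -
  have "rowsum {..<n} (\<lambda>k s. (y k + y' k) * mag L s) \<xi> i
      = rowsum {..<n} (\<lambda>k s. y k * mag L s) \<xi> i + rowsum {..<n} (\<lambda>k s. y' k * mag L s) \<xi> i" for i
    unfolding rowsum_def sum.distrib[symmetric] by (intro sum.cong) (auto simp: entry_def algebra_simps)
  thus ?thesis unfolding heavy_norm_def sum.distrib[symmetric]
    by (intro sum_mono) (simp add: abs_triangle_ineq)
qed

lemma heavy_norm_scale: "heavy_norm L n r \<xi> (\<lambda>k. c * y k) = \<bar>c\<bar> * heavy_norm L n r \<xi> y"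
proof -
  have "rowsum {..<n} (\<lambda>k s. c * y k * mag L s) \<xi> i = c * rowsum {..<n} (\<lambda>k s. y k * mag L s) \<xi> i" for i
    unfolding rowsum_def sum_distrib_left by (intro sum.cong) (auto simp: entry_def)
  thus ?thesis by (simp add: heavy_norm_def abs_mult sum_distrib_left)
qed

lemma heavy_norm_minus: "heavy_norm L n r \<xi> (\<lambda>k. - y k) = heavy_norm L n r \<xi> y"
  using heavy_norm_scale[of L n r \<xi> "-1" y] by simp

lemma sign_norm_le_l1:
  assumes "\<And>k. k < n \<Longrightarrow> fst (\<xi> k) < r \<and> \<bar>fst (snd (\<xi> k))\<bar> = 1"
  shows "sign_norm n r \<xi> y \<le> (\<Sum>k<n. \<bar>y k\<bar>)"
proof -
  have "sign_norm n r \<xi> y \<le> (\<Sum>i<r. \<Sum>k<n. \<bar>entry (\<lambda>_. y k) (\<xi> k) i\<bar>)"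
    unfolding sign_norm_def rowsum_def by (intro sum_mono sum_abs)
  also have "\<dots> = (\<Sum>k<n. \<Sum>i<r. if fst (\<xi> k) = i then \<bar>y k\<bar> else 0)"
    by (subst sum.swap) (auto simp: entry_def abs_mult assms intro!: sum.cong)
  also have "\<dots> = (\<Sum>k<n. \<bar>y k\<bar>)" using assms by (intro sum.cong) auto
  finally show ?thesis .
qed

lemma sum_squares_le_square_sum:
  fixes f :: "'a \<Rightarrow> real"
  assumes "finite A"
  shows "(\<Sum>i\<in>A. (f i)\<^sup>2) \<le> (\<Sum>i\<in>A. \<bar>f i\<bar>)\<^sup>2"
proof -
  have "(\<Sum>i\<in>A. (f i)\<^sup>2) = (\<Sum>i\<in>A. \<bar>f i\<bar> * \<bar>f i\<bar>)" by (simp add: power2_eq_square)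
  also have "\<dots> \<le> (\<Sum>i\<in>A. \<bar>f i\<bar> * (\<Sum>j\<in>A. \<bar>f j\<bar>))"
    using assms by (intro sum_mono mult_left_mono member_le_sum) auto
  also have "\<dots> = (\<Sum>i\<in>A. \<bar>f i\<bar>)\<^sup>2" by (simp add: power2_eq_square sum_distrib_right)
  finally show ?thesis .
qed

subsection \<open>The sign part as an l2 subspace embedding\<close>

text \<open>The squared Frobenius norm of the deviation of the sketched Gram matrix from the true
  one. It dominates the squared operator norm, which is what an embedding needs, and its mean is a
  plain sum of second moments.\<close>

definition gram_error :: "nat \<Rightarrow> nat \<Rightarrow> nat \<Rightarrow> (nat \<Rightarrow> nat \<Rightarrow> real) \<Rightarrow> (nat \<Rightarrow> nat \<times> real \<times> nat) \<Rightarrow> real" where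
  "gram_error n r m b \<xi> = (\<Sum>a<m. \<Sum>c<m. ((\<Sum>i<r. rowsum {..<n} (\<lambda>k _. b a k) \<xi> i * rowsum {..<n} (\<lambda>k _. b c k) \<xi> i)
            - (\<Sum>k<n. b a k * b c k))\<^sup>2)"

lemma prob_gram_error:
  assumes r: "r > 0" and q: "finite (set_pmf q)"
    and b: "\<And>a. a < m \<Longrightarrow> (\<Sum>k<n. (b a k)\<^sup>2) = 1"
  shows "measure_pmf.prob (sketch_pmf r q {..<n}) {\<xi>. gram_error n r m b \<xi> \<ge> 1 / 4} \<le> 8 * (real m)\<^sup>2 / r"
proof -
  let ?P = "sketch_pmf r q {..<n}"
  have fin: "finite (set_pmf ?P)" using r q by simp
  show ?thesis
  proof (rule markov_finite[OF fin, where f = "gram_error n r m b" and t = "1 / 4"])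
    show "(0::real) < 1 / 4" by simp
    show "gram_error n r m b \<xi> \<ge> 0" for \<xi> by (auto simp: gram_error_def intro!: sum_nonneg)
    have "E ?P (gram_error n r m b) = (\<Sum>a<m. \<Sum>c<m. E ?P (\<lambda>\<xi>. ((\<Sum>i<r. rowsum {..<n} (\<lambda>k _. b a k) \<xi> i * rowsum {..<n} (\<lambda>k _. b c k) \<xi> i)
            - (\<Sum>k<n. b a k * b c k))\<^sup>2))"
      unfolding gram_error_def by (simp only: expectation_sum_finite[OF fin])
    also have "\<dots> \<le> (\<Sum>a<m. \<Sum>c<m. 2 / r * ((\<Sum>k<n. (b a k)\<^sup>2) * (\<Sum>k<n. (b c k)\<^sup>2)))"
      using r q by (intro sum_mono second_moment_gram) auto
    also have "\<dots> = 8 * (real m)\<^sup>2 / r * (1 / 4)" using b by (simp add: power2_eq_square)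
    finally show "E ?P (gram_error n r m b) \<le> 8 * (real m)\<^sup>2 / r * (1 / 4)" .
  qed
qed

text \<open>A deviation of Frobenius norm below 1/2 changes the quadratic form by at most half of
  \<open>Z\<close>. The l1 norm of the sketch then dominates its l2 norm.\<close>

lemma sign_norm_lower:
  assumes ort: "\<And>a c. a < m \<Longrightarrow> c < m \<Longrightarrow> (\<Sum>k<n. b a k * b c k) = (if a = c then 1 else (0::real))"
    and err: "gram_error n r m b \<xi> < 1 / 4"
    and y: "\<And>k. k < n \<Longrightarrow> y k = (\<Sum>a<m. z a * b a k)"
  shows "(\<Sum>k<n. (y k)\<^sup>2) / 2 \<le> (sign_norm n r \<xi> y)\<^sup>2"
proof -
  define R where "R a i = rowsum {..<n} (\<lambda>k _. b a k) \<xi> i" for a i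
  define Q where "Q a c = (\<Sum>i<r. R a i * R c i) - (\<Sum>k<n. b a k * b c k)" for a c
  define Z where "Z = (\<Sum>a<m. (z a)\<^sup>2)"
  have Z0: "Z \<ge> 0" by (simp add: Z_def sum_nonneg)
  have delta: "(\<Sum>a<m. \<Sum>c<m. z a * z c * (\<Sum>k<n. b a k * b c k)) = Z"
  proof -
    have "(\<Sum>a<m. \<Sum>c<m. z a * z c * (\<Sum>k<n. b a k * b c k)) = (\<Sum>a<m. \<Sum>c<m. if c = a then z a * z c else 0)"
      by (intro sum.cong) (auto simp: ort)
    thus ?thesis by (simp add: Z_def power2_eq_square)
  qed
  have Zy: "(\<Sum>k<n. (y k)\<^sup>2) = Z"
  proof -
    have "(\<Sum>k<n. (y k)\<^sup>2) = (\<Sum>k<n. \<Sum>a<m. \<Sum>c<m. z a * z c * (b a k * b c k))"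
      by (intro sum.cong refl) (simp add: y power2_eq_square sum_product mult_ac)
    also have "\<dots> = (\<Sum>a<m. \<Sum>k<n. \<Sum>c<m. z a * z c * (b a k * b c k))" by (rule sum.swap)
    also have "\<dots> = (\<Sum>a<m. \<Sum>c<m. \<Sum>k<n. z a * z c * (b a k * b c k))" by (intro sum.cong refl sum.swap)
    finally show ?thesis using delta by (simp add: sum_distrib_left)
  qed
  have Ry: "rowsum {..<n} (\<lambda>k _. y k) \<xi> i = (\<Sum>a<m. z a * R a i)" for i
    unfolding R_def rowsum_linear[symmetric] by (rule rowsum_cong) (simp add: y)
  have S: "(\<Sum>i<r. (rowsum {..<n} (\<lambda>k _. y k) \<xi> i)\<^sup>2) = (\<Sum>a<m. \<Sum>c<m. z a * z c * (\<Sum>i<r. R a i * R c i))"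
  proof -
    have "(\<Sum>i<r. (rowsum {..<n} (\<lambda>k _. y k) \<xi> i)\<^sup>2) = (\<Sum>i<r. \<Sum>a<m. \<Sum>c<m. z a * z c * (R a i * R c i))"
      by (intro sum.cong refl) (simp add: Ry power2_eq_square sum_product mult_ac)
    also have "\<dots> = (\<Sum>a<m. \<Sum>i<r. \<Sum>c<m. z a * z c * (R a i * R c i))" by (rule sum.swap)
    also have "\<dots> = (\<Sum>a<m. \<Sum>c<m. \<Sum>i<r. z a * z c * (R a i * R c i))" by (intro sum.cong refl sum.swap)
    finally show ?thesis by (simp add: sum_distrib_left)
  qed
  also have "\<dots> = Z + (\<Sum>a<m. \<Sum>c<m. z a * z c * Q a c)"
    unfolding delta[symmetric] Q_def by (simp add: sum.distrib[symmetric] algebra_simps)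
  finally have S': "(\<Sum>i<r. (rowsum {..<n} (\<lambda>k _. y k) \<xi> i)\<^sup>2) = Z + (\<Sum>a<m. \<Sum>c<m. z a * z c * Q a c)" .
  have "- (\<Sum>a<m. \<Sum>c<m. z a * z c * Q a c) \<le> Z / 2"
  proof (cases "Z = 0")
    case True
    hence "z a = 0" if "a < m" for a
      using that unfolding Z_def by (subst (asm) sum_nonneg_eq_0_iff) auto
    thus ?thesis using True by simp
  next
    case False
    with Z0 have Z: "Z > 0" by simp
    have "- (\<Sum>a<m. \<Sum>c<m. z a * z c * Q a c) \<le> (\<Sum>a<m. \<Sum>c<m. (z a)\<^sup>2 * (z c)\<^sup>2 / (4 * Z) + Z * (Q a c)\<^sup>2)"
      unfolding sum_negf[symmetric]
    proof (intro sum_mono)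
      fix a c
      \<comment> \<open>Completing the square acts as Cauchy-Schwarz. With these weights each of the
        two resulting sums is at most \<open>Z / 4\<close>.\<close>
      have "0 \<le> (z a * z c / 2 + Z * Q a c)\<^sup>2 / Z" using Z by simp
      also have "\<dots> = (z a)\<^sup>2 * (z c)\<^sup>2 / (4 * Z) + Z * (Q a c)\<^sup>2 + z a * z c * Q a c"
        using Z by (simp add: power2_eq_square field_simps)
      finally show "- (z a * z c * Q a c) \<le> (z a)\<^sup>2 * (z c)\<^sup>2 / (4 * Z) + Z * (Q a c)\<^sup>2" by simp
    qed
    also have "\<dots> = Z * Z / (4 * Z) + Z * gram_error n r m b \<xi>"
    proof -
      have "(\<Sum>a<m. \<Sum>c<m. (z a)\<^sup>2 * (z c)\<^sup>2 / (4 * Z)) = Z * Z / (4 * Z)"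
        unfolding sum_divide_distrib[symmetric] sum_product[symmetric] Z_def[symmetric] ..
      moreover have "(\<Sum>a<m. \<Sum>c<m. Z * (Q a c)\<^sup>2) = Z * gram_error n r m b \<xi>"
        unfolding gram_error_def Q_def R_def sum_distrib_left ..
      ultimately show ?thesis by (simp add: sum.distrib)
    qed
    also have "\<dots> \<le> Z * Z / (4 * Z) + Z * (1 / 4)"
      using err Z by (intro add_left_mono mult_left_mono) auto
    also have "\<dots> = Z / 2" using Z by simp
    finally show ?thesis .
  qed
  hence "Z / 2 \<le> (\<Sum>i<r. (rowsum {..<n} (\<lambda>k _. y k) \<xi> i)\<^sup>2)" using S' by simp
  also have "\<dots> \<le> (sign_norm n r \<xi> y)\<^sup>2"
    unfolding sign_norm_def by (rule sum_squares_le_square_sum) simp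
  finally show ?thesis by (simp add: Zy)
qed

subsection \<open>The heavy-tailed part on spread vectors\<close>

lemma heavy_norm_spread_vector:
  fixes D N L n :: nat and \<epsilon> :: real
  assumes D: "D > 0" and eps: "0 \<le> \<epsilon>" "\<epsilon> \<le> 1" and N: "N \<ge> 40" and n: "n > 0"
    and L: "48 * n * N * 2 ^ N \<le> (2::real) ^ L * D\<^sup>2"
    and y2: "(\<Sum>k<n. (y k)\<^sup>2) \<le> 4 / D\<^sup>2" and y1: "9 / 10 \<le> (\<Sum>k<n. \<bar>y k\<bar>)" "(\<Sum>k<n. \<bar>y k\<bar>) \<le> 2"
  shows "measure_pmf.prob (sketch_pmf (D\<^sup>2) (scale_pmf \<epsilon> L) {..<n}) {\<xi>. heavy_norm L n (D\<^sup>2) \<xi> y \<le> \<epsilon> * N / 128}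
      \<le> 2 * exp (- (\<epsilon> * D\<^sup>2 / (384 * 2 ^ N)))"
proof -
  let ?P = "sketch_pmf (D\<^sup>2) (scale_pmf \<epsilon> L) {..<n}"
  \<comment> \<open>By the l2 bound, coordinates above \<open>\<theta>\<close> carry mass at most
    \<open>4 / (3 * N)\<close>, hence at most 1/30. The factor \<open>N\<close> cancels the one in
    \<open>G\<close>, and the 3 makes \<open>24 * G \<le> D\<^sup>2 / 2 ^ Suc N\<close> equivalent
    to \<open>\<epsilon> * W \<le> 2\<close>.\<close>
  define \<theta> where "\<theta> = 3 * N / (real D)\<^sup>2"
  define b where "b = 2 ^ Suc N * \<theta>"
  \<comment> \<open>Coordinates below \<open>1 / (8 * n)\<close> carry mass at most 1/8 together.
    This lower cutoff is what ties the number \<open>L\<close> of scales to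
    \<open>n\<close>.\<close>
  define \<Lambda> where "\<Lambda> = {k. k < n \<and> 1 / (8 * n) \<le> \<bar>y k\<bar> \<and> \<bar>y k\<bar> \<le> \<theta>}"
  define W where "W = (\<Sum>k\<in>\<Lambda>. \<bar>y k\<bar>)"
  define G where "G = \<epsilon> * N * W / (16 * b)"
  have \<theta>: "\<theta> > 0" using D N by (simp add: \<theta>_def)
  have b: "b > 0" using \<theta> by (simp add: b_def)
  have \<Lambda>: "\<Lambda> \<subseteq> {..<n}" unfolding \<Lambda>_def by auto
  have W2: "W \<le> 2"
  proof -
    have "W \<le> (\<Sum>k<n. \<bar>y k\<bar>)" unfolding W_def by (intro sum_mono2 \<Lambda>) auto
    thus ?thesis using y1 by simp
  qed
  have W1: "1 / 2 \<le> W"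
  proof -
    have "(\<Sum>k<n. \<bar>y k\<bar>) \<le> (\<Sum>k<n. (if k \<in> \<Lambda> then \<bar>y k\<bar> else 0) + 1 / (8 * n) + (y k)\<^sup>2 / \<theta>)"
    proof (rule sum_mono)
      fix k assume k: "k \<in> {..<n}"
      have nn: "0 \<le> (y k)\<^sup>2 / \<theta>" "0 \<le> 1 / (8 * real n)" using \<theta> by simp_all
      consider "k \<in> \<Lambda>" | "\<bar>y k\<bar> < 1 / (8 * n)" | "\<bar>y k\<bar> > \<theta>" "k \<notin> \<Lambda>"
        using k by (force simp: \<Lambda>_def)
      thus "\<bar>y k\<bar> \<le> (if k \<in> \<Lambda> then \<bar>y k\<bar> else 0) + 1 / (8 * n) + (y k)\<^sup>2 / \<theta>"
      proof cases
        case 1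
        thus ?thesis using nn by simp
      next
        case 2
        hence "\<bar>y k\<bar> \<le> 1 / (8 * n)" by simp
        moreover have "0 \<le> (if k \<in> \<Lambda> then \<bar>y k\<bar> else 0)" by simp
        ultimately show ?thesis using nn by linarith
      next
        case 3
        have "\<bar>y k\<bar> * \<theta> \<le> \<bar>y k\<bar> * \<bar>y k\<bar>" using 3 by (intro mult_left_mono) auto
        hence "\<bar>y k\<bar> \<le> (y k)\<^sup>2 / \<theta>" using \<theta> by (simp add: le_divide_eq power2_eq_square)
        moreover have "0 \<le> (if k \<in> \<Lambda> then \<bar>y k\<bar> else 0)" by simp
        ultimately show ?thesis using nn by linarith
      qed
    qed
    also have "\<dots> = W + 1 / 8 + (\<Sum>k<n. (y k)\<^sup>2) / \<theta>"
      using n \<Lambda> by (simp add: sum.distrib W_def sum.inter_restrict[symmetric] Int_absorb1 sum_divide_distrib)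
    finally have "9 / 10 \<le> W + 1 / 8 + (\<Sum>k<n. (y k)\<^sup>2) / \<theta>" using y1 by simp
    moreover have "(\<Sum>k<n. (y k)\<^sup>2) / \<theta> \<le> (4 / (real D)\<^sup>2) / \<theta>"
      using y2 \<theta> by (intro divide_right_mono) auto
    moreover have "(4 / (real D)\<^sup>2) / \<theta> = 4 / (3 * N)" using D by (simp add: \<theta>_def)
    moreover have "4 / (3 * N) \<le> 1 / (30::real)" using N by (simp add: divide_le_eq)
    ultimately show ?thesis by linarith
  qed
  have bN: "b * (real D)\<^sup>2 = 6 * N * 2 ^ N" using D by (simp add: b_def \<theta>_def)
  have G_eq: "G = \<epsilon> * W * D\<^sup>2 / (96 * 2 ^ N)"
    using D N by (simp add: G_def b_def \<theta>_def field_simps)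
  have "measure_pmf.prob ?P {\<xi>. (\<Sum>i<D\<^sup>2. \<bar>rowsum {..<n} (\<lambda>k s. y k * mag L s) \<xi> i\<bar>) \<le> b * G / 4} \<le> 2 * exp (- G / 2)"
  proof (rule heavy_part_lower[of "D\<^sup>2" \<epsilon> N "{..<n}" \<Lambda> b y L G])
    show "\<bar>y k\<bar> \<le> b / 2 ^ Suc N \<and> b \<le> 2 ^ L * \<bar>y k\<bar>" if k: "k \<in> \<Lambda>" for k
    proof
      show "\<bar>y k\<bar> \<le> b / 2 ^ Suc N" using k by (simp add: \<Lambda>_def b_def)
      have "b * (8 * n) \<le> 2 ^ L"
      proof -
        have "b * (8 * n) * (real D)\<^sup>2 = 48 * n * N * 2 ^ N" using bN by (simp add: mult_ac)
        also have "\<dots> \<le> 2 ^ L * (real D)\<^sup>2" using L by simp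
        finally show ?thesis using D by simp
      qed
      hence "b \<le> 2 ^ L * (1 / (8 * n))" using n by (simp add: field_simps)
      also have "\<dots> \<le> 2 ^ L * \<bar>y k\<bar>" using k by (intro mult_left_mono) (auto simp: \<Lambda>_def)
      finally show "b \<le> 2 ^ L * \<bar>y k\<bar>" .
    qed
    show "24 * G \<le> real (D\<^sup>2) / 2 ^ Suc N"
    proof -
      have "\<epsilon> * W \<le> 1 * 2" using eps W2 W1 by (intro mult_mono) auto
      hence "\<epsilon> * W * (D\<^sup>2 / (4 * 2 ^ N)) \<le> 2 * (D\<^sup>2 / (4 * 2 ^ N))" by (intro mult_right_mono) auto
      thus ?thesis unfolding G_eq by (simp add: mult_ac)
    qed
  qed (use D eps N \<Lambda> b in \<open>auto simp: G_def W_def\<close>)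
  \<comment> \<open>The scale \<open>b\<close> cancels in \<open>b * G\<close>, so the guaranteed
    norm is \<open>\<epsilon> * N * W / 64\<close> with \<open>W\<close> at least 1/2.\<close>
  moreover have "\<epsilon> * N / 128 \<le> b * G / 4"
  proof -
    have "\<epsilon> * N * (1 / 2) \<le> \<epsilon> * N * W" using W1 eps by (intro mult_left_mono) auto
    thus ?thesis using b by (simp add: G_def)
  qed
  hence "{\<xi>. heavy_norm L n (D\<^sup>2) \<xi> y \<le> \<epsilon> * N / 128}
      \<subseteq> {\<xi>. (\<Sum>i<D\<^sup>2. \<bar>rowsum {..<n} (\<lambda>k s. y k * mag L s) \<xi> i\<bar>) \<le> b * G / 4}"
    by (auto simp: heavy_norm_def)
  hence "measure_pmf.prob ?P {\<xi>. heavy_norm L n (D\<^sup>2) \<xi> y \<le> \<epsilon> * N / 128}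
     \<le> measure_pmf.prob ?P {\<xi>. (\<Sum>i<D\<^sup>2. \<bar>rowsum {..<n} (\<lambda>k s. y k * mag L s) \<xi> i\<bar>) \<le> b * G / 4}"
    by (intro measure_pmf.finite_measure_mono) auto
  moreover have "\<epsilon> * D\<^sup>2 / (384 * 2 ^ N) \<le> G / 2"
  proof -
    have "\<epsilon> * D\<^sup>2 / (192 * 2 ^ N) * (1 / 2) \<le> \<epsilon> * D\<^sup>2 / (192 * 2 ^ N) * W"
      using W1 eps by (intro mult_left_mono) auto
    thus ?thesis unfolding G_eq by (simp add: mult_ac)
  qed
  hence "2 * exp (- G / 2) \<le> 2 * exp (- (\<epsilon> * D\<^sup>2 / (384 * 2 ^ N)))" by simp
  ultimately show ?thesis by linarith
qed

text \<open>The vectors of interest have l1 norm 1 and squared l2 norm at most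
  \<open>1 / D\<^sup>2\<close>; the slack in the constants absorbs the rounding to the grid.\<close>

definition spread_vector :: "nat \<Rightarrow> real \<Rightarrow> (nat \<Rightarrow> real) \<Rightarrow> bool" where
  "spread_vector n D y \<longleftrightarrow> (\<Sum>k<n. (y k)\<^sup>2) \<le> 4 / D\<^sup>2 \<and> 9 / 10 \<le> (\<Sum>k<n. \<bar>y k\<bar>) \<and> (\<Sum>k<n. \<bar>y k\<bar>) \<le> 2"

definition grid_point :: "nat \<Rightarrow> nat \<Rightarrow> (nat \<Rightarrow> nat \<Rightarrow> real) \<Rightarrow> (nat \<Rightarrow> int) \<Rightarrow> nat \<Rightarrow> real" where
  "grid_point m D v g k = (\<Sum>j<m. g j / (real D)\<^sup>2 * v j k)"

text \<open>Auerbach coefficients of a vector of l1 norm 1 lie in [-2, 2]. At mesh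
  \<open>1 / D\<^sup>2\<close> this leaves \<open>4 * D\<^sup>2 + 1\<close> values per
  coordinate.\<close>

definition grid :: "nat \<Rightarrow> nat \<Rightarrow> (nat \<Rightarrow> int) set" where
  "grid m D = PiE {..<m} (\<lambda>_. {- 2 * int (D\<^sup>2)..2 * int (D\<^sup>2)})"

lemma prob_net:
  fixes D N L n :: nat and \<epsilon> :: real
  assumes D: "D > 0" and eps: "0 \<le> \<epsilon>" "\<epsilon> \<le> 1" and N: "N \<ge> 40" and n: "n > 0"
    and L: "48 * n * N * 2 ^ N \<le> (2::real) ^ L * D\<^sup>2"
  shows "measure_pmf.prob (sketch_pmf (D\<^sup>2) (scale_pmf \<epsilon> L) {..<n})
     {\<xi>. \<exists>g\<in>grid m D. spread_vector n D (grid_point m D v g) \<and> heavy_norm L n (D\<^sup>2) \<xi> (grid_point m D v g) \<le> \<epsilon> * N / 128}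
     \<le> (4 * real D ^ 2 + 1) ^ m * (2 * exp (- (\<epsilon> * D\<^sup>2 / (384 * 2 ^ N))))"
proof -
  let ?P = "sketch_pmf (D\<^sup>2) (scale_pmf \<epsilon> L) {..<n}"
  define \<Gamma> where "\<Gamma> = {g \<in> grid m D. spread_vector n D (grid_point m D v g)}"
  have fing: "finite (grid m D)" unfolding grid_def by (intro finite_PiE) auto
  hence fin: "finite \<Gamma>" unfolding \<Gamma>_def by simp
  have "measure_pmf.prob ?P {\<xi>. \<exists>g\<in>grid m D. spread_vector n D (grid_point m D v g) \<and> heavy_norm L n (D\<^sup>2) \<xi> (grid_point m D v g) \<le> \<epsilon> * N / 128}
     = measure_pmf.prob ?P (\<Union>g\<in>\<Gamma>. {\<xi>. heavy_norm L n (D\<^sup>2) \<xi> (grid_point m D v g) \<le> \<epsilon> * N / 128})"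
    by (intro arg_cong[where f = "measure_pmf.prob ?P"]) (auto simp: \<Gamma>_def)
  also have "\<dots> \<le> (\<Sum>g\<in>\<Gamma>. measure_pmf.prob ?P {\<xi>. heavy_norm L n (D\<^sup>2) \<xi> (grid_point m D v g) \<le> \<epsilon> * N / 128})"
    by (intro measure_UNION_le fin) auto
  also have "\<dots> \<le> (\<Sum>g\<in>\<Gamma>. 2 * exp (- (\<epsilon> * D\<^sup>2 / (384 * 2 ^ N))))"
    by (intro sum_mono heavy_norm_spread_vector D eps N n L) (auto simp: \<Gamma>_def spread_vector_def)
  also have "\<dots> = card \<Gamma> * (2 * exp (- (\<epsilon> * D\<^sup>2 / (384 * 2 ^ N))))" by simp
  also have "\<dots> \<le> (4 * real D ^ 2 + 1) ^ m * (2 * exp (- (\<epsilon> * D\<^sup>2 / (384 * 2 ^ N))))"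
  proof (rule mult_right_mono)
    have "card \<Gamma> \<le> card (grid m D)" unfolding \<Gamma>_def by (intro card_mono fing) auto
    also have "card (grid m D) = nat (4 * int (D\<^sup>2) + 1) ^ m" unfolding grid_def by (simp add: card_PiE)
    finally have "real (card \<Gamma>) \<le> real (nat (4 * int (D\<^sup>2) + 1) ^ m)" by (simp only: of_nat_le_iff)
    also have "\<dots> = (4 * real D ^ 2 + 1) ^ m" by (simp add: nat_add_distrib nat_mult_distrib add.commute)
    finally show "real (card \<Gamma>) \<le> (4 * real D ^ 2 + 1) ^ m" .
  qed simp
  finally show ?thesis .
qed

text \<open>Rounding moves \<open>y\<close> by at most
  \<open>m / (2 * D\<^sup>2) \<le> 1 / (2 * D)\<close> in l1 and hence in l2. That is below the l2
  scale \<open>1 / D\<close> of \<open>y\<close>, so the grid point is still spread and the net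
  bound applies to it.\<close>

lemma heavy_norm_lower:
  fixes D :: nat
  assumes D: "D \<ge> 10" and m: "m \<le> D"
    and net: "\<And>g. g \<in> grid m D \<Longrightarrow> spread_vector n D (grid_point m D v g) \<Longrightarrow> heavy_norm L n r \<xi> (grid_point m D v g) > \<beta>"
    and U: "(\<Sum>j<m. heavy_norm L n r \<xi> (v j)) \<le> \<beta> / 2 * (real D)\<^sup>2"
    and v: "\<And>j. j < m \<Longrightarrow> (\<Sum>k<n. \<bar>v j k\<bar>) \<le> 1"
    and \<alpha>: "\<And>j. j < m \<Longrightarrow> \<bar>\<alpha> j\<bar> \<le> 2" and y: "\<And>k. k < n \<Longrightarrow> y k = (\<Sum>j<m. \<alpha> j * v j k)"
    and y1: "(\<Sum>k<n. \<bar>y k\<bar>) = 1" and y2: "(\<Sum>k<n. (y k)\<^sup>2) \<le> 1 / (real D)\<^sup>2"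
  shows "\<beta> / 2 \<le> heavy_norm L n r \<xi> y"
proof -
  have D0: "real D > 0" using D by simp
  define g where "g = restrict (\<lambda>j. round (\<alpha> j * (real D)\<^sup>2)) {..<m}"
  define \<delta> where "\<delta> j = \<alpha> j - g j / (real D)\<^sup>2" for j
  define u where "u = grid_point m D v g"
  define e where "e k = (\<Sum>j<m. \<delta> j * v j k)" for k
  have \<delta>: "\<bar>\<delta> j\<bar> \<le> 1 / (2 * (real D)\<^sup>2)" if "j < m" for j
  proof -
    have "\<delta> j * (real D)\<^sup>2 = \<alpha> j * (real D)\<^sup>2 - of_int (round (\<alpha> j * (real D)\<^sup>2))"
      using D0 that by (simp add: \<delta>_def g_def field_simps)
    hence "\<bar>\<delta> j\<bar> * (real D)\<^sup>2 \<le> 1 / 2"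
      using of_int_round_abs_le[of "\<alpha> j * (real D)\<^sup>2"]
      by (metis abs_minus_commute abs_mult abs_power2)
    thus ?thesis using D0 by (simp add: field_simps)
  qed
  have gg: "g \<in> grid m D" unfolding grid_def
  proof (rule PiE_I)
    fix j assume j: "j \<in> {..<m}"
    have "\<bar>\<alpha> j * (real D)\<^sup>2\<bar> \<le> 2 * (real D)\<^sup>2"
      using \<alpha>[of j] j by (simp add: abs_mult mult_right_mono)
    hence "- of_int (2 * int (D\<^sup>2)) \<le> \<alpha> j * (real D)\<^sup>2" "\<alpha> j * (real D)\<^sup>2 \<le> of_int (2 * int (D\<^sup>2))" by auto
    hence "round (of_int (- (2 * int (D\<^sup>2))) :: real) \<le> round (\<alpha> j * (real D)\<^sup>2)"
      "round (\<alpha> j * (real D)\<^sup>2) \<le> round (of_int (2 * int (D\<^sup>2)) :: real)"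
      by (intro round_mono; simp)+
    thus "g j \<in> {- 2 * int (D\<^sup>2)..2 * int (D\<^sup>2)}" using j unfolding round_of_int by (simp add: g_def)
  qed (simp add: g_def)
  have yue: "y k = u k + e k" if "k < n" for k
    unfolding y[OF that] u_def e_def grid_point_def sum.distrib[symmetric]
    by (intro sum.cong) (auto simp: \<delta>_def algebra_simps)
  have e1: "(\<Sum>k<n. \<bar>e k\<bar>) \<le> 1 / (2 * D)"
  proof -
    have "(\<Sum>k<n. \<bar>e k\<bar>) \<le> (\<Sum>k<n. \<Sum>j<m. \<bar>\<delta> j\<bar> * \<bar>v j k\<bar>)"
      unfolding e_def by (intro sum_mono order.trans[OF sum_abs]) (simp add: abs_mult)
    also have "\<dots> = (\<Sum>j<m. \<bar>\<delta> j\<bar> * (\<Sum>k<n. \<bar>v j k\<bar>))"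
      by (subst sum.swap) (simp add: sum_distrib_left)
    also have "\<dots> \<le> (\<Sum>j<m. 1 / (2 * (real D)\<^sup>2) * 1)"
      using \<delta> v by (intro sum_mono mult_mono) (auto intro: sum_nonneg)
    also have "\<dots> = m / (2 * (real D)\<^sup>2)" by simp
    also have "\<dots> \<le> D / (2 * (real D)\<^sup>2)" using m by (intro divide_right_mono) auto
    also have "\<dots> = 1 / (2 * D)" using D0 by (simp add: power2_eq_square)
    finally show ?thesis .
  qed
  have e2: "(\<Sum>k<n. (e k)\<^sup>2) \<le> 1 / (4 * (real D)\<^sup>2)"
  proof -
    have "(\<Sum>k<n. (e k)\<^sup>2) \<le> (\<Sum>k<n. \<bar>e k\<bar>)\<^sup>2" by (rule sum_squares_le_square_sum) simp
    also have "\<dots> \<le> (1 / (2 * D))\<^sup>2" using e1 by (intro power_mono) (auto intro: sum_nonneg)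
    finally show ?thesis by (simp add: power2_eq_square)
  qed
  have e3: "(\<Sum>k<n. \<bar>e k\<bar>) \<le> 1 / 20"
  proof -
    have "1 / (2 * real D) \<le> 1 / 20" using D by (simp add: divide_le_eq)
    thus ?thesis using e1 by linarith
  qed
  have "spread_vector n D u"
    unfolding spread_vector_def
  proof (intro conjI)
    have "(\<Sum>k<n. (u k)\<^sup>2) \<le> (\<Sum>k<n. 2 * (y k)\<^sup>2 + 2 * (e k)\<^sup>2)"
    proof (rule sum_mono)
      fix k assume "k \<in> {..<n}"
      hence u: "u k = y k - e k" using yue[of k] by simp
      have "0 \<le> (y k + e k)\<^sup>2" by simp
      thus "(u k)\<^sup>2 \<le> 2 * (y k)\<^sup>2 + 2 * (e k)\<^sup>2" unfolding u by (simp add: power2_eq_square algebra_simps)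
    qed
    also have "\<dots> = 2 * (\<Sum>k<n. (y k)\<^sup>2) + 2 * (\<Sum>k<n. (e k)\<^sup>2)" by (simp add: sum.distrib sum_distrib_left)
    also have "\<dots> \<le> 2 * (1 / (real D)\<^sup>2) + 2 * (1 / (4 * (real D)\<^sup>2))" using y2 e2 by linarith
    also have "\<dots> \<le> 4 / (real D)\<^sup>2" using D0 by (simp add: field_simps)
    finally show "(\<Sum>k<n. (u k)\<^sup>2) \<le> 4 / (real D)\<^sup>2" .
    have "(\<Sum>k<n. \<bar>y k\<bar>) \<le> (\<Sum>k<n. \<bar>u k\<bar> + \<bar>e k\<bar>)" using yue by (intro sum_mono) auto
    thus "9 / 10 \<le> (\<Sum>k<n. \<bar>u k\<bar>)" using y1 e3 by (simp add: sum.distrib)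
    have "(\<Sum>k<n. \<bar>u k\<bar>) \<le> (\<Sum>k<n. \<bar>y k\<bar> + \<bar>e k\<bar>)" using yue by (intro sum_mono) auto
    thus "(\<Sum>k<n. \<bar>u k\<bar>) \<le> 2" using y1 e3 by (simp add: sum.distrib)
  qed
  hence hu: "\<beta> < heavy_norm L n r \<xi> u" using net[OF gg] unfolding u_def by blast
  \<comment> \<open>The block can enlarge the rounding error, so its l1 size is not enough.
    Expanding in the basis, the mesh reduces the bound \<open>U\<close> by
    \<open>2 * (real D)\<^sup>2\<close>, leaving \<open>\<beta> / 4\<close>.\<close>
  have "heavy_norm L n r \<xi> e \<le> (\<Sum>j<m. \<bar>\<delta> j\<bar> * heavy_norm L n r \<xi> (v j))"
    unfolding e_def by (rule heavy_norm_combination_le)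
  also have "\<dots> \<le> (\<Sum>j<m. 1 / (2 * (real D)\<^sup>2) * heavy_norm L n r \<xi> (v j))"
    using \<delta> by (intro sum_mono mult_right_mono) (auto simp: heavy_norm_def intro: sum_nonneg)
  also have "\<dots> \<le> 1 / (2 * (real D)\<^sup>2) * (\<beta> / 2 * (real D)\<^sup>2)"
    unfolding sum_distrib_left[symmetric] by (intro mult_left_mono U) auto
  also have "\<dots> = \<beta> / 4" using D0 by simp
  finally have he: "heavy_norm L n r \<xi> e \<le> \<beta> / 4" .
  have "heavy_norm L n r \<xi> u = heavy_norm L n r \<xi> (\<lambda>k. y k + - e k)"
    by (rule heavy_norm_cong) (simp add: yue)
  also have "\<dots> \<le> heavy_norm L n r \<xi> y + heavy_norm L n r \<xi> e"
    using heavy_norm_triangle[of L n r \<xi> y "\<lambda>k. - e k"] unfolding heavy_norm_minus .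
  finally have "\<beta> - \<beta> / 4 \<le> heavy_norm L n r \<xi> y" using hu he by linarith
  moreover have "0 \<le> heavy_norm L n r \<xi> e" by (simp add: heavy_norm_def sum_nonneg)
  hence "\<beta> \<ge> 0" using he by linarith
  ultimately show ?thesis by linarith
qed

subsection \<open>The good event\<close>

text \<open>The distribution \<open>P\<close> is fixed without reference to \<open>A\<close>; only
  \<open>Good\<close> depends on it, through the two bases and the net. Three bad events of
  probability at most 1/1000, 2/1000 and 1/1000 are removed. Membership in the support supplies
  valid rows and signs.\<close>

lemma embedding_good_event:
  fixes D d n N L :: nat and \<epsilon> :: real and A :: "nat \<Rightarrow> nat \<Rightarrow> real"
  assumes eps: "0 < \<epsilon>" "\<epsilon> < 1" and d: "d \<ge> 2" and n: "n \<ge> 1" and D: "100 * d \<le> D"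
    and N: "N \<ge> 40" "4 ^ N \<le> D" "D < 4 ^ Suc N" and D_eps: "2304000 \<le> \<epsilon> * D"
    and tail: "(4 * real D ^ 2 + 1) ^ D * (2 * exp (- (\<epsilon> * D\<^sup>2 / (384 * 2 ^ N)))) \<le> 1 / 1000"
    and L: "48 * n * N * 2 ^ N \<le> (2::real) ^ L * D\<^sup>2"
  defines "P \<equiv> sketch_pmf (D\<^sup>2) (scale_pmf \<epsilon> L) {..<n}"
  obtains Good where "measure_pmf.prob P Good \<ge> 0.99"
    "\<And>\<xi> x. \<xi> \<in> Good \<Longrightarrow> \<xi> \<in> set_pmf P \<Longrightarrow>
       min (1 / 2) (\<epsilon> / 768) * ln d * l1norm n (mat_vec d A x)
         \<le> D * ln d * sign_norm n (D\<^sup>2) \<xi> (mat_vec d A x) + heavy_norm L n (D\<^sup>2) \<xi> (mat_vec d A x)"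
    "\<And>\<xi> x. \<xi> \<in> Good \<Longrightarrow> \<xi> \<in> set_pmf P \<Longrightarrow>
       sign_norm n (D\<^sup>2) \<xi> (mat_vec d A x) \<le> l1norm n (mat_vec d A x)"
    "\<And>\<xi> x. \<xi> \<in> Good \<Longrightarrow> \<xi> \<in> set_pmf P \<Longrightarrow>
       heavy_norm L n (D\<^sup>2) \<xi> (mat_vec d A x) \<le> 18000 * d * N * l1norm n (mat_vec d A x)"
proof -
  have D0: "D > 0" "real D > 0" using D d by auto
  have r: "D\<^sup>2 > 0" using D0 by simp
  have q: "finite (set_pmf (scale_pmf \<epsilon> L))" using eps by simp
  have dD: "d \<le> D" using D by simp
  have DD: "10000 * (real d * d) \<le> (real D)\<^sup>2"
  proof -
    have "real (100 * d) \<le> D" using D by (simp only: of_nat_le_iff)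
    hence "(100 * real d)\<^sup>2 \<le> (real D)\<^sup>2" by (intro power_mono) auto
    thus ?thesis by (simp add: power2_eq_square)
  qed
  obtain m b where m: "m \<le> d"
    and ort: "\<And>a c. a < m \<Longrightarrow> c < m \<Longrightarrow> (\<Sum>k<n. b a k * b c k) = (if a = c then 1 else (0::real))"
    and range: "\<And>x. \<exists>z. \<forall>k<n. mat_vec d A x k = (\<Sum>a<m. z a * b a k)"
    using orthonormal_range[of d n A] by blast
  obtain t where t1: "\<And>i. i < m \<Longrightarrow> (\<Sum>k<n. \<bar>\<Sum>a<m. t i a * b a k\<bar>) \<le> 1"
    and t2: "\<And>z. \<exists>\<alpha>. (\<forall>a<m. z a = (\<Sum>i<m. \<alpha> i * t i a)) \<and>
       (\<forall>i<m. \<bar>\<alpha> i\<bar> \<le> 2 * (\<Sum>k<n. \<bar>\<Sum>a<m. z a * b a k\<bar>))"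
    using auerbach_coefficients[OF ort] by blast
  define v where "v i k = (\<Sum>a<m. t i a * b a k)" for i k
  have v: "(\<Sum>k<n. \<bar>v i k\<bar>) \<le> 1" if "i < m" for i using t1[OF that] by (simp add: v_def)
  define U where "U \<xi> = (\<Sum>j<m. heavy_norm L n (D\<^sup>2) \<xi> (v j))" for \<xi>
  \<comment> \<open>Sized so that Markov's inequality fails with probability at most 1/1000, given
    that \<open>1 + 8 * Suc N\<close> is at most \<open>9 * N\<close>.\<close>
  define u where "u = 9000 * real d * N"
  define \<beta> where "\<beta> = \<epsilon> * N / 128"
  define B1 where "B1 = {\<xi>. gram_error n (D\<^sup>2) m b \<xi> \<ge> 1 / 4}"
  define B2 where "B2 = {\<xi>. U \<xi> \<ge> u}"
  define B3 where "B3 = {\<xi>. \<exists>g\<in>grid m D. spread_vector n D (grid_point m D v g) \<and>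
      heavy_norm L n (D\<^sup>2) \<xi> (grid_point m D v g) \<le> \<beta>}"
  have p1: "measure_pmf.prob P B1 \<le> 1 / 1000"
  proof -
    have "measure_pmf.prob P B1 \<le> 8 * (real m)\<^sup>2 / real (D\<^sup>2)"
      unfolding B1_def P_def
      by (rule prob_gram_error[OF r q]) (use ort in \<open>simp add: power2_eq_square\<close>)
    also have "\<dots> \<le> 1 / 1000"
    proof -
      have "(real m)\<^sup>2 \<le> (real d)\<^sup>2" using m by (intro power_mono) auto
      moreover have "0 \<le> real d * d" by simp
      ultimately have "8000 * (real m)\<^sup>2 \<le> (real D)\<^sup>2" using DD unfolding power2_eq_square by linarith
      thus ?thesis using D0 by (simp add: divide_le_eq)
    qed
    finally show ?thesis .
  qed
  have p2: "measure_pmf.prob P B2 \<le> 2 / 1000"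
  proof -
    \<comment> \<open>Here \<open>T\<close> is \<open>1000 * d\<close>, and \<open>J\<close> is
      \<open>8 * Suc N\<close> because \<open>T * D\<^sup>2 \<le> D ^ 4\<close> and \<open>D\<close>
      is below \<open>4 ^ Suc N\<close>.\<close>
    have "measure_pmf.prob P B2 \<le> m / (1000 * real d) + real m * (1 + real (8 * Suc N)) / u"
      unfolding B2_def P_def U_def heavy_norm_def
    proof (rule heavy_part_upper)
      have "1000 * real d * real (D\<^sup>2) \<le> (real D)\<^sup>2 * (real D)\<^sup>2"
      proof -
        have "1000 * real d \<le> 10000 * (real d * d)" using d by simp
        hence "1000 * real d \<le> (real D)\<^sup>2" using DD by linarith
        thus ?thesis unfolding of_nat_power by (rule mult_right_mono) simp
      qed
      also have "\<dots> = real (D ^ 4)" by (simp add: power2_eq_square power4_eq_xxxx)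
      also have "\<dots> \<le> real ((4 ^ Suc N) ^ 4)"
        unfolding of_nat_le_iff using N by (intro power_mono) auto
      also have "\<dots> = 2 ^ (8 * Suc N)"
      proof -
        have "(4::real) = 2 ^ 2" by simp
        thus ?thesis by (simp only: of_nat_power of_nat_numeral power_mult[symmetric]) (simp add: mult_ac)
      qed
      finally show "1000 * real d * real (D\<^sup>2) \<le> 2 ^ (8 * Suc N)" .
    qed (use r d eps v N in \<open>simp_all add: u_def\<close>)
    also have "\<dots> \<le> 1 / 1000 + 1 / 1000"
    proof (rule add_mono)
      show "m / (1000 * real d) \<le> 1 / 1000" using m d by (simp add: divide_le_eq)
      have "real (m * (1 + (8 * Suc N))) \<le> real (d * (9 * N))"
        unfolding of_nat_le_iff using m N by (intro mult_mono) auto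
      hence "real m * (1 + real (8 * Suc N)) \<le> d * (9 * N)" by simp
      hence "real m * (1 + real (8 * Suc N)) / u \<le> real d * (9 * N) / u"
        by (intro divide_right_mono) (auto simp: u_def)
      also have "\<dots> = 1 / 1000" using d N by (simp add: u_def)
      finally show "real m * (1 + real (8 * Suc N)) / u \<le> 1 / 1000" .
    qed
    finally show ?thesis by simp
  qed
  have p3: "measure_pmf.prob P B3 \<le> 1 / 1000"
  proof -
    have "measure_pmf.prob P B3 \<le> (4 * real D ^ 2 + 1) ^ m * (2 * exp (- (\<epsilon> * D\<^sup>2 / (384 * 2 ^ N))))"
      unfolding B3_def P_def \<beta>_def using D0 eps N n L by (intro prob_net) auto
    also have "\<dots> \<le> (4 * real D ^ 2 + 1) ^ D * (2 * exp (- (\<epsilon> * D\<^sup>2 / (384 * 2 ^ N))))"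
      using m dD by (intro mult_right_mono power_increasing) auto
    finally show ?thesis using tail by simp
  qed
  have Good: "measure_pmf.prob P (- (B1 \<union> B2 \<union> B3)) \<ge> 0.99"
  proof -
    have "measure_pmf.prob P (B1 \<union> B2 \<union> B3) \<le> measure_pmf.prob P (B1 \<union> B2) + measure_pmf.prob P B3"
      by (rule measure_Un_le) auto
    moreover have "measure_pmf.prob P (B1 \<union> B2) \<le> measure_pmf.prob P B1 + measure_pmf.prob P B2"
      by (rule measure_Un_le) auto
    moreover have "measure_pmf.prob P (- (B1 \<union> B2 \<union> B3)) = 1 - measure_pmf.prob P (B1 \<union> B2 \<union> B3)"
      using measure_pmf.prob_compl[of "B1 \<union> B2 \<union> B3" P] by (simp add: Compl_eq_Diff_UNIV)
    ultimately show ?thesis using p1 p2 p3 by simp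
  qed
  have coords: "\<exists>\<alpha>. (\<forall>k<n. mat_vec d A x k = (\<Sum>j<m. \<alpha> j * v j k)) \<and>
       (\<forall>j<m. \<bar>\<alpha> j\<bar> \<le> 2 * l1norm n (mat_vec d A x))" for x
  proof -
    obtain z where z: "\<And>k. k < n \<Longrightarrow> mat_vec d A x k = (\<Sum>a<m. z a * b a k)" using range by blast
    obtain \<alpha> where \<alpha>: "\<And>a. a < m \<Longrightarrow> z a = (\<Sum>i<m. \<alpha> i * t i a)"
      "\<And>i. i < m \<Longrightarrow> \<bar>\<alpha> i\<bar> \<le> 2 * (\<Sum>k<n. \<bar>\<Sum>a<m. z a * b a k\<bar>)" using t2[of z] by blast
    have "mat_vec d A x k = (\<Sum>j<m. \<alpha> j * v j k)" if "k < n" for k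
    proof -
      have "mat_vec d A x k = (\<Sum>a<m. \<Sum>j<m. \<alpha> j * (t j a * b a k))"
        unfolding z[OF that] by (intro sum.cong refl) (simp add: \<alpha>(1) sum_distrib_right mult.assoc)
      also have "\<dots> = (\<Sum>j<m. \<alpha> j * v j k)"
        by (subst sum.swap) (simp add: v_def sum_distrib_left)
      finally show ?thesis .
    qed
    moreover have "(\<Sum>k<n. \<bar>\<Sum>a<m. z a * b a k\<bar>) = l1norm n (mat_vec d A x)"
      unfolding l1norm_def by (intro sum.cong) (auto simp: z)
    ultimately show ?thesis using \<alpha>(2) by (intro exI[of _ \<alpha>]) auto
  qed
  \<comment> \<open>The constant 2304000 is 9000 * 256. This inequality makes mesh
    \<open>1 / D\<^sup>2\<close> fine enough for the rounding step.\<close>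
  have u_le: "u \<le> \<beta> / 2 * (real D)\<^sup>2"
  proof -
    have "2304000 * real d \<le> \<epsilon> * D * D" using D_eps dD by (intro mult_mono) auto
    hence "2304000 * real d * N \<le> \<epsilon> * D * D * N" by (intro mult_right_mono) auto
    thus ?thesis by (simp add: u_def \<beta>_def power2_eq_square mult_ac)
  qed
  have lnd: "0 < ln (real d)" "ln (real d) \<le> 3 * N"
  proof -
    show "0 < ln (real d)" using d by simp
    have "real d \<le> real (4 ^ Suc N)" unfolding of_nat_le_iff using dD N by linarith
    hence "ln (real d) \<le> ln (real (4 ^ Suc N))" using d by simp
    also have "\<dots> = Suc N * ln 4" using ln_realpow[of 4 "Suc N"] by simp
    also have "ln (4::real) = 2 * ln 2" using ln_realpow[of 2 2] by simp
    also have "Suc N * (2 * ln 2) \<le> Suc N * (2 * (1::real))"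
      using ln_2_less_1 by (intro mult_left_mono) auto
    also have "\<dots> \<le> 3 * N" using N by simp
    finally show "ln (real d) \<le> 3 * N" .
  qed
  show ?thesis
  proof (rule that[of "- (B1 \<union> B2 \<union> B3)"])
    show "measure_pmf.prob P (- (B1 \<union> B2 \<union> B3)) \<ge> 0.99" by (rule Good)
  next
    fix \<xi> x assume \<xi>: "\<xi> \<in> - (B1 \<union> B2 \<union> B3)" "\<xi> \<in> set_pmf P"
    define y where "y = mat_vec d A x"
    define Y where "Y = l1norm n y"
    have Y0: "Y \<ge> 0" by (simp add: Y_def l1norm_def sum_nonneg)
    obtain \<alpha> where \<alpha>: "\<And>k. k < n \<Longrightarrow> y k = (\<Sum>j<m. \<alpha> j * v j k)" "\<And>j. j < m \<Longrightarrow> \<bar>\<alpha> j\<bar> \<le> 2 * Y"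
      using coords[of x] by (auto simp: y_def Y_def)
    obtain z where z: "\<And>k. k < n \<Longrightarrow> y k = (\<Sum>a<m. z a * b a k)" using range[of x] by (auto simp: y_def)
    have U: "U \<xi> \<le> u" using \<xi> by (simp add: B2_def)
    have hn: "heavy_norm L n (D\<^sup>2) \<xi> w \<ge> 0" "sign_norm n (D\<^sup>2) \<xi> w \<ge> 0" for w
      by (simp_all add: heavy_norm_def sign_norm_def sum_nonneg)
    have col: "fst (\<xi> k) < D\<^sup>2 \<and> \<bar>fst (snd (\<xi> k))\<bar> = 1" if "k < n" for k
    proof -
      have "\<xi> \<in> PiE_dflt {..<n} (0, 0, 0) (\<lambda>_. {..<D\<^sup>2} \<times> {- 1, 1} \<times> set_pmf (scale_pmf \<epsilon> L))"
        using \<xi>(2) set_sketch_pmf[OF r q, of "{..<n}"] by (simp add: P_def)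
      hence "\<xi> k \<in> {..<D\<^sup>2} \<times> {- 1, 1} \<times> set_pmf (scale_pmf \<epsilon> L)" using that unfolding PiE_dflt_def by blast
      thus ?thesis by auto
    qed
    show "sign_norm n (D\<^sup>2) \<xi> (mat_vec d A x) \<le> l1norm n (mat_vec d A x)"
      unfolding l1norm_def by (rule sign_norm_le_l1) (rule col)
    have "heavy_norm L n (D\<^sup>2) \<xi> y = heavy_norm L n (D\<^sup>2) \<xi> (\<lambda>k. \<Sum>j<m. \<alpha> j * v j k)"
      by (rule heavy_norm_cong) (rule \<alpha>)
    also have "\<dots> \<le> (\<Sum>j<m. \<bar>\<alpha> j\<bar> * heavy_norm L n (D\<^sup>2) \<xi> (v j))"
      by (rule heavy_norm_combination_le)
    also have "\<dots> \<le> (\<Sum>j<m. 2 * Y * heavy_norm L n (D\<^sup>2) \<xi> (v j))"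
      using \<alpha> hn by (intro sum_mono mult_right_mono) auto
    also have "\<dots> = 2 * Y * U \<xi>" by (simp add: U_def sum_distrib_left)
    also have "\<dots> \<le> 2 * Y * u" using Y0 U by (intro mult_left_mono) auto
    finally show "heavy_norm L n (D\<^sup>2) \<xi> (mat_vec d A x) \<le> 18000 * d * N * l1norm n (mat_vec d A x)"
      by (simp add: u_def y_def Y_def mult_ac)
    show "min (1 / 2) (\<epsilon> / 768) * ln d * l1norm n (mat_vec d A x)
         \<le> D * ln d * sign_norm n (D\<^sup>2) \<xi> (mat_vec d A x) + heavy_norm L n (D\<^sup>2) \<xi> (mat_vec d A x)"
      unfolding y_def[symmetric] Y_def[symmetric]
    proof (cases "Y = 0")
      case True
      have "0 \<le> D * ln d * sign_norm n (D\<^sup>2) \<xi> y + heavy_norm L n (D\<^sup>2) \<xi> y"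
        using hn lnd by (intro add_nonneg_nonneg mult_nonneg_nonneg) auto
      thus "min (1 / 2) (\<epsilon> / 768) * ln d * Y
         \<le> D * ln d * sign_norm n (D\<^sup>2) \<xi> y + heavy_norm L n (D\<^sup>2) \<xi> y" using True by simp
    next
      case False
      with Y0 have Y: "Y > 0" by simp
      show "min (1 / 2) (\<epsilon> / 768) * ln d * Y
         \<le> D * ln d * sign_norm n (D\<^sup>2) \<xi> y + heavy_norm L n (D\<^sup>2) \<xi> y"
      \<comment> \<open>For a concentrated \<open>y\<close> the l2 embedding yields
        \<open>Y / (2 * D)\<close>, which the weight \<open>D * ln d\<close> lifts to
        \<open>ln d * Y / 2\<close>. Otherwise \<open>y / Y\<close> is a candidate for the net
        argument.\<close>
      proof (cases "(\<Sum>k<n. (y k)\<^sup>2) \<ge> (Y / D)\<^sup>2")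
        case True
        have "gram_error n (D\<^sup>2) m b \<xi> < 1 / 4" using \<xi>(1) by (simp add: B1_def)
        hence "(\<Sum>k<n. (y k)\<^sup>2) / 2 \<le> (sign_norm n (D\<^sup>2) \<xi> y)\<^sup>2"
          by (intro sign_norm_lower[where b = b and z = z and m = m] ort z)
        moreover have "(Y / (2 * D))\<^sup>2 = (Y / D)\<^sup>2 / 4"
          by (simp add: power_divide power_mult_distrib)
        moreover have "0 \<le> (Y / D)\<^sup>2" by simp
        ultimately have "(Y / (2 * D))\<^sup>2 \<le> (sign_norm n (D\<^sup>2) \<xi> y)\<^sup>2" using True by linarith
        hence "Y / (2 * D) \<le> sign_norm n (D\<^sup>2) \<xi> y" using hn(2) by (rule power2_le_imp_le)
        hence "D * ln d * (Y / (2 * D)) \<le> D * ln d * sign_norm n (D\<^sup>2) \<xi> y"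
          using lnd by (intro mult_left_mono) auto
        moreover have "D * ln d * (Y / (2 * D)) = 1 / 2 * (ln d * Y)" using D0 by simp
        moreover have "min (1 / 2) (\<epsilon> / 768) * (ln d * Y) \<le> 1 / 2 * (ln d * Y)"
          using lnd Y by (intro mult_right_mono) auto
        ultimately show ?thesis using hn(1)[of y] unfolding mult.assoc by linarith
      next
        case False
        have "\<beta> / 2 \<le> heavy_norm L n (D\<^sup>2) \<xi> (\<lambda>k. 1 / Y * y k)"
        proof (rule heavy_norm_lower[where v = v and m = m and \<alpha> = "\<lambda>j. 1 / Y * \<alpha> j" and D = D])
          show "10 \<le> D" using D d by linarith
          show "m \<le> D" using m dD by simp
          show "heavy_norm L n (D\<^sup>2) \<xi> (grid_point m D v g) > \<beta>"
            if "g \<in> grid m D" "spread_vector n D (grid_point m D v g)" for g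
            using \<xi>(1) that by (auto simp: B3_def not_le)
          show "(\<Sum>j<m. heavy_norm L n (D\<^sup>2) \<xi> (v j)) \<le> \<beta> / 2 * (real D)\<^sup>2"
            using U u_le by (simp add: U_def)
          show "(\<Sum>k<n. \<bar>v j k\<bar>) \<le> 1" if "j < m" for j by (rule v[OF that])
          show "\<bar>1 / Y * \<alpha> j\<bar> \<le> 2" if "j < m" for j
            using \<alpha>(2)[OF that] Y by (simp add: abs_mult divide_le_eq)
          show "1 / Y * y k = (\<Sum>j<m. 1 / Y * \<alpha> j * v j k)" if "k < n" for k
            unfolding \<alpha>(1)[OF that] by (simp add: sum_distrib_left mult.assoc sum_divide_distrib)
          show "(\<Sum>k<n. \<bar>1 / Y * y k\<bar>) = 1"
            using Y by (simp add: abs_mult sum_divide_distrib[symmetric] Y_def l1norm_def)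
          have "(\<Sum>k<n. (1 / Y * y k)\<^sup>2) = (\<Sum>k<n. (y k)\<^sup>2) / Y\<^sup>2"
            by (simp add: power_divide sum_divide_distrib)
          also have "\<dots> \<le> (Y / D)\<^sup>2 / Y\<^sup>2" using False by (intro divide_right_mono) auto
          also have "\<dots> = 1 / (real D)\<^sup>2" using Y by (simp add: power_divide)
          finally show "(\<Sum>k<n. (1 / Y * y k)\<^sup>2) \<le> 1 / (real D)\<^sup>2" .
        qed
        hence "\<beta> / 2 * Y \<le> heavy_norm L n (D\<^sup>2) \<xi> y"
          unfolding heavy_norm_scale using Y by (simp add: field_simps)
        moreover have "min (1 / 2) (\<epsilon> / 768) * ln d * Y \<le> \<beta> / 2 * Y"
        proof (rule mult_right_mono)
          \<comment> \<open>The constant 768 is 3 * 256: \<open>\<beta> / 2\<close> equals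
            \<open>\<epsilon> * N / 256\<close>, and \<open>ln d\<close> is at most
            \<open>3 * N\<close>.\<close>
          have "min (1 / 2) (\<epsilon> / 768) * ln d \<le> \<epsilon> / 768 * (3 * N)"
            using lnd eps by (intro mult_mono) auto
          thus "min (1 / 2) (\<epsilon> / 768) * ln d \<le> \<beta> / 2" by (simp add: \<beta>_def)
        qed (rule Y0)
        moreover have "0 \<le> D * ln d * sign_norm n (D\<^sup>2) \<xi> y" using hn lnd by simp
        ultimately show ?thesis by linarith
      qed
    qed
  qed
qed

subsection \<open>The matrix distribution\<close>

definition sketch_matrix :: "nat \<Rightarrow> nat \<Rightarrow> nat \<Rightarrow> real \<Rightarrow> (nat \<Rightarrow> nat \<times> real \<times> nat) \<Rightarrow> nat \<Rightarrow> nat \<Rightarrow> real" where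
  "sketch_matrix n r L W \<xi> i j =
     (if j < n then if i < r then entry (\<lambda>_. W) (\<xi> j) i else entry (mag L) (\<xi> j) (i - r) else 0)"

lemma l1norm_sketch_matrix:
  assumes "W \<ge> 0"
  shows "l1norm (r + r) (mat_vec n (sketch_matrix n r L W \<xi>) y) = W * sign_norm n r \<xi> y + heavy_norm L n r \<xi> y"
proof -
  have split: "(\<Sum>i<r + s. f i) = (\<Sum>i<r. f i) + (\<Sum>i<s. f (r + i))" for f :: "nat \<Rightarrow> real" and s
    by (induction s) (auto simp: add_ac)
  have 1: "mat_vec n (sketch_matrix n r L W \<xi>) y i = W * rowsum {..<n} (\<lambda>k _. y k) \<xi> i" if "i < r" for i
    unfolding mat_vec_def rowsum_def sum_distrib_left using that
    by (intro sum.cong) (auto simp: sketch_matrix_def entry_def)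
  have 2: "mat_vec n (sketch_matrix n r L W \<xi>) y (r + i) = rowsum {..<n} (\<lambda>k s. y k * mag L s) \<xi> i" for i
    unfolding mat_vec_def rowsum_def
    by (intro sum.cong) (auto simp: sketch_matrix_def entry_def)
  show ?thesis
    unfolding l1norm_def split using assms
    by (simp add: 1 2 sign_norm_def heavy_norm_def abs_mult sum_distrib_left)
qed

lemma col_nnz_sketch_matrix:
  "col_nnz (r + r) (sketch_matrix n r L W \<xi>) j \<le> 1 + (if snd (snd (\<xi> j)) < L then 1 else 0)"
proof -
  let ?S = "{i. i < r + r \<and> sketch_matrix n r L W \<xi> i j \<noteq> 0}"
  have "?S \<subseteq> {fst (\<xi> j)} \<union> (if snd (snd (\<xi> j)) < L then {r + fst (\<xi> j)} else {})"
    by (auto simp: sketch_matrix_def entry_def mag_def split: if_splits)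
  hence "card ?S \<le> card ({fst (\<xi> j)} \<union> (if snd (snd (\<xi> j)) < L then {r + fst (\<xi> j)} else {}))"
    by (rule card_mono[rotated]) simp
  also have "\<dots> \<le> 1 + (if snd (snd (\<xi> j)) < L then 1 else 0)"
    by (rule order.trans[OF card_Un_le]) simp
  finally show ?thesis by (simp add: col_nnz_def)
qed

section \<open>Measurability in the space of matrices\<close>

lemma space_mat_space [simp]: "space mat_space = UNIV"
  by (simp add: mat_space_def space_PiM)

text \<open>Singletons are countable products of singletons. This is needed because the success
  event is given as a finite set of matrices.\<close>

lemma finite_in_sets_mat_space:
  assumes "finite F"
  shows "F \<in> sets mat_space"
proof -
  have row: "{f} \<in> sets (PiM UNIV (\<lambda>_::nat. borel :: real measure))" for f
  proof -
    have "{f} = PiE UNIV (\<lambda>j. {f j})" by (auto simp: PiE_UNIV_domain)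
    thus ?thesis by (simp add: sets_PiM_I_countable)
  qed
  have "{P} \<in> sets mat_space" for P
  proof -
    have "{P} = PiE UNIV (\<lambda>i. {P i})" by (auto simp: PiE_UNIV_domain)
    thus ?thesis unfolding mat_space_def using row by (simp add: sets_PiM_I_countable)
  qed
  hence "(\<Union>P\<in>F. {P}) \<in> sets mat_space" using assms by (intro sets.finite_UN) auto
  thus ?thesis by simp
qed

lemma measurable_mat_entry: "(\<lambda>P. P i j) \<in> borel_measurable mat_space"
proof -
  have "(\<lambda>P. P i) \<in> measurable mat_space (PiM UNIV (\<lambda>_. borel))"
    unfolding mat_space_def by (rule measurable_component_singleton) simp
  moreover have "(\<lambda>f. f j) \<in> borel_measurable (PiM UNIV (\<lambda>_. borel))"
    by (rule measurable_component_singleton) simp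
  ultimately show ?thesis by (rule measurable_compose)
qed

lemma measurable_col_nnz: "(\<lambda>P. real (col_nnz r P j)) \<in> borel_measurable mat_space"
proof -
  have eq: "real (col_nnz r P j) = (\<Sum>i<r. if P i j = 0 then 0 else 1)" for P
  proof -
    have "(\<Sum>i<r. if P i j = 0 then 0 else 1) = (\<Sum>i\<in>{i. i < r \<and> P i j \<noteq> 0}. 1::real)"
      by (rule sum.mono_neutral_cong_right) auto
    thus ?thesis by (simp add: col_nnz_def)
  qed
  note measurable_mat_entry [measurable]
  show ?thesis unfolding eq by measurable
qed

lemma expected_col_nnz:
  assumes eps: "0 \<le> \<epsilon>" "\<epsilon> \<le> 1" and r: "r > 0" and j: "j < n"
  shows "(\<integral>\<^sup>+ \<xi>. ennreal (real (col_nnz (r + r) (sketch_matrix n r L W \<xi>) j)) \<partial>sketch_pmf r (scale_pmf \<epsilon> L) {..<n})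
    \<le> ennreal (1 + \<epsilon>)"
proof -
  let ?q = "scale_pmf \<epsilon> L"
  let ?P = "sketch_pmf r ?q {..<n}"
  define f where "f c = 1 + (if snd (snd c) < L then 1 else (0::real))" for c :: "nat \<times> real \<times> nat"
  have q: "finite (set_pmf ?q)" using eps by simp
  have fin: "finite (set_pmf ?P)" using r q by simp
  have "(\<integral>\<^sup>+ \<xi>. ennreal (real (col_nnz (r + r) (sketch_matrix n r L W \<xi>) j)) \<partial>?P) \<le> (\<integral>\<^sup>+ \<xi>. ennreal (f (\<xi> j)) \<partial>?P)"
  proof (intro nn_integral_mono ennreal_leI)
    fix \<xi>
    have "real (col_nnz (r + r) (sketch_matrix n r L W \<xi>) j) \<le> real (1 + (if snd (snd (\<xi> j)) < L then 1 else 0))"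
      unfolding of_nat_le_iff by (rule col_nnz_sketch_matrix)
    thus "real (col_nnz (r + r) (sketch_matrix n r L W \<xi>) j) \<le> f (\<xi> j)" by (simp add: f_def split: if_splits)
  qed
  also have "\<dots> = ennreal (E ?P (\<lambda>\<xi>. f (\<xi> j)))"
    by (rule nn_integral_eq_integral[OF integrable_measure_pmf_finite[OF fin]]) (simp add: f_def)
  also have "E ?P (\<lambda>\<xi>. f (\<xi> j)) = E (col_pmf r ?q) f"
    using j by (intro expectation_sketch_component[OF r q]) auto
  also have "\<dots> = E ?q (\<lambda>s. 1 + (if s < L then 1 else 0))"
    using r by (simp add: expectation_col[OF r q] f_def)
  also have "\<dots> = 1 + \<epsilon> * (1 - 1 / 2 ^ L)"
    using expectation_scale_mag[OF eps, of "\<lambda>s. if s < L then 1 else 0" L] sum_half_powers[of L]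
    by (simp add: expectation_add_finite[OF q])
  also have "ennreal \<dots> \<le> ennreal (1 + \<epsilon>)"
    using eps mult_left_mono[of "1 - 1 / 2 ^ L" 1 \<epsilon>] by (intro ennreal_leI) simp
  finally show ?thesis .
qed

text \<open>From \<open>4 ^ N \<le> D\<close> follows \<open>2 ^ N \<le> sqrt D\<close>, so the
  failure exponent is at least \<open>\<epsilon> / 384 * D powr (3 / 2)\<close> and eventually
  dominates the logarithm \<open>D * ln (4 * D\<^sup>2 + 1)\<close> of the net size. The bound
  \<open>4 ^ 40 \<le> D\<close> later yields \<open>N \<ge> 40\<close>.\<close>

lemma large_dimension_condition:
  fixes \<epsilon> :: real
  assumes "\<epsilon> > 0"
  shows "\<exists>K::nat. K \<ge> 100 \<and> (\<forall>D::nat. K \<le> D \<longrightarrow> 4 ^ 40 \<le> D \<and> 2304000 \<le> \<epsilon> * D \<and>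
    (\<forall>N. 4 ^ N \<le> D \<longrightarrow> (4 * real D ^ 2 + 1) ^ D * (2 * exp (- (\<epsilon> * D\<^sup>2 / (384 * 2 ^ N)))) \<le> 1 / 1000))"
proof -
  \<comment> \<open>The 11 is chosen for
    \<open>2 * exp (- 11) \<le> 2 / 2 ^ 11 \<le> 1 / 1000\<close>.\<close>
  have "eventually (\<lambda>x::real. x * ln (4 * x\<^sup>2 + 1) + 11 \<le> \<epsilon> / 384 * x powr (3 / 2)) at_top"
    using assms by real_asymp
  moreover have "eventually (\<lambda>x::real. 2304000 \<le> \<epsilon> * x) at_top" using assms by real_asymp
  ultimately have "eventually (\<lambda>x::real. x * ln (4 * x\<^sup>2 + 1) + 11 \<le> \<epsilon> / 384 * x powr (3 / 2) \<and> 2304000 \<le> \<epsilon> * x) at_top"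
    by (rule eventually_conj)
  then obtain x0 where x0: "\<And>x. x \<ge> x0 \<Longrightarrow> x * ln (4 * x\<^sup>2 + 1) + 11 \<le> \<epsilon> / 384 * x powr (3 / 2)"
    "\<And>x. x \<ge> x0 \<Longrightarrow> 2304000 \<le> \<epsilon> * x"
    unfolding eventually_at_top_linorder by blast
  define K where "K = max (4 ^ 40) (nat \<lceil>x0\<rceil>)"
  have "(100::nat) \<le> 4 ^ 40" by simp
  hence K: "K \<ge> 100" unfolding K_def by linarith
  show ?thesis
  proof (intro exI[of _ K] conjI allI impI K)
    fix D assume D: "K \<le> D"
    show "4 ^ 40 \<le> D" using D unfolding K_def by linarith
    have "real D \<ge> x0" using D unfolding K_def by linarith
    note * = x0[OF this]
    show "2304000 \<le> \<epsilon> * D" by (rule *)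
    fix N :: nat assume N: "4 ^ N \<le> D"
    have D0: "real D > 0" using D K by simp
    have "(2 ^ N)\<^sup>2 \<le> real D"
    proof -
      have "((2::real) ^ N)\<^sup>2 = real (4 ^ N)" by (simp add: power_mult_distrib[symmetric] power2_eq_square)
      also have "\<dots> \<le> D" using N by (simp only: of_nat_le_iff)
      finally show ?thesis .
    qed
    hence "2 ^ N \<le> sqrt D" by (simp add: real_le_rsqrt)
    hence N2: "2 ^ N \<le> D powr (1 / 2)" by (simp add: powr_half_sqrt)
    have "D powr (3 / 2) * 2 ^ N \<le> D powr (3 / 2) * D powr (1 / 2)"
      using N2 by (intro mult_left_mono) auto
    also have "\<dots> = (real D)\<^sup>2" using D0 by (simp add: powr_add[symmetric])
    finally have "D powr (3 / 2) \<le> (real D)\<^sup>2 / 2 ^ N" by (simp add: le_divide_eq)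
    hence "\<epsilon> / 384 * D powr (3 / 2) \<le> \<epsilon> / 384 * ((real D)\<^sup>2 / 2 ^ N)"
      using assms by (intro mult_left_mono) auto
    hence "\<epsilon> / 384 * D powr (3 / 2) \<le> \<epsilon> * (real D)\<^sup>2 / (384 * 2 ^ N)" by simp
    hence main: "D * ln (4 * (real D)\<^sup>2 + 1) + 11 \<le> \<epsilon> * (real D)\<^sup>2 / (384 * 2 ^ N)" using *(1) by linarith
    have pos: "4 * (real D)\<^sup>2 + 1 > 0" by (simp add: add_nonneg_pos)
    have "(4 * (real D)\<^sup>2 + 1) ^ D = exp (D * ln (4 * (real D)\<^sup>2 + 1))"
      using pos by (simp add: exp_of_nat_mult)
    moreover have gen: "exp a * (2 * exp (- b)) = 2 * exp (a - b)" for a b :: real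
      by (simp add: exp_diff exp_minus divide_inverse)
    ultimately have "(4 * (real D)\<^sup>2 + 1) ^ D * (2 * exp (- (\<epsilon> * (real D)\<^sup>2 / (384 * 2 ^ N))))
        = 2 * exp (D * ln (4 * (real D)\<^sup>2 + 1) - \<epsilon> * (real D)\<^sup>2 / (384 * 2 ^ N))"
      using gen by simp
    also have "\<dots> \<le> 2 * exp (- 11)" using main by simp
    also have "\<dots> \<le> 1 / 1000"
    proof -
      have "(2::real) \<le> exp 1" using exp_ge_add_one_self[of 1] by simp
      hence "(2::real) ^ 11 \<le> exp 1 ^ 11" by (intro power_mono) auto
      also have "exp 1 ^ 11 = exp (11::real)" by (simp add: exp_of_nat_mult[symmetric])
      finally show ?thesis by (simp add: exp_minus field_simps)
    qed
    finally show "(4 * real D ^ 2 + 1) ^ D * (2 * exp (- (\<epsilon> * D\<^sup>2 / (384 * 2 ^ N)))) \<le> 1 / 1000" by simp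
  qed
qed

theorem theorem7:
  fixes \<epsilon> :: real
  assumes "0 < \<epsilon>" "\<epsilon> < 1"
  shows "\<exists>c C :: real. c > 0 \<and> C > 0 \<and>
    (\<forall>d n :: nat. d \<ge> 2 \<longrightarrow> n \<ge> 1 \<longrightarrow>
      (\<exists>(r::nat) (M :: (nat \<Rightarrow> nat \<Rightarrow> real) measure).
         real r \<le> C * real d ^ 2 \<and>
         prob_space M \<and> sets M = sets mat_space \<and>
         (AE P in M. \<forall>j<n. col_nnz r P j \<le> 2) \<and>
         (\<forall>j<n. (\<integral>\<^sup>+ P. ennreal (real (col_nnz r P j)) \<partial>M) \<le> ennreal (1 + \<epsilon>)) \<and>
         (\<forall>A :: nat \<Rightarrow> nat \<Rightarrow> real.
            \<exists>E \<in> sets M. measure M E \<ge> 0.99 \<and>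
              (\<forall>P \<in> E. \<forall>x :: nat \<Rightarrow> real.
                 c * ln (real d) * l1norm n (mat_vec d A x)
                   \<le> l1norm r (mat_vec n P (mat_vec d A x)) \<and>
                 l1norm r (mat_vec n P (mat_vec d A x))
                   \<le> C * real d * ln (real d) * l1norm n (mat_vec d A x)))))"
proof -
  obtain K :: nat where K: "K \<ge> 100" and Kcond: "\<And>D::nat. K \<le> D \<Longrightarrow> 4 ^ 40 \<le> D \<and> 2304000 \<le> \<epsilon> * D \<and>
    (\<forall>N. 4 ^ N \<le> D \<longrightarrow> (4 * real D ^ 2 + 1) ^ D * (2 * exp (- (\<epsilon> * D\<^sup>2 / (384 * 2 ^ N)))) \<le> 1 / 1000)"
    using large_dimension_condition[OF assms(1)] by blast
  define c where "c = min (1 / 2) (\<epsilon> / 768)"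
  \<comment> \<open>The summand \<open>K\<close> pays for the sign block, of weight
    \<open>K * d * ln d\<close>; the other one pays for the heavy-tailed block after
    \<open>N\<close> is bounded by a multiple of \<open>ln d\<close>. The
    \<open>2 * (real K)\<^sup>2\<close> added in \<open>C\<close> covers the
    \<open>2 * D\<^sup>2\<close> rows.\<close>
  define C0 where "C0 = K + 18000 * (2 * ln K + 1)"
  define C where "C = 2 * (real K)\<^sup>2 + C0"
  have lnK: "ln (real K) \<ge> 0" using K by simp
  have C0: "C0 \<ge> 0" using lnK by (simp add: C0_def)
  have c: "c > 0" using assms by (simp add: c_def)
  have C: "C > 0" using C0 K by (simp add: C_def add_pos_nonneg)
  have main: "\<exists>(r::nat) (M :: (nat \<Rightarrow> nat \<Rightarrow> real) measure).
         real r \<le> C * real d ^ 2 \<and>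
         prob_space M \<and> sets M = sets mat_space \<and>
         (AE P in M. \<forall>j<n. col_nnz r P j \<le> 2) \<and>
         (\<forall>j<n. (\<integral>\<^sup>+ P. ennreal (real (col_nnz r P j)) \<partial>M) \<le> ennreal (1 + \<epsilon>)) \<and>
         (\<forall>A :: nat \<Rightarrow> nat \<Rightarrow> real.
            \<exists>E \<in> sets M. measure M E \<ge> 0.99 \<and>
              (\<forall>P \<in> E. \<forall>x :: nat \<Rightarrow> real.
                 c * ln (real d) * l1norm n (mat_vec d A x)
                   \<le> l1norm r (mat_vec n P (mat_vec d A x)) \<and>
                 l1norm r (mat_vec n P (mat_vec d A x))
                   \<le> C * real d * ln (real d) * l1norm n (mat_vec d A x)))"
    if d: "d \<ge> 2" and n: "n \<ge> 1" for d n :: nat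
  proof -
    define D where "D = K * d"
    define R where "R = D\<^sup>2"
    have KD: "K \<le> D" using d by (simp add: D_def)
    note D = Kcond[OF KD]
    have "1 \<le> D" using KD K by linarith
    then obtain N where N: "4 ^ N \<le> D" "D < 4 ^ (N + 1)"
      using ex_power_ivl1[of 4 D] by auto
    have N40: "N \<ge> 40"
    proof (rule ccontr)
      assume "\<not> N \<ge> 40"
      hence "(4::nat) ^ (N + 1) \<le> 4 ^ 40" by (intro power_increasing) auto
      thus False using N D by linarith
    qed
    \<comment> \<open>The only parameter chosen in terms of \<open>n\<close>; neither the number of
      rows nor the distortion bounds contain it.\<close>
    obtain L where L: "48 * real n * N * 2 ^ N / (real D)\<^sup>2 < 2 ^ L"
      using real_arch_pow[of 2] by auto
    have D0: "real D > 0" using \<open>1 \<le> D\<close> by simp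
    have D100: "100 * d \<le> D" using K unfolding D_def by (intro mult_right_mono) auto
    have N2: "D < 4 ^ Suc N" using N(2) by simp
    have D_eps: "2304000 \<le> \<epsilon> * D" using D by blast
    have tail: "(4 * real D ^ 2 + 1) ^ D * (2 * exp (- (\<epsilon> * D\<^sup>2 / (384 * 2 ^ N)))) \<le> 1 / 1000"
      using D N(1) by blast
    have L': "48 * n * N * 2 ^ N \<le> (2::real) ^ L * D\<^sup>2"
      using L D0 by (simp add: divide_less_eq less_imp_le)
    define W where "W = D * ln d"
    have lnd: "ln (real d) \<ge> 1 / 2"
    proof -
      have "(1::real) / 2 \<le> ln 2" using ln2_ge_two_thirds by simp
      also have "\<dots> \<le> ln d" using d by simp
      finally show ?thesis .
    qed
    have W: "W \<ge> 0" using lnd by (simp add: W_def)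
    have R: "R > 0" using \<open>1 \<le> D\<close> by (simp add: R_def)
    define Q where "Q = sketch_pmf R (scale_pmf \<epsilon> L) {..<n}"
    define F where "F = sketch_matrix n R L W"
    define M where "M = distr (measure_pmf Q) mat_space F"
    have eps: "0 \<le> \<epsilon>" "\<epsilon> \<le> 1" using assms by auto
    have finQ: "finite (set_pmf Q)" unfolding Q_def using R eps by simp
    have F: "F \<in> measurable (measure_pmf Q) mat_space" by simp
    \<comment> \<open>Since \<open>ln d \<ge> 1 / 2\<close>, the additive \<open>ln K\<close> is at
      most \<open>2 * ln K * ln d\<close>, which turns the bound on \<open>N\<close> into a pure
      multiple of \<open>ln d\<close>.\<close>
    have NK: "N \<le> (2 * ln K + 1) * ln d"
    proof -
      have "real (4 ^ N) \<le> real (K * d)" using N by (simp only: of_nat_le_iff D_def)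
      hence "ln (real (4 ^ N)) \<le> ln (real (K * d))" by (subst ln_le_cancel_iff) (use K d in auto)
      hence 1: "N * ln 4 \<le> ln K + ln d" using K d by (simp add: ln_realpow ln_mult)
      have "(1::real) \<le> ln 4" using ln2_ge_two_thirds ln_realpow[of 2 2] by simp
      hence "real N * 1 \<le> N * ln 4" by (intro mult_left_mono) auto
      moreover have "ln K * (1 / 2) \<le> ln K * ln d" using lnK lnd by (intro mult_left_mono) auto
      ultimately show ?thesis using 1 by (simp add: algebra_simps)
    qed
    show ?thesis
    proof (intro exI[of _ "R + R"] exI[of _ M] conjI allI impI)
      have "real (R + R) = 2 * (real K)\<^sup>2 * (real d)\<^sup>2" by (simp add: R_def D_def power_mult_distrib)
      also have "\<dots> \<le> C * (real d)\<^sup>2" using C0 by (intro mult_right_mono) (auto simp: C_def)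
      finally show "real (R + R) \<le> C * real d ^ 2" .
      show "prob_space M" unfolding M_def by (intro measure_pmf.prob_space_distr F)
      show "sets M = sets mat_space" by (simp add: M_def)
      have AEF: "col_nnz (R + R) (F \<xi>) j \<le> 2" for \<xi> j
        using col_nnz_sketch_matrix[of R n L W \<xi> j] by (simp add: F_def split: if_splits)
      have pred: "{P \<in> space mat_space. \<forall>j<n. col_nnz (R + R) P j \<le> 2} \<in> sets mat_space"
      proof -
        note measurable_col_nnz [measurable]
        have "{P \<in> space mat_space. \<forall>j<n. real (col_nnz (R + R) P j) \<le> 2} \<in> sets mat_space" by measurable
        thus ?thesis by simp
      qed
      show "AE P in M. \<forall>j<n. col_nnz (R + R) P j \<le> 2"
        unfolding M_def by (subst AE_distr_iff[OF F pred]) (simp add: AEF)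
      show "(\<integral>\<^sup>+ P. ennreal (real (col_nnz (R + R) P j)) \<partial>M) \<le> ennreal (1 + \<epsilon>)" if j: "j < n" for j
        unfolding M_def
        by (subst nn_integral_distr[OF F])
          (use measurable_col_nnz expected_col_nnz[OF eps R j] in \<open>auto simp: F_def Q_def\<close>)
      fix A :: "nat \<Rightarrow> nat \<Rightarrow> real"
      obtain Good where G: "measure_pmf.prob Q Good \<ge> 0.99"
        and lower: "\<And>\<xi> x. \<xi> \<in> Good \<Longrightarrow> \<xi> \<in> set_pmf Q \<Longrightarrow> c * ln d * l1norm n (mat_vec d A x)
         \<le> D * ln d * sign_norm n R \<xi> (mat_vec d A x) + heavy_norm L n R \<xi> (mat_vec d A x)"
        and upper1: "\<And>\<xi> x. \<xi> \<in> Good \<Longrightarrow> \<xi> \<in> set_pmf Q \<Longrightarrow>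
          sign_norm n R \<xi> (mat_vec d A x) \<le> l1norm n (mat_vec d A x)"
        and upper2: "\<And>\<xi> x. \<xi> \<in> Good \<Longrightarrow> \<xi> \<in> set_pmf Q \<Longrightarrow>
          heavy_norm L n R \<xi> (mat_vec d A x) \<le> 18000 * d * N * l1norm n (mat_vec d A x)"
        using embedding_good_event[OF assms d n D100 N40 N(1) N2 D_eps tail L', of A, folded R_def c_def, folded Q_def]
        by blast
      show "\<exists>E \<in> sets M. measure M E \<ge> 0.99 \<and>
              (\<forall>P \<in> E. \<forall>x :: nat \<Rightarrow> real.
                 c * ln (real d) * l1norm n (mat_vec d A x)
                   \<le> l1norm (R + R) (mat_vec n P (mat_vec d A x)) \<and>
                 l1norm (R + R) (mat_vec n P (mat_vec d A x))
                   \<le> C * real d * ln (real d) * l1norm n (mat_vec d A x))"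
      \<comment> \<open>Intersecting with the support makes the image finite, hence measurable, at
        no loss of probability; the preimage of the image contains all good outcomes of the
        support.\<close>
      proof (intro bexI[of _ "F ` (Good \<inter> set_pmf Q)"] conjI ballI allI)
        have ev: "F ` (Good \<inter> set_pmf Q) \<in> sets mat_space" using finQ by (intro finite_in_sets_mat_space) auto
        thus "F ` (Good \<inter> set_pmf Q) \<in> sets M" by (simp add: M_def)
        have "measure_pmf.prob Q Good = measure_pmf.prob Q (Good \<inter> set_pmf Q)"
          by (rule measure_Int_set_pmf[symmetric])
        also have "\<dots> \<le> measure_pmf.prob Q (F -` (F ` (Good \<inter> set_pmf Q)))"
          by (intro measure_pmf.finite_measure_mono) auto
        also have "\<dots> = measure M (F ` (Good \<inter> set_pmf Q))"
          unfolding M_def by (subst measure_distr[OF F ev]) simp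
        finally show "measure M (F ` (Good \<inter> set_pmf Q)) \<ge> 0.99" using G by simp
        fix P x assume "P \<in> F ` (Good \<inter> set_pmf Q)"
        then obtain \<xi> where \<xi>: "\<xi> \<in> Good" "\<xi> \<in> set_pmf Q" "P = F \<xi>" by blast
        define y where "y = mat_vec d A x"
        have Y0: "l1norm n y \<ge> 0" by (simp add: l1norm_def sum_nonneg)
        have eq: "l1norm (R + R) (mat_vec n P y) = D * ln d * sign_norm n R \<xi> y + heavy_norm L n R \<xi> y"
          unfolding \<xi>(3) F_def using l1norm_sketch_matrix[OF W] by (simp add: W_def)
        show "c * ln (real d) * l1norm n (mat_vec d A x) \<le> l1norm (R + R) (mat_vec n P (mat_vec d A x))"
          using lower[OF \<xi>(1,2), of x] unfolding eq y_def[symmetric] by simp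
        have "D * ln d * sign_norm n R \<xi> y + heavy_norm L n R \<xi> y
            \<le> D * ln d * l1norm n y + 18000 * d * N * l1norm n y"
          unfolding y_def using upper1[OF \<xi>(1,2), of x] upper2[OF \<xi>(1,2), of x] lnd
          by (intro add_mono mult_left_mono) auto
        also have "\<dots> \<le> D * ln d * l1norm n y + 18000 * d * ((2 * ln K + 1) * ln d) * l1norm n y"
          by (rule add_left_mono, rule mult_right_mono[OF _ Y0]) (use mult_left_mono[OF NK, of "18000 * real d"] in simp)
        also have "\<dots> = C0 * (d * ln d * l1norm n y)" by (simp add: C0_def D_def algebra_simps)
        also have "\<dots> \<le> C * (d * ln d * l1norm n y)"
          using lnd Y0 by (intro mult_right_mono) (auto simp: C_def)
        finally show "l1norm (R + R) (mat_vec n P (mat_vec d A x)) \<le> C * real d * ln (real d) * l1norm n (mat_vec d A x)"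
          unfolding y_def[symmetric] eq by (simp add: mult_ac)
      qed
    qed
  qed
  show ?thesis using c C main by blast
qed

end
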